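(* Suppose that $\mathcal{G} : \mathbb{P}_k^r \dashrightarrow \mathbb{P}_k^{m_1}\times_k\cdots\times_k\mathbb{P}_k^{m_p}$ is generically finite. Then the following statements hold: (i) For all $\mathbf{d}\in\mathbb{N}^p$ with $|\mathbf{d}|=r$, we have the equality $$e\big(\mathbf{d},\widetilde{\mathfrak{F}}(I_1,\ldots,I_p)\big)=\deg(\mathcal{G})\cdot\deg_{\mathbb{P}}^{\mathbf{d}}(Y).$$ (ii) Under the additional condition that $\mathfrak{F}(I_1,\ldots,I_p)$ is integrally closed, $\mathcal{G}$ is birational if and only if $\widetilde{\mathfrak{F}}(I_1,\ldots,I_p)=\mathfrak{F}(I_1,\ldots,I_p)$.
   Context: Let $k$ be an arbitrary field, $R=k[x_0,\ldots,x_r]$ a standard graded polynomial ring, $\mathfrak{m}=(x_0,\ldots,x_r)$, and $p\ge 1$. For each $1\le i\le p$ let $\{f_{i,0},\ldots,f_{i,m_i}\}\subset R$ be a set of forms (not all zero) of the same degree $\delta_i\ge 1$, let $I_i=(f_{i,0},\ldots,f_{i,m_i})\subset R$, and let $\mathcal{G}_i:\mathbb{P}_k^r\dashrightarrow\mathbb{P}_k^{m_i}$ be the rational map $\mathbf{x}\mapsto(f_{i,0}(\mathbf{x}),\ldots,f_{i,m_i}(\mathbf{x}))$. Let $\mathcal{G}=(\mathcal{G}_1,\ldots,\mathcal{G}_p):\mathbb{P}_k^r\dashrightarrow\mathbb{P}:=\mathbb{P}_k^{m_1}\times_k\cdots\times_k\mathbb{P}_k^{m_p}$ and let $Y\subset\mathbb{P}$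 be the closure of the image of $\mathcal{G}$. Notation: for $\mathbf{n}=(n_1,\ldots,n_p)\in\mathbb{N}^p$, $|\mathbf{n}|=n_1+\cdots+n_p$, $\mathbf{n}\cdot\delta=n_1\delta_1+\cdots+n_p\delta_p$ and $\mathbf{I}^{\mathbf{n}}=I_1^{n_1}\cdots I_p^{n_p}$; $[\cdot]_j$ denotes the degree-$j$ graded part. Special fiber ring: $\mathfrak{F}(I_1,\ldots,I_p)=\bigoplus_{\mathbf{n}\in\mathbb{N}^p}[\mathbf{I}^{\mathbf{n}}]_{\mathbf{n}\cdot\delta}$, a standard $\mathbb{N}^p$-graded $k$-algebra; it is the multihomogeneous coordinate ring of $Y$. Saturated special fiber ring: $\widetilde{\mathfrak{F}}(I_1,\ldots,I_p)=\bigoplus_{\mathbf{n}\in\mathbb{N}^p}\big[(\mathbf{I}^{\mathbf{n}}:_R\mathfrak{m}^\infty)\big]_{\mathbf{n}\cdot\delta}$, an $\mathbb{N}^p$-graded $k$-algebra containing $\mathfrak{F}(I_1,\ldots,I_p)$; it is a finitely generated graded $\mathfrak{F}(I_1,\ldots,I_p)$-module. Mixed multiplicities: for a finitely generated $\mathbb{Z}^p$-graded module $M$ over $\mathfrak{F}(I_1,\ldots,I_p)$, let $P_M(\mathbf{t})\in\mathbb{Q}[t_1,\ldots,t_p]$ be its Hilbert polynomial, $P_M(\nu)=\dim_k[M]_\nu$ for $\nu\gg\mathbf{0}$; it has degree at most $r$. Writing $P_M(\mathbf{t})=\sum_{\mathbf{d}}e(\mathbf{d})\binom{t_1+d_1}{d_1}\cdots\binom{t_p+d_p}{d_p}$,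 set $e(\mathbf{d},M):=e(\mathbf{d})$ for $|\mathbf{d}|=r$. The multidegree of $Y$ of type $\mathbf{d}$ is $\deg_{\mathbb{P}}^{\mathbf{d}}(Y):=e(\mathbf{d},\mathfrak{F}(I_1,\ldots,I_p))$. $\mathcal{G}$ is generically finite if $[K(\mathbb{P}_k^r):K(Y)]<\infty$ (equivalently $\dim Y=r$), where $K(\cdot)$ denotes the field of rational functions; then $\deg(\mathcal{G}):=[K(\mathbb{P}_k^r):K(Y)]$, and $\mathcal{G}$ is birational if $\deg(\mathcal{G})=1$. *)

theory Defs
  imports
    "HOL-Library.Poly_Mapping"
    "HOL-Computational_Algebra.Computational_Algebra"
    "HOL-Algebra.Embedded_Algebras"
    "HOL-Algebra.Algebraic_Closure_Type"
begin

section \<open>Multivariate polynomials and forms\<close>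

text \<open>
  A polynomial is a finitely supported map from exponent vectors to coefficients.  The standard
  graded ring \<open>R = k[x\<^sub>0, \<dots>, x\<^sub>r]\<close> is the whole type \<open>('v, 'k) mpol\<close> when \<open>'v\<close>
  has \<open>r + 1\<close> elements.
  An order on the variables is only required because the library's \<open>idom\<close> instance (hence the
  type of fractions) asks for one; it plays no role in the definitions.
\<close>

type_synonym ('x, 'c) mpol = "('x \<Rightarrow>\<^sub>0 nat) \<Rightarrow>\<^sub>0 'c"

definition Const :: "'c::zero \<Rightarrow> ('x, 'c) mpol" where
  "Const c = Poly_Mapping.single 0 c"

definition Var :: "'x \<Rightarrow> ('x, 'c::zero_neq_one) mpol" where
  "Var x = Poly_Mapping.single (Poly_Mapping.single x 1) 1"

text \<open>Evaluation at \<open>g\<close> after mapping the coefficients by \<open>h\<close>.\<close>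

definition mpol_eval :: "('c \<Rightarrow> 'b) \<Rightarrow> ('x \<Rightarrow> 'b) \<Rightarrow> ('x, 'c::zero) mpol \<Rightarrow> 'b::comm_semiring_1" where
  "mpol_eval h g P =
     (\<Sum>\<mu>\<in>Poly_Mapping.keys P. h (Poly_Mapping.lookup P \<mu>) * (\<Prod>x\<in>Poly_Mapping.keys \<mu>. g x ^ Poly_Mapping.lookup \<mu> x))"

definition homogeneous :: "nat \<Rightarrow> ('v::finite, 'c::zero) mpol \<Rightarrow> bool" where
  "homogeneous j g \<longleftrightarrow> (\<forall>\<mu>\<in>Poly_Mapping.keys g. (\<Sum>x\<in>UNIV. Poly_Mapping.lookup \<mu> x) = j)"

definition graded_part :: "nat \<Rightarrow> ('v::finite, 'c::zero) mpol set \<Rightarrow> ('v, 'c) mpol set" where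
  "graded_part j J = {g \<in> J. homogeneous j g}"

lemma vector_space_mpol:
  "vector_space (\<lambda>(c::'c::field) (g::('v, 'c) mpol). Const c * g)"
  by unfold_locales
    (auto simp: Const_def algebra_simps single_add mult_single simp flip: mult.assoc)

definition kdim :: "('v, 'k::field) mpol set \<Rightarrow> nat" where
  "kdim V = vector_space.dim (\<lambda>(c::'k) (g::('v, 'k) mpol). Const c * g) V"

section \<open>Ideals\<close>

lemma module_ring: "Modules.module ((*) :: 'a::comm_ring_1 \<Rightarrow> 'a \<Rightarrow> 'a)"
  by unfold_locales (auto simp: algebra_simps)

definition gen_ideal :: "'a::comm_ring_1 set \<Rightarrow> 'a set" where
  "gen_ideal S = Modules.module.span (*) S"

definition ideal_power :: "'a::comm_ring_1 set \<Rightarrow> nat \<Rightarrow> 'a set" where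
  "ideal_power J s = gen_ideal {(\<Prod>l<s. a l) | a. \<forall>l<s. a l \<in> J}"

text \<open>\<open>I\<^sub>1\<^bsup>n\<^sub>1\<^esup> \<cdots> I\<^sub>p\<^bsup>n\<^sub>p\<^esup>\<close>\<close>

definition ideal_multipower :: "('p::finite \<Rightarrow> 'a::comm_ring_1 set) \<Rightarrow> ('p \<Rightarrow> nat) \<Rightarrow> 'a set" where
  "ideal_multipower I n = gen_ideal {(\<Prod>i\<in>UNIV. a i) | a. \<forall>i. a i \<in> ideal_power (I i) (n i)}"

definition irrelevant_ideal :: "('v, 'k::field) mpol set" where
  "irrelevant_ideal = gen_ideal (range Var)"

definition saturation :: "('v, 'k::field) mpol set \<Rightarrow> ('v, 'k) mpol set" where
  "saturation J = {g. \<exists>s. \<forall>h \<in> ideal_power irrelevant_ideal s. g * h \<in> J}"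

section \<open>The special fiber ring and its saturation\<close>

text \<open>
  The data are \<open>m :: 'p \<Rightarrow> nat\<close>, \<open>\<delta> :: 'p \<Rightarrow> nat\<close> and the forms \<open>f i j\<close> with \<open>j \<le> m i\<close>; values of
  \<open>f i j\<close> for \<open>j > m i\<close> are never used.  The indices \<open>1, \<dots>, p\<close> are the elements of the finite type
  \<open>'p\<close>.  An \<open>\<nat>\<^sup>p\<close>-graded algebra inside \<open>R[T\<^sub>1, \<dots>, T\<^sub>p]\<close> is given by its family of components
  \<open>M n \<subseteq> R\<close>.
\<close>

definition form_ideal :: "('p \<Rightarrow> nat) \<Rightarrow> ('p \<Rightarrow> nat \<Rightarrow> ('v, 'k::field) mpol) \<Rightarrow> 'p \<Rightarrow> ('v, 'k) mpol set"
  where "form_ideal m f i = gen_ideal {f i j | j. j \<le> m i}"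

definition special_fiber ::
  "('p::finite \<Rightarrow> nat) \<Rightarrow> ('p \<Rightarrow> nat) \<Rightarrow> ('p \<Rightarrow> nat \<Rightarrow> ('v::finite, 'k::field) mpol)
    \<Rightarrow> ('p \<Rightarrow> nat) \<Rightarrow> ('v, 'k) mpol set" where
  "special_fiber m \<delta> f n =
     graded_part (\<Sum>i\<in>UNIV. n i * \<delta> i) (ideal_multipower (form_ideal m f) n)"

definition saturated_special_fiber ::
  "('p::finite \<Rightarrow> nat) \<Rightarrow> ('p \<Rightarrow> nat) \<Rightarrow> ('p \<Rightarrow> nat \<Rightarrow> ('v::finite, 'k::field) mpol)
    \<Rightarrow> ('p \<Rightarrow> nat) \<Rightarrow> ('v, 'k) mpol set" where
  "saturated_special_fiber m \<delta> f n =
     graded_part (\<Sum>i\<in>UNIV. n i * \<delta> i) (saturation (ideal_multipower (form_ideal m f) n))"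

text \<open>The ring \<open>\<Oplus>\<^sub>n M n \<cdot> T\<^sup>n\<close> as a subset of \<open>R[T\<^sub>1, \<dots>, T\<^sub>p]\<close>.\<close>

definition multigraded_ring ::
  "(('p \<Rightarrow> nat) \<Rightarrow> ('v, 'k::field) mpol set) \<Rightarrow> ('p, ('v, 'k) mpol) mpol set" where
  "multigraded_ring M = {h. \<forall>\<mu>. Poly_Mapping.lookup h \<mu> \<in> M (Poly_Mapping.lookup \<mu>)}"

text \<open>A subring \<open>A\<close> of a domain is integrally closed if it is so in its own field of fractions.\<close>

definition integral_over :: "'b::field set \<Rightarrow> 'b \<Rightarrow> bool" where
  "integral_over B z \<longleftrightarrow>
     (\<exists>q. lead_coeff q = 1 \<and> (\<forall>i. Polynomial.coeff q i \<in> B) \<and> poly q z = 0)"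

definition integrally_closed :: "'a::idom set \<Rightarrow> bool" where
  "integrally_closed A \<longleftrightarrow>
     (\<forall>a\<in>A. \<forall>b\<in>A. b \<noteq> 0 \<longrightarrow> integral_over (to_fract ` A) (Fract a b)
        \<longrightarrow> Fract a b \<in> to_fract ` A)"

section \<open>Mixed multiplicities\<close>

definition is_hilbert_polynomial ::
  "(('p::finite \<Rightarrow> nat) \<Rightarrow> ('v, 'k::field) mpol set) \<Rightarrow> ('p, rat) mpol \<Rightarrow> bool" where
  "is_hilbert_polynomial M P \<longleftrightarrow>
     (\<exists>\<nu>0. \<forall>\<nu>. (\<forall>i. \<nu>0 i \<le> \<nu> i) \<longrightarrow>
        mpol_eval id (\<lambda>i. of_nat (\<nu> i)) P = of_nat (kdim (M \<nu>)))"

definition hilbert_polynomial ::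
  "(('p::finite \<Rightarrow> nat) \<Rightarrow> ('v, 'k::field) mpol set) \<Rightarrow> ('p, rat) mpol" where
  "hilbert_polynomial M = (THE P. is_hilbert_polynomial M P)"

text \<open>The polynomial \<open>binom (t\<^sub>i + d) d\<close>.\<close>

definition binomial_mpol :: "'p \<Rightarrow> nat \<Rightarrow> ('p, rat) mpol" where
  "binomial_mpol i d = Const (1 / fact d) * (\<Prod>j=1..d. Var i + Const (of_nat j))"

text \<open>
  The coefficients of the Hilbert polynomial in the basis of products of such binomials; the one
  at \<open>d\<close> is the mixed multiplicity of type \<open>d\<close> when \<open>\<bar>d\<bar> = r\<close>.
\<close>

definition mixed_multiplicity ::
  "('p::finite \<Rightarrow> nat) \<Rightarrow> (('p \<Rightarrow> nat) \<Rightarrow> ('v, 'k::field) mpol set) \<Rightarrow> rat" where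
  "mixed_multiplicity d M =
     (THE e. finite {c. e c \<noteq> 0} \<and>
        hilbert_polynomial M =
          (\<Sum>c | e c \<noteq> 0. Const (e c) * (\<Prod>i\<in>UNIV. binomial_mpol i (c i)))) d"

section \<open>The rational map and its degree\<close>

text \<open>
  The product of the \<open>\<P>\<^bsup>m\<^sub>i\<^esup>\<close> has homogeneous coordinates \<open>y\<^bsub>i,j\<^esub>\<close>, \<open>j \<le> m i\<close>.
  \<open>multiform m n A\<close>: \<open>A\<close> is a form of multidegree \<open>n\<close> in them.
\<close>

definition multiform :: "('p \<Rightarrow> nat) \<Rightarrow> ('p \<Rightarrow> nat) \<Rightarrow> ('p \<times> nat, 'k::field) mpol \<Rightarrow> bool" where
  "multiform m n A \<longleftrightarrow>
     (\<forall>\<mu>\<in>Poly_Mapping.keys A. (\<forall>(i, j)\<in>Poly_Mapping.keys \<mu>. j \<le> m i) \<and> (\<forall>i. (\<Sum>j\<le>m i. Poly_Mapping.lookup \<mu> (i, j)) = n i))"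

text \<open>Pullback of a form along the map given by \<open>f\<close>: substitute \<open>f i j\<close> for \<open>y\<^bsub>i,j\<^esub>\<close>.\<close>

definition pullback ::
  "('p \<Rightarrow> nat \<Rightarrow> ('v, 'k::field) mpol) \<Rightarrow> ('p \<times> nat, 'k) mpol \<Rightarrow> ('v, 'k) mpol" where
  "pullback f A = mpol_eval Const (\<lambda>(i, j). f i j) A"

text \<open>
  \<open>Y\<close>, the (integral) closure of the image, is the closed subscheme cut out by the forms whose
  pullback is zero.  A rational function on \<open>Y\<close> is the restriction of a quotient \<open>A/B\<close> of two forms of
  equal multidegree, \<open>B\<close> not vanishing on \<open>Y\<close>; \<open>K(Y)\<close> is regarded as a subfield of
  \<open>K(\<P>\<^sup>r) \<subseteq> Frac R\<close> by pulling back.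
\<close>

definition vanishes_on_image_closure ::
  "('p \<Rightarrow> nat \<Rightarrow> ('v, 'k::field) mpol) \<Rightarrow> ('p \<times> nat, 'k) mpol \<Rightarrow> bool" where
  "vanishes_on_image_closure f B \<longleftrightarrow> pullback f B = 0"

definition function_field_image ::
  "('p \<Rightarrow> nat) \<Rightarrow> ('p \<Rightarrow> nat \<Rightarrow> ('v::linorder, 'k::field) mpol) \<Rightarrow> ('v, 'k) mpol fract set" where
  "function_field_image m f =
     {Fract (pullback f A) (pullback f B) | A B n.
        multiform m n A \<and> multiform m n B \<and> \<not> vanishes_on_image_closure f B}"

definition function_field_proj :: "('v::{finite,linorder}, 'k::field) mpol fract set" where
  "function_field_proj =
     {Fract a b | a b j. homogeneous j a \<and> homogeneous j b \<and> b \<noteq> 0}"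

definition generically_finite ::
  "('p \<Rightarrow> nat) \<Rightarrow> ('p \<Rightarrow> nat \<Rightarrow> ('v::{finite,linorder}, 'k::field) mpol) \<Rightarrow> bool" where
  "generically_finite m f \<longleftrightarrow>
     ring.finite_dimension ring_of_type_algebra (function_field_image m f)
       (function_field_proj :: ('v, 'k) mpol fract set)"

definition map_degree ::
  "('p \<Rightarrow> nat) \<Rightarrow> ('p \<Rightarrow> nat \<Rightarrow> ('v::{finite,linorder}, 'k::field) mpol) \<Rightarrow> nat" where
  "map_degree m f =
     ring.dim ring_of_type_algebra (function_field_image m f)
       (function_field_proj :: ('v, 'k) mpol fract set)"

definition birational_map ::
  "('p \<Rightarrow> nat) \<Rightarrow> ('p \<Rightarrow> nat \<Rightarrow> ('v::{finite,linorder}, 'k::field) mpol) \<Rightarrow> bool" where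
  "birational_map m f \<longleftrightarrow> generically_finite m f \<and> map_degree m f = 1"

text \<open>The special fiber ring is the multihomogeneous coordinate ring of \<open>Y\<close>.\<close>

definition multidegree_image ::
  "('p::finite \<Rightarrow> nat) \<Rightarrow> ('p \<Rightarrow> nat) \<Rightarrow> ('p \<Rightarrow> nat) \<Rightarrow> ('p \<Rightarrow> nat \<Rightarrow> ('v::finite, 'k::field) mpol) \<Rightarrow> rat"
  where "multidegree_image d m \<delta> f = mixed_multiplicity d (special_fiber m \<delta> f)"

end

theory Submission
  imports Defs "HOL-Library.List_Lexorder"
begin

text \<open>
  Let \<open>D\<close> be the degree of the map, \<open>\<FF>\<close> the special fiber ring and \<open>\<FF>'\<close> its saturation, with Hilbert
  functions \<open>h\<close> and \<open>h'\<close>.  Everything takes place in the Rees algebra, whose component in bidegree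
  \<open>(e, n)\<close> is spanned by the products \<open>x\<^sup>a f\<^sup>b\<close> with \<open>\<bar>a\<bar> = e\<close> and \<open>b\<close> of multidegree \<open>n\<close>; it consists of the
  forms of degree \<open>n\<cdot>\<delta> + e\<close> in \<open>\<^bold>I\<^sup>n\<close>.  The components with \<open>e = 0\<close> form \<open>\<FF>\<close>, and a form \<open>g\<close> of degree
  \<open>n\<cdot>\<delta>\<close> belongs to \<open>\<FF>'\<close> iff, for some \<open>s\<close>, all forms of degree \<open>s\<close> multiply it into bidegree \<open>(s, n)\<close>.

  For the multiplicities it suffices to find shifts \<open>a\<close>, \<open>b\<close> with
  \<open>D h(n) \<le> h'(n + a)\<close> and \<open>h'(n) \<le> D h(n + b)\<close>: both functions are eventually polynomial and \<open>h\<close> has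
  degree at most \<open>r\<close>, so that a shift does not affect the part of degree \<open>r\<close>, and the two parts of
  degree \<open>r\<close> differ by the factor \<open>D\<close> (\<open>leading_coefficients_proportional\<close>).  Take a basis
  \<open>p\<^sub>i / x\<^sup>d\<close>, \<open>i < D\<close>, of the field extension, with forms \<open>p\<^sub>i\<close> and a variable \<open>x\<close>
  (\<open>basis_of_forms\<close>).

  The first inequality: expanding \<open>u / x\<^bsup>2d\<^esup>\<close> in this basis for the forms \<open>u\<close> of degree \<open>2d\<close> and clearing
  denominators gives a nonzero \<open>a\<close> in \<open>\<FF>\<close> such that \<open>a u\<close> is always \<open>x\<^sup>d\<close> times an element of the Rees
  algebra.  Hence the \<open>a p\<^sub>i / x\<^sup>d\<close> are polynomials and lie in \<open>\<FF>'\<close>; they are independent over \<open>\<FF>\<close>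
  (\<open>independent_saturated_elements\<close>).

  The second inequality rests on \<open>uniform_saturation\<close>: one power \<open>x\<^sup>E\<close> multiplies every component of
  \<open>\<FF>'\<close> into the Rees algebra.  Indeed the ideal \<open>(x) : \<mm>\<^sup>\<infinity>\<close> of the Rees algebra is finitely generated, so
  that for large \<open>e\<close> its elements are divisible by \<open>x\<close>, and a power of \<open>x\<close> that works can be
  lowered step by step until it is \<open>E\<close>.  Expanding the forms of degree \<open>E\<close> in the basis then embeds \<open>\<FF>'\<close>,
  up to a shift, in a sum of \<open>D\<close> copies of \<open>\<FF>\<close>.  Multiplication by \<open>x\<^sup>E\<close> also identifies \<open>\<FF>'\<close> with an
  \<open>\<FF>\<close>-submodule of the finitely generated module formed by the
  components with \<open>e = E\<close>, whence its Hilbert function is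
  eventually polynomial.

  Noetherianity and polynomiality both come from leading exponents.  Order the monomials in the
  generators; those that lead an element of a given graded submodule form a set closed under
  multiplication by monomials.  By Dickson's lemma this set is finitely generated, which bounds the
  generators of the submodule (\<open>finitely_generated\<close>), and inclusion-exclusion over cones counts its
  elements by a polynomial (\<open>hilbert_function_eventually_polynomial\<close>).

  For the second part, an element \<open>g\<close> of \<open>\<FF>'\<close> is integral over \<open>\<FF>\<close>, because the products \<open>x\<^sup>s g\<^sup>i\<close> all lie in
  one finitely generated module (\<open>saturated_element_integral\<close>).  If \<open>D = 1\<close>, it is also a fraction of
  elements of \<open>\<FF>\<close>, so it lies in \<open>\<FF>\<close> if \<open>\<FF>\<close> is integrally closed.  Conversely, if \<open>\<FF>' = \<FF>\<close> and \<open>D > 1\<close>, then two of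
  the independent elements \<open>g\<^sub>0\<close>, \<open>g\<^sub>1\<close> of \<open>\<FF>'\<close> would be elements of \<open>\<FF>\<close> with \<open>g\<^sub>1 g\<^sub>0 - g\<^sub>0 g\<^sub>1 = 0\<close>.
\<close>

section \<open>Evaluation of polynomials\<close>

definition monomial_value :: "('x \<Rightarrow> 'b) \<Rightarrow> ('x \<Rightarrow>\<^sub>0 nat) \<Rightarrow> 'b::comm_semiring_1" where
  "monomial_value g \<mu> = (\<Prod>x\<in>Poly_Mapping.keys \<mu>. g x ^ Poly_Mapping.lookup \<mu> x)"

lemma monomial_value_superset:
  assumes "finite S" "Poly_Mapping.keys \<mu> \<subseteq> S"
  shows "monomial_value g \<mu> = (\<Prod>x\<in>S. g x ^ Poly_Mapping.lookup \<mu> x)"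
  unfolding monomial_value_def
  by (rule prod.mono_neutral_left) (use assms in \<open>auto simp: in_keys_iff\<close>)

lemma monomial_value_add: "monomial_value g (\<mu> + \<nu>) = monomial_value g \<mu> * monomial_value g \<nu>"
proof -
  let ?S = "Poly_Mapping.keys \<mu> \<union> Poly_Mapping.keys \<nu>"
  have "Poly_Mapping.keys (\<mu> + \<nu>) \<subseteq> ?S" by (rule keys_add)
  then have "monomial_value g (\<mu> + \<nu>) = (\<Prod>x\<in>?S. g x ^ Poly_Mapping.lookup (\<mu> + \<nu>) x)"
    by (intro monomial_value_superset) auto
  also have "\<dots> = (\<Prod>x\<in>?S. g x ^ Poly_Mapping.lookup \<mu> x) * (\<Prod>x\<in>?S. g x ^ Poly_Mapping.lookup \<nu> x)"
    by (simp add: lookup_add power_add prod.distrib)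
  also have "\<dots> = monomial_value g \<mu> * monomial_value g \<nu>"
    by (subst (1 2) monomial_value_superset[of ?S]) auto
  finally show ?thesis .
qed

lemma monomial_value_0 [simp]: "monomial_value g 0 = 1"
  by (simp add: monomial_value_def)

lemma monomial_value_single [simp]: "monomial_value g (Poly_Mapping.single x n) = g x ^ n"
  by (simp add: monomial_value_def)

lemma mpol_eval_alt: "mpol_eval h g P =
  (\<Sum>\<mu>\<in>Poly_Mapping.keys P. h (Poly_Mapping.lookup P \<mu>) * monomial_value g \<mu>)"
  by (simp add: mpol_eval_def monomial_value_def)

lemma mpol_eval_superset:
  assumes "finite S" "Poly_Mapping.keys P \<subseteq> S" "h 0 = 0"
  shows "mpol_eval h g P = (\<Sum>\<mu>\<in>S. h (Poly_Mapping.lookup P \<mu>) * monomial_value g \<mu>)"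
  unfolding mpol_eval_alt
  by (rule sum.mono_neutral_left) (use assms in \<open>auto simp: in_keys_iff\<close>)

lemma poly_mapping_sum_singles:
  "P = (\<Sum>\<mu>\<in>Poly_Mapping.keys P. Poly_Mapping.single \<mu> (Poly_Mapping.lookup P \<mu>))"
  by (rule poly_mapping_eqI) (simp add: lookup_sum lookup_single when_def in_keys_iff)

locale coefficient_hom =
  fixes h :: "'c::comm_semiring_1 \<Rightarrow> 'b::comm_semiring_1"
  assumes hom_0 [simp]: "h 0 = 0" and hom_1 [simp]: "h 1 = 1"
    and hom_add: "h (a + b) = h a + h b" and hom_mult: "h (a * b) = h a * h b"
begin

lemma eval_0 [simp]: "mpol_eval h g 0 = 0"
  by (simp add: mpol_eval_alt)

lemma eval_single: "mpol_eval h g (Poly_Mapping.single \<mu> c) = h c * monomial_value g \<mu>"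
  by (simp add: mpol_eval_alt)

lemma eval_Const [simp]: "mpol_eval h g (Const c) = h c"
  by (simp add: Const_def eval_single)

lemma eval_Var [simp]: "mpol_eval h g (Var x) = g x"
  by (simp add: Var_def eval_single)

lemma eval_add: "mpol_eval h g (P + Q) = mpol_eval h g P + mpol_eval h g Q"
proof -
  let ?S = "Poly_Mapping.keys P \<union> Poly_Mapping.keys Q"
  have "Poly_Mapping.keys (P + Q) \<subseteq> ?S" by (rule keys_add)
  then show ?thesis
    by (subst (1 2 3) mpol_eval_superset[of ?S])
      (auto simp: lookup_add hom_add algebra_simps sum.distrib)
qed

lemma eval_sum: "mpol_eval h g (\<Sum>a\<in>A. P a) = (\<Sum>a\<in>A. mpol_eval h g (P a))"
  by (induction A rule: infinite_finite_induct) (auto simp: eval_add)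

lemma eval_mult: "mpol_eval h g (P * Q) = mpol_eval h g P * mpol_eval h g Q"
proof -
  have "P * Q = (\<Sum>\<mu>\<in>Poly_Mapping.keys P. \<Sum>\<nu>\<in>Poly_Mapping.keys Q.
      Poly_Mapping.single (\<mu> + \<nu>) (Poly_Mapping.lookup P \<mu> * Poly_Mapping.lookup Q \<nu>))"
    by (subst (1) poly_mapping_sum_singles[of P], subst (1) poly_mapping_sum_singles[of Q])
      (simp add: sum_product mult_single)
  then have "mpol_eval h g (P * Q) = (\<Sum>\<mu>\<in>Poly_Mapping.keys P. \<Sum>\<nu>\<in>Poly_Mapping.keys Q.
      (h (Poly_Mapping.lookup P \<mu>) * monomial_value g \<mu>) *
      (h (Poly_Mapping.lookup Q \<nu>) * monomial_value g \<nu>))"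
    by (simp add: eval_sum eval_single hom_mult monomial_value_add mult_ac)
  then show ?thesis
    by (simp add: mpol_eval_alt sum_product)
qed

lemma eval_prod: "mpol_eval h g (\<Prod>a\<in>A. P a) = (\<Prod>a\<in>A. mpol_eval h g (P a))"
proof (induction A rule: infinite_finite_induct)
  case empty
  have "mpol_eval h g (Const 1) = 1" by simp
  then show ?case by (simp add: Const_def)
next
  case (infinite A)
  have "mpol_eval h g (Const 1) = 1" by simp
  with infinite show ?case by (simp add: Const_def)
qed (auto simp: eval_mult)

end

interpretation rat_eval: coefficient_hom "id :: rat \<Rightarrow> rat"
  by unfold_locales auto

lemma Const_add: "Const (a + b) = Const a + Const b"
  by (simp add: Const_def single_add)

lemma Const_mult: "Const (a * b) = Const a * (Const b :: ('x, 'c::semiring_0) mpol)"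
  by (simp add: Const_def mult_single)

lemma Const_0 [simp]: "Const 0 = 0"
  by (simp add: Const_def)

lemma Const_1 [simp]: "Const 1 = 1"
  by (simp add: Const_def)

lemma lookup_Const_mult:
  "Poly_Mapping.lookup (Const c * (P :: ('x, 'c::comm_semiring_1) mpol)) \<mu>
    = c * Poly_Mapping.lookup P \<mu>"
proof -
  have "Const c * P = (\<Sum>\<nu>\<in>Poly_Mapping.keys P. Poly_Mapping.single \<nu> (c * Poly_Mapping.lookup P \<nu>))"
    by (subst (1) poly_mapping_sum_singles[of P]) (simp add: Const_def sum_distrib_left mult_single)
  then show ?thesis
    by (simp add: lookup_sum lookup_single when_def in_keys_iff)
qed

section \<open>Polynomial functions in the binomial basis\<close>

definition binomial_product :: "('p::finite \<Rightarrow> nat) \<Rightarrow> ('p \<Rightarrow> nat) \<Rightarrow> rat" where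
  "binomial_product c \<nu> = (\<Prod>i\<in>UNIV. of_nat ((\<nu> i + c i) choose c i))"

text \<open>
  The functions \<open>binomial_product c\<close> are the basis in which mixed multiplicities are
  read off. It is also the convenient basis for counting, since differences and shifts act on it
  by Pascal's rule.
\<close>

definition binomial_sum :: "(('p::finite \<Rightarrow> nat) \<Rightarrow> rat) \<Rightarrow> ('p \<Rightarrow> nat) \<Rightarrow> rat" where
  "binomial_sum e \<nu> = (\<Sum>c | e c \<noteq> 0. e c * binomial_product c \<nu>)"

definition finite_support :: "('a \<Rightarrow> 'b::zero) \<Rightarrow> bool" where
  "finite_support e \<longleftrightarrow> finite {c. e c \<noteq> 0}"

lemma binomial_sum_superset:
  assumes "finite S" "{c. e c \<noteq> 0} \<subseteq> S"
  shows "binomial_sum e \<nu> = (\<Sum>c\<in>S. e c * binomial_product c \<nu>)"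
  unfolding binomial_sum_def by (rule sum.mono_neutral_left) (use assms in auto)

lemma finite_support_linear:
  fixes a b :: rat
  assumes "finite_support e" "finite_support e'"
  shows "finite_support (\<lambda>c. a * e c + b * e' c)"
proof -
  have "{c. a * e c + b * e' c \<noteq> 0} \<subseteq> {c. e c \<noteq> 0} \<union> {c. e' c \<noteq> 0}" by auto
  then show ?thesis
    using assms unfolding finite_support_def by (meson finite_UnI finite_subset)
qed

lemma binomial_sum_linear:
  assumes "finite_support e" "finite_support e'"
  shows "binomial_sum (\<lambda>c. a * e c + b * e' c) \<nu> = a * binomial_sum e \<nu> + b * binomial_sum e' \<nu>"
proof -
  let ?S = "{c. e c \<noteq> 0} \<union> {c. e' c \<noteq> 0}"
  have "finite ?S" using assms by (auto simp: finite_support_def)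
  then show ?thesis
    by (subst (1 2 3) binomial_sum_superset[of ?S])
      (auto simp: sum.distrib algebra_simps sum_distrib_left)
qed

definition eventually_polynomial :: "(('p::finite \<Rightarrow> nat) \<Rightarrow> rat) \<Rightarrow> bool" where
  "eventually_polynomial h \<longleftrightarrow>
     (\<exists>e \<nu>0. finite_support e \<and> (\<forall>\<nu>. (\<forall>i. \<nu>0 i \<le> \<nu> i) \<longrightarrow> h \<nu> = binomial_sum e \<nu>))"

lemma eventually_polynomial_linear:
  assumes "eventually_polynomial h" "eventually_polynomial h'"
  shows "eventually_polynomial (\<lambda>\<nu>. a * h \<nu> + b * h' \<nu>)"
proof -
  obtain e \<nu>0 where e: "finite_support e" "\<And>\<nu>. (\<forall>i. \<nu>0 i \<le> \<nu> i) \<Longrightarrow> h \<nu> = binomial_sum e \<nu>"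
    using assms(1) unfolding eventually_polynomial_def by blast
  obtain e' \<nu>1 where e': "finite_support e'" "\<And>\<nu>. (\<forall>i. \<nu>1 i \<le> \<nu> i) \<Longrightarrow> h' \<nu> = binomial_sum e' \<nu>"
    using assms(2) unfolding eventually_polynomial_def by blast
  show ?thesis
    unfolding eventually_polynomial_def
    by (rule exI[of _ "\<lambda>c. a * e c + b * e' c"], rule exI[of _ "\<lambda>i. max (\<nu>0 i) (\<nu>1 i)"])
      (use e e' in \<open>auto simp: finite_support_linear binomial_sum_linear\<close>)
qed

lemma eventually_polynomial_cong:
  assumes "eventually_polynomial h" "\<And>\<nu>. (\<forall>i. \<nu>1 i \<le> \<nu> i) \<Longrightarrow> h' \<nu> = h \<nu>"
  shows "eventually_polynomial h'"
proof -
  obtain e \<nu>0 where e: "finite_support e" "\<And>\<nu>. (\<forall>i. \<nu>0 i \<le> \<nu> i) \<Longrightarrow> h \<nu> = binomial_sum e \<nu>"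
    using assms(1) unfolding eventually_polynomial_def by blast
  show ?thesis
    unfolding eventually_polynomial_def
    by (rule exI[of _ e], rule exI[of _ "\<lambda>i. max (\<nu>0 i) (\<nu>1 i)"])
      (use e assms(2) in auto)
qed

lemma eventually_polynomial_0: "eventually_polynomial (\<lambda>_. 0)"
  unfolding eventually_polynomial_def
  by (rule exI[of _ "\<lambda>_. 0"]) (auto simp: finite_support_def binomial_sum_def)

lemma eventually_polynomial_add:
  "eventually_polynomial h \<Longrightarrow> eventually_polynomial h' \<Longrightarrow> eventually_polynomial (\<lambda>\<nu>. h \<nu> + h' \<nu>)"
  using eventually_polynomial_linear[of h h' 1 1] by simp

lemma eventually_polynomial_diff:
  "eventually_polynomial h \<Longrightarrow> eventually_polynomial h' \<Longrightarrow> eventually_polynomial (\<lambda>\<nu>. h \<nu> - h' \<nu>)"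
  using eventually_polynomial_linear[of h h' 1 "-1"] by simp

lemma eventually_polynomial_sum:
  assumes "\<And>a. a \<in> A \<Longrightarrow> eventually_polynomial (h a)"
  shows "eventually_polynomial (\<lambda>\<nu>. \<Sum>a\<in>A. h a \<nu>)"
  using assms
  by (induction A rule: infinite_finite_induct)
    (auto simp: eventually_polynomial_0 intro: eventually_polynomial_add)

lemma binomial_sum_delta: "binomial_sum (\<lambda>c'. if c' = c then a else 0) \<nu> = a * binomial_product c \<nu>"
  by (subst binomial_sum_superset[of "{c}"]) auto

lemma eventually_polynomial_binomial_product: "eventually_polynomial (binomial_product c)"
proof -
  have "finite_support (\<lambda>c'. if c' = c then 1 else (0::rat))"
    by (simp add: finite_support_def)
  then show ?thesis
    unfolding eventually_polynomial_def
    by (intro exI[of _ "\<lambda>c'. if c' = c then 1 else 0"]) (auto simp: binomial_sum_delta)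
qed

text \<open>Pascal's rule: a backward difference lowers one index of a basis function by one.\<close>

lemma binomial_product_diff:
  assumes "\<nu> i \<ge> 1"
  shows "binomial_product c \<nu> - binomial_product c (\<nu>(i := \<nu> i - 1)) =
    (if c i = 0 then 0 else binomial_product (c(i := c i - 1)) \<nu>)"
proof -
  have *: "binomial_product c' \<nu>' = of_nat ((\<nu>' i + c' i) choose c' i) *
      (\<Prod>j\<in>UNIV - {i}. of_nat ((\<nu>' j + c' j) choose c' j))" for c' \<nu>' :: "'a \<Rightarrow> nat"
    unfolding binomial_product_def by (rule prod.remove) auto
  obtain n where n: "\<nu> i = Suc n" using assms by (cases "\<nu> i") auto
  show ?thesis
  proof (cases "c i")
    case 0
    have "(\<Prod>j\<in>UNIV - {i}. of_nat ((\<nu> j + c j) choose c j)) =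
        (\<Prod>j\<in>UNIV - {i}. of_nat (((\<nu>(i := \<nu> i - 1)) j + c j) choose c j) :: rat)"
      by (rule prod.cong) auto
    then show ?thesis using 0 by (subst (1 2) *) simp
  next
    case (Suc m)
    have 1: "(\<Prod>j\<in>UNIV - {i}. of_nat (((\<nu>(i := \<nu> i - 1)) j + c j) choose c j) :: rat) =
        (\<Prod>j\<in>UNIV - {i}. of_nat ((\<nu> j + c j) choose c j))"
      by (rule prod.cong) auto
    have 2: "(\<Prod>j\<in>UNIV - {i}. of_nat ((\<nu> j + (c(i := c i - 1)) j) choose (c(i := c i - 1)) j) :: rat) =
        (\<Prod>j\<in>UNIV - {i}. of_nat ((\<nu> j + c j) choose c j))"
      by (rule prod.cong) auto
    show ?thesis
      unfolding *[of c] *[of "c(i := c i - 1)" \<nu>] 1 2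
      using Suc n by (simp add: algebra_simps)
  qed
qed

lemma eventually_polynomial_binomial_product_shift:
  "eventually_polynomial (\<lambda>\<nu>. binomial_product c (\<nu>(i := \<nu> i - 1)))"
proof (rule eventually_polynomial_cong)
  show "eventually_polynomial (\<lambda>\<nu>. binomial_product c \<nu> -
      (if c i = 0 then 0 else binomial_product (c(i := c i - 1)) \<nu>))"
    by (cases "c i = 0") (auto intro!: eventually_polynomial_diff eventually_polynomial_binomial_product eventually_polynomial_0)
  show "binomial_product c (\<nu>(i := \<nu> i - 1)) = binomial_product c \<nu> -
      (if c i = 0 then 0 else binomial_product (c(i := c i - 1)) \<nu>)"
    if "\<forall>j. 1 \<le> \<nu> j" for \<nu>
    using binomial_product_diff[of \<nu> i c] that by (simp add: algebra_simps)
qed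

lemma eventually_polynomial_shift1:
  assumes "eventually_polynomial h"
  shows "eventually_polynomial (\<lambda>\<nu>. h (\<nu>(i := \<nu> i - 1)))"
proof -
  obtain e \<nu>0 where e: "finite_support e" "\<And>\<nu>. (\<forall>i. \<nu>0 i \<le> \<nu> i) \<Longrightarrow> h \<nu> = binomial_sum e \<nu>"
    using assms(1) unfolding eventually_polynomial_def by blast
  have "eventually_polynomial (\<lambda>\<nu>. \<Sum>c | e c \<noteq> 0. e c * binomial_product c (\<nu>(i := \<nu> i - 1)))"
  proof (rule eventually_polynomial_sum)
    fix c
    show "eventually_polynomial (\<lambda>\<nu>. e c * binomial_product c (\<nu>(i := \<nu> i - 1)))"
      using eventually_polynomial_linear[OF eventually_polynomial_binomial_product_shift eventually_polynomial_0, of "e c" c i 0]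
      by simp
  qed
  then show ?thesis
  proof (rule eventually_polynomial_cong)
    fix \<nu> :: "'a \<Rightarrow> nat" assume "\<forall>j. \<nu>0 j + 1 \<le> \<nu> j"
    then have "\<forall>j. \<nu>0 j \<le> (\<nu>(i := \<nu> i - 1)) j"
      by (metis Nat.le_diff_conv2 add_leD1 add_leD2 fun_upd_apply)
    from e(2)[OF this] show "h (\<nu>(i := \<nu> i - 1)) =
        (\<Sum>c | e c \<noteq> 0. e c * binomial_product c (\<nu>(i := \<nu> i - 1)))"
      by (simp only: binomial_sum_def)
  qed
qed

text \<open>Truncated subtraction does no harm because only arguments above a bound matter.\<close>

lemma eventually_polynomial_shift:
  fixes h :: "('p::finite \<Rightarrow> nat) \<Rightarrow> rat"
  assumes "eventually_polynomial h"
  shows "eventually_polynomial (\<lambda>\<nu>. h (\<lambda>i. \<nu> i - a i))"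
proof -
  have single: "eventually_polynomial (\<lambda>\<nu>. h (\<nu>(i := \<nu> i - k)))"
    if "eventually_polynomial h" for i k and h :: "('p \<Rightarrow> nat) \<Rightarrow> rat"
    using that
  proof (induction k arbitrary: h)
    case (Suc k)
    have "(\<nu>(i := \<nu> i - 1))(i := (\<nu>(i := \<nu> i - 1)) i - k) = \<nu>(i := \<nu> i - Suc k)" for \<nu> :: "'p \<Rightarrow> nat"
      by simp
    with eventually_polynomial_shift1[OF Suc.IH[OF Suc.prems], of i] show ?case by (simp only:)
  qed simp
  have "eventually_polynomial (\<lambda>\<nu>. h (\<lambda>i. if i \<in> A then \<nu> i - a i else \<nu> i))" for A :: "'p set"
    using finite[of A]
  proof (induction A rule: finite_induct)
    case (insert i A)
    have "(\<lambda>j. if j \<in> insert i A then \<nu> j - a j else \<nu> j) =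
        (\<lambda>j. if j \<in> A then (\<nu>(i := \<nu> i - a i)) j - a j else (\<nu>(i := \<nu> i - a i)) j)" for \<nu>
      using insert(2) by auto
    then show ?case using single[OF insert.IH, of i "a i"] by simp
  qed (simp add: assms)
  from this[of UNIV] show ?thesis by simp
qed

text \<open>Linear independence of the basis: differences reduce the degree until a constant is left.\<close>

lemma binomial_sum_eq_0_imp:
  fixes e :: "('p::finite \<Rightarrow> nat) \<Rightarrow> rat"
  assumes "finite_support e" "\<And>\<nu>. (\<forall>i. \<nu>0 i \<le> \<nu> i) \<Longrightarrow> binomial_sum e \<nu> = 0"
  shows "e c = 0"
proof -
  have "\<forall>c. e c = 0" if "\<forall>c. e c \<noteq> 0 \<longrightarrow> sum c UNIV \<le> N" for N
    using that assms
  proof (induction N arbitrary: e \<nu>0)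
    case 0
    then have sub: "{c. e c \<noteq> 0} \<subseteq> {\<lambda>_. 0}" by auto
    then have "binomial_sum e \<nu>0 = e (\<lambda>_. 0)"
      by (subst binomial_sum_superset[of "{\<lambda>_. 0}"]) (auto simp: binomial_product_def)
    with 0(3)[of \<nu>0] have "e (\<lambda>_. 0) = 0" by simp
    with sub show ?case by blast
  next
    case (Suc N)
    \<comment> \<open>the coefficients of the backward difference in direction \<open>i\<close>, which has smaller degree\<close>
    have shifted: "e (c(i := Suc (c i))) = 0" for c i
    proof -
      let ?up = "\<lambda>c::'p \<Rightarrow> nat. c(i := Suc (c i))"
      let ?e = "\<lambda>c. e (?up c)"
      have inj: "inj ?up"
        by (rule injI) (metis fun_upd_apply fun_upd_triv fun_upd_upd nat.inject)
      have fin: "finite {c. ?e c \<noteq> 0}"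
        using finite_vimageI[OF Suc.prems(2)[unfolded finite_support_def] inj] by (simp add: vimage_def)
      have im: "?up ` {c. ?e c \<noteq> 0} = {c. e c \<noteq> 0 \<and> c i \<noteq> 0}"
      proof (rule Set.set_eqI, rule iffI)
        fix c assume "c \<in> {c. e c \<noteq> 0 \<and> c i \<noteq> 0}"
        then have "c = ?up (c(i := c i - 1))" "e c \<noteq> 0" by auto
        then show "c \<in> ?up ` {c. ?e c \<noteq> 0}" by (metis (mono_tags, lifting) image_eqI mem_Collect_eq)
      qed auto
      have van: "binomial_sum ?e \<nu> = 0" if "\<forall>j. \<nu>0 j + 1 \<le> \<nu> j" for \<nu>
      proof -
        have \<nu>1: "\<forall>j. \<nu>0 j \<le> (\<nu>(i := \<nu> i - 1)) j"
          using that by (metis Nat.le_diff_conv2 add_leD1 add_leD2 fun_upd_apply)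
        have \<nu>2: "\<forall>j. \<nu>0 j \<le> \<nu> j" using that by (metis add_leD1)
        have "0 = binomial_sum e \<nu> - binomial_sum e (\<nu>(i := \<nu> i - 1))"
          by (simp only: Suc.prems(3)[OF \<nu>1] Suc.prems(3)[OF \<nu>2] diff_self)
        also have "\<dots> = (\<Sum>c | e c \<noteq> 0. e c * (binomial_product c \<nu> - binomial_product c (\<nu>(i := \<nu> i - 1))))"
          by (simp add: binomial_sum_def sum_subtractf algebra_simps)
        also have "\<dots> = (\<Sum>c | e c \<noteq> 0. if c i = 0 then 0 else e c * binomial_product (c(i := c i - 1)) \<nu>)"
        proof (rule sum.cong[OF refl])
          fix c
          have "1 \<le> \<nu> i" using that by (metis add_leD2)
          then show "e c * (binomial_product c \<nu> - binomial_product c (\<nu>(i := \<nu> i - 1))) =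
              (if c i = 0 then 0 else e c * binomial_product (c(i := c i - 1)) \<nu>)"
            by (cases "c i = 0") (simp_all only: binomial_product_diff if_True if_False mult_zero_right simp_thms)
        qed
        also have "\<dots> = (\<Sum>c | e c \<noteq> 0 \<and> c i \<noteq> 0. e c * binomial_product (c(i := c i - 1)) \<nu>)"
          by (rule sum.mono_neutral_cong_right) (use Suc.prems(2) in \<open>auto simp: finite_support_def\<close>)
        also have "\<dots> = (\<Sum>c | ?e c \<noteq> 0. ?e c * binomial_product c \<nu>)"
          unfolding im[symmetric] by (subst sum.reindex[OF inj_on_subset[OF inj]]) auto
        finally show ?thesis by (simp add: binomial_sum_def)
      qed
      have deg: "sum c UNIV \<le> N" if "?e c \<noteq> 0" for c
      proof -
        have "sum (?up c) UNIV \<le> Suc N" using Suc.prems(1) that by blast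
        moreover have "sum (?up c) UNIV = Suc (sum c UNIV)"
          by (subst (1 2) sum.remove[of UNIV i]) (auto intro!: sum.cong)
        ultimately show ?thesis by simp
      qed
      have "\<forall>c. ?e c = 0"
      proof (rule Suc.IH[of ?e "\<lambda>j. \<nu>0 j + 1"])
        show "\<forall>c. ?e c \<noteq> 0 \<longrightarrow> sum c UNIV \<le> N" using deg by blast
        show "finite_support ?e" using fin by (simp only: finite_support_def)
        show "binomial_sum ?e \<nu> = 0" if "\<forall>j. \<nu>0 j + 1 \<le> \<nu> j" for \<nu> by (rule van[OF that])
      qed
      then show ?thesis by blast
    qed
    have zero: "e c = 0" if "c i \<noteq> 0" for c i
      using shifted[of "c(i := c i - 1)" i] that by simp
    then have "\<forall>c. e c \<noteq> 0 \<longrightarrow> c = (\<lambda>_. 0)" by (auto simp: fun_eq_iff)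
    then have sub: "{c. e c \<noteq> 0} \<subseteq> {\<lambda>_. 0}" by auto
    then have "binomial_sum e \<nu>0 = e (\<lambda>_. 0)"
      by (subst binomial_sum_superset[of "{\<lambda>_. 0}"]) (auto simp: binomial_product_def)
    with Suc.prems(3)[of \<nu>0] have "e (\<lambda>_. 0) = 0" by simp
    with sub show ?case by blast
  qed
  moreover have "\<forall>c. e c \<noteq> 0 \<longrightarrow> sum c UNIV \<le> Max ((\<lambda>c. sum c UNIV) ` {c. e c \<noteq> 0})"
    using assms(1) by (auto simp: finite_support_def)
  ultimately show ?thesis by blast
qed

lemma binomial_sum_unique:
  assumes "finite_support e" "finite_support e'"
    "\<And>\<nu>. (\<forall>i. \<nu>0 i \<le> \<nu> i) \<Longrightarrow> binomial_sum e \<nu> = binomial_sum e' \<nu>"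
  shows "e = e'"
proof
  fix c
  have "1 * e c + (-1) * e' c = 0"
    by (rule binomial_sum_eq_0_imp[where e = "\<lambda>c. 1 * e c + (-1) * e' c" and ?\<nu>0.0 = \<nu>0])
      (use assms in \<open>simp_all only: finite_support_linear binomial_sum_linear, simp\<close>)
  then show "e c = e' c" by simp
qed

section \<open>Mixed multiplicities as coefficients\<close>

definition binomial_poly :: "('p::finite \<Rightarrow> nat) \<Rightarrow> ('p, rat) mpol" where
  "binomial_poly c = (\<Prod>i\<in>UNIV. binomial_mpol i (c i))"

lemma prod_shift_eq_fact_choose:
  "(\<Prod>j = 1..c. of_nat n + of_nat j) = (fact c * of_nat ((n + c) choose c) :: 'a::field_char_0)"
proof -
  have "(\<Prod>j = 1..c. of_nat n + of_nat j) = (pochhammer (of_nat n + 1) c :: 'a)"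
    by (simp add: pochhammer_prod prod.atLeast1_atMost_eq atLeast0LessThan add_ac)
  also have "\<dots> = fact c * (of_nat (n + c) gchoose c)"
    by (simp add: gbinomial_pochhammer')
  also have "of_nat (n + c) gchoose c = (of_nat ((n + c) choose c) :: 'a)"
    by (rule binomial_gbinomial[symmetric])
  finally show ?thesis .
qed

lemma eval_binomial_mpol:
  "mpol_eval id (\<lambda>i. of_nat (\<nu> i)) (binomial_mpol i d) = of_nat ((\<nu> i + d) choose d)"
  unfolding binomial_mpol_def rat_eval.eval_mult rat_eval.eval_prod rat_eval.eval_add rat_eval.eval_Const
    rat_eval.eval_Var id_apply prod_shift_eq_fact_choose by simp

lemma eval_binomial_poly:
  "mpol_eval id (\<lambda>i. of_nat (\<nu> i)) (binomial_poly c) = binomial_product c \<nu>"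
  by (simp add: binomial_poly_def binomial_product_def rat_eval.eval_prod eval_binomial_mpol)

lemma eval_binomial_poly_sum:
  "mpol_eval id (\<lambda>i. of_nat (\<nu> i)) (\<Sum>c | e c \<noteq> 0. Const (e c) * binomial_poly c) = binomial_sum e \<nu>"
  by (simp add: binomial_sum_def rat_eval.eval_sum rat_eval.eval_mult eval_binomial_poly)

lemma Var_times_binomial_mpol:
  "Var i * binomial_mpol i d = Const (of_nat (Suc d)) * binomial_mpol i (Suc d)
     - Const (of_nat (Suc d)) * binomial_mpol i d"
proof -
  have C: "Const (of_nat (Suc d)) * Const (1 / fact (Suc d)) = (Const (1 / fact d) :: ('a, rat) mpol)"
    unfolding Const_mult[symmetric] by (subst fact_Suc) (simp del: of_nat_Suc)
  have "Const (of_nat (Suc d)) * binomial_mpol i (Suc d)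
      = (Const (of_nat (Suc d)) * Const (1 / fact (Suc d))) *
        ((\<Prod>j=1..d. Var i + Const (of_nat j)) * (Var i + Const (of_nat (Suc d))))"
    unfolding binomial_mpol_def by (simp add: mult.assoc)
  also have "\<dots> = binomial_mpol i d * (Var i + Const (of_nat (Suc d)))"
    unfolding C binomial_mpol_def by (simp add: mult.assoc)
  finally show ?thesis by (simp add: algebra_simps)
qed

text \<open>
  From \<open>(t + d + 1) \<cdot> binom (t + d) d = (d + 1) \<cdot> binom (t + d + 1) (d +
  1)\<close>.
\<close>

lemma Var_times_binomial_poly:
  "Var i * binomial_poly c = Const (of_nat (Suc (c i))) * binomial_poly (c(i := Suc (c i)))
     - Const (of_nat (Suc (c i))) * binomial_poly c"
proof -
  have *: "binomial_poly c' = binomial_mpol i (c' i) * (\<Prod>j\<in>UNIV - {i}. binomial_mpol j (c' j))" for c' :: "'a \<Rightarrow> nat"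
    unfolding binomial_poly_def by (rule prod.remove) auto
  have "(\<Prod>j\<in>UNIV - {i}. binomial_mpol j ((c(i := Suc (c i))) j)) = (\<Prod>j\<in>UNIV - {i}. binomial_mpol j (c j))"
    by (rule prod.cong) auto
  then have "Const (of_nat (Suc (c i))) * binomial_poly (c(i := Suc (c i))) - Const (of_nat (Suc (c i))) * binomial_poly c
    = (Const (of_nat (Suc (c i))) * binomial_mpol i (Suc (c i)) - Const (of_nat (Suc (c i))) * binomial_mpol i (c i))
      * (\<Prod>j\<in>UNIV - {i}. binomial_mpol j (c j))"
    unfolding *[of c] *[of "c(i := Suc (c i))"] by (simp add: algebra_simps)
  also have "\<dots> = Var i * binomial_poly c"
    unfolding Var_times_binomial_mpol[symmetric] *[of c] by (simp add: mult.assoc)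
  finally show ?thesis ..
qed

text \<open>The products of binomials span all polynomials, because their span contains \<open>1\<close> and is stable
  under multiplication by each variable.\<close>

lemma Const_uminus: "Const (- a) = - (Const a :: ('x, 'c::ring_1) mpol)"
  by (simp add: Const_def single_uminus)

lemma binomial_poly_spanning:
  fixes P :: "('p::finite, rat) mpol"
  shows "\<exists>e. finite_support e \<and> P = (\<Sum>c | e c \<noteq> 0. Const (e c) * binomial_poly c)"
proof -
  define S where "S = {P. \<exists>e. finite_support e \<and> P = (\<Sum>c | e c \<noteq> 0. Const (e c) * (binomial_poly c :: ('p, rat) mpol))}"
  have S_I: "P \<in> S" if "finite_support e" "P = (\<Sum>c | e c \<noteq> 0. Const (e c) * binomial_poly c)" for P e
    unfolding S_def using that by blast
  have S_E: "\<exists>e. finite_support e \<and> P = (\<Sum>c | e c \<noteq> 0. Const (e c) * binomial_poly c)" if "P \<in> S" for P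
    using that unfolding S_def by blast
  have sup: "(\<Sum>c | e c \<noteq> 0. Const (e c) * binomial_poly c) = (\<Sum>c\<in>T. Const (e c) * binomial_poly c)"
    if "finite T" "{c. e c \<noteq> 0} \<subseteq> T" for e and T :: "('p \<Rightarrow> nat) set"
    by (rule sum.mono_neutral_left) (use that in auto)
  have add: "P + Q \<in> S" if "P \<in> S" "Q \<in> S" for P Q
  proof -
    from S_E[OF that(1)] S_E[OF that(2)] obtain e e' where e: "finite_support e" "P = (\<Sum>c | e c \<noteq> 0. Const (e c) * binomial_poly c)"
      and e': "finite_support e'" "Q = (\<Sum>c | e' c \<noteq> 0. Const (e' c) * binomial_poly c)"
      by blast
    let ?T = "{c. e c \<noteq> 0} \<union> {c. e' c \<noteq> 0}"
    have T: "finite ?T" using e e' by (auto simp: finite_support_def)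
    have "finite_support (\<lambda>c. e c + e' c)" using finite_support_linear[OF e(1) e'(1), of 1 1] by simp
    moreover have "P + Q = (\<Sum>c | e c + e' c \<noteq> 0. Const (e c + e' c) * binomial_poly c)"
      unfolding e(2) e'(2)
      by (subst (1 2) sup[OF T], simp, simp, subst sup[OF T, of "\<lambda>c. e c + e' c"])
        (auto simp: Const_add algebra_simps sum.distrib)
    ultimately show ?thesis by (rule S_I)
  qed
  have delta: "Const a * binomial_poly c \<in> S" for a c
  proof -
    have "finite_support (\<lambda>c'. if c' = c then a else 0)" by (simp add: finite_support_def)
    moreover have "Const a * binomial_poly c =
        (\<Sum>c' | (if c' = c then a else 0) \<noteq> 0. Const (if c' = c then a else 0) * binomial_poly c')"
      by (subst sup[of "{c}"]) auto
    ultimately show ?thesis by (rule S_I)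
  qed
  have sumS: "(\<Sum>a\<in>A. p a) \<in> S" if "\<And>a. a \<in> A \<Longrightarrow> p a \<in> S" for A :: "'z set" and p
    using that
  proof (induction A rule: infinite_finite_induct)
    case (insert x F)
    then have "p x + sum p F \<in> S" by (intro add) auto
    then show ?case using insert(1,2) by simp
  qed (use delta[of 0] in simp_all)
  have Var: "Var i * P \<in> S" if "P \<in> S" for i P
  proof -
    from S_E[OF that] obtain e where e: "finite_support e" "P = (\<Sum>c | e c \<noteq> 0. Const (e c) * binomial_poly c)"
      by blast
    have "Var i * P = (\<Sum>c | e c \<noteq> 0. Const (e c) * (Var i * binomial_poly c))"
      unfolding e(2) by (simp add: sum_distrib_left mult_ac)
    also have "\<dots> = (\<Sum>c | e c \<noteq> 0. Const (e c * of_nat (Suc (c i))) * binomial_poly (c(i := Suc (c i)))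
        + Const (- (e c * of_nat (Suc (c i)))) * binomial_poly c)"
      unfolding Var_times_binomial_poly
      by (rule sum.cong) (simp_all add: Const_mult Const_uminus right_diff_distrib mult.assoc del: of_nat_Suc)
    also have "\<dots> \<in> S" by (intro sumS add delta)
    finally show ?thesis .
  qed
  have one: "Const a \<in> S" for a
    using delta[of a "\<lambda>_. 0"] by (simp add: binomial_poly_def binomial_mpol_def)
  have pow: "Var i ^ n * P \<in> S" if "P \<in> S" for i n P
    using that by (induction n arbitrary: P) (auto simp: mult.assoc intro: Var)
  have mon: "Const a * (\<Prod>i\<in>A. Var i ^ n i) \<in> S" for a and A :: "'p set" and n
    using finite[of A]
  proof (induction A rule: finite_induct)
    case (insert x F)
    have "Var x ^ n x * (Const a * (\<Prod>i\<in>F. Var i ^ n i)) \<in> S" by (rule pow[OF insert.IH])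
    then show ?case using insert(1,2) by (simp add: mult_ac)
  qed (simp add: one)
  have single: "Poly_Mapping.single \<mu> a \<in> S" for \<mu> a
  proof -
    have pw: "Var i ^ n = (Poly_Mapping.single (Poly_Mapping.single i n) 1 :: ('p, rat) mpol)" for i n
      by (induction n) (auto simp: Var_def mult_single single_add[symmetric])
    have pr: "(\<Prod>i\<in>A. Var i ^ n i) = (Poly_Mapping.single (\<Sum>i\<in>A. Poly_Mapping.single i (n i)) 1 :: ('p, rat) mpol)" for A n
      using finite[of A] by (induction A rule: finite_induct) (auto simp: pw mult_single)
    have "\<mu> = (\<Sum>i\<in>UNIV. Poly_Mapping.single i (Poly_Mapping.lookup \<mu> i))"
      by (rule poly_mapping_eqI) (simp add: lookup_sum lookup_single when_def)
    then have "Poly_Mapping.single \<mu> a = Const a * (\<Prod>i\<in>UNIV. Var i ^ Poly_Mapping.lookup \<mu> i)"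
      by (simp add: pr Const_def mult_single)
    then show ?thesis using mon by simp
  qed
  have "P \<in> S"
    by (subst poly_mapping_sum_singles) (intro sumS single)
  then show ?thesis by (rule S_E)
qed

text \<open>
  Hilbert polynomials are unique: expand in products of binomials, which are independent as
  functions on every shifted orthant.
\<close>

lemma mpol_eq_0_if_eval_eq_0:
  fixes P :: "('p::finite, rat) mpol"
  assumes "\<And>\<nu>. (\<forall>i. \<nu>0 i \<le> \<nu> i) \<Longrightarrow> mpol_eval id (\<lambda>i. of_nat (\<nu> i)) P = 0"
  shows "P = 0"
proof -
  obtain e where e: "finite_support e" "P = (\<Sum>c | e c \<noteq> 0. Const (e c) * binomial_poly c)"
    using binomial_poly_spanning by blast
  have "e c = 0" for c
    using binomial_sum_eq_0_imp[OF e(1), of \<nu>0] assms unfolding e(2) eval_binomial_poly_sum by blast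
  then show ?thesis using e(2) by simp
qed

lemma mixed_multiplicity_eqI:
  fixes M :: "('p::finite \<Rightarrow> nat) \<Rightarrow> ('v, 'k::field) mpol set"
  assumes e: "finite_support e"
    and M: "\<And>\<nu>. (\<forall>i. \<nu>0 i \<le> \<nu> i) \<Longrightarrow> of_nat (kdim (M \<nu>)) = binomial_sum e \<nu>"
  shows "mixed_multiplicity d M = e d"
proof -
  let ?P = "(\<Sum>c | e c \<noteq> 0. Const (e c) * binomial_poly c)"
  have "is_hilbert_polynomial M ?P"
    unfolding is_hilbert_polynomial_def eval_binomial_poly_sum
    by (rule exI[of _ \<nu>0]) (simp add: M)
  moreover have "P = ?P" if "is_hilbert_polynomial M P" for P
  proof -
    from that[unfolded is_hilbert_polynomial_def]
    obtain \<nu>1 where \<nu>1: "\<forall>\<nu>. (\<forall>i. \<nu>1 i \<le> \<nu> i) \<longrightarrow>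
        mpol_eval id (\<lambda>i. of_nat (\<nu> i)) P = of_nat (kdim (M \<nu>))"
      by (rule exE)
    have "P + Const (-1) * ?P = 0"
      by (rule mpol_eq_0_if_eval_eq_0[where ?\<nu>0.0 = "\<lambda>i. max (\<nu>0 i) (\<nu>1 i)"])
        (simp add: rat_eval.eval_add rat_eval.eval_mult eval_binomial_poly_sum \<nu>1 M)
    moreover have "Const (-1) = (- 1 :: ('p, rat) mpol)"
      by (simp add: Const_def single_uminus)
    ultimately show ?thesis by simp
  qed
  ultimately have H: "hilbert_polynomial M = ?P"
    unfolding hilbert_polynomial_def by (rule the_equality)
  have "(THE e. finite {c. e c \<noteq> 0} \<and>
        hilbert_polynomial M = (\<Sum>c | e c \<noteq> 0. Const (e c) * (\<Prod>i\<in>UNIV. binomial_mpol i (c i)))) = e"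
  proof (rule the_equality)
    fix e' assume e': "finite {c. e' c \<noteq> 0} \<and>
        hilbert_polynomial M = (\<Sum>c | e' c \<noteq> 0. Const (e' c) * (\<Prod>i\<in>UNIV. binomial_mpol i (c i)))"
    then have "?P = (\<Sum>c | e' c \<noteq> 0. Const (e' c) * binomial_poly c)"
      using H by (simp add: binomial_poly_def)
    from arg_cong[OF this, of "mpol_eval id (\<lambda>i. of_nat (\<nu> i))" for \<nu>]
    have "binomial_sum e' \<nu> = binomial_sum e \<nu>" for \<nu>
      unfolding eval_binomial_poly_sum by simp
    then show "e' = e"
      using e' e by (intro binomial_sum_unique) (auto simp: finite_support_def)
  qed (use e H in \<open>auto simp: finite_support_def binomial_poly_def\<close>)
  then show ?thesis unfolding mixed_multiplicity_def by simp
qed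

section \<open>Growth along rays\<close>

text \<open>
  The homogeneous part of degree \<open>s\<close> of \<open>binomial_sum e\<close>: the leading
  term of \<open>binom (t + c) c\<close> is \<open>t\<^sup>c / c!\<close>.
\<close>

definition top_form :: "(('p::finite \<Rightarrow> nat) \<Rightarrow> rat) \<Rightarrow> nat \<Rightarrow> ('p \<Rightarrow> nat) \<Rightarrow> rat" where
  "top_form e s t = (\<Sum>c | e c \<noteq> 0 \<and> sum c UNIV = s. e c * (\<Prod>i\<in>UNIV. of_nat (t i) ^ c i / fact (c i)))"

lemma tendsto_choose_quotient:
  fixes u :: "nat \<Rightarrow> nat"
  assumes "(\<lambda>l. real (u l) / real l) \<longlonglongrightarrow> t"
  shows "(\<lambda>l. real ((u l + c) choose c) / real l ^ c) \<longlonglongrightarrow> t ^ c / fact c"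
proof -
  have "real ((n + c) choose c) = (\<Prod>j = 1..c. real n + real j) / fact c" for n
    unfolding prod_shift_eq_fact_choose by simp
  then have "real ((u l + c) choose c) / real l ^ c =
      (\<Prod>j = 1..c. real (u l) / real l + real j / real l) / fact c" for l
    by (simp add: add_divide_distrib[symmetric] prod_dividef)
  moreover have "(\<lambda>l. (\<Prod>j = 1..c. real (u l) / real l + real j / real l) / fact c)
      \<longlonglongrightarrow> (\<Prod>j = 1..c. t + 0) / fact c"
    by (intro tendsto_divide tendsto_prod tendsto_add assms tendsto_const
        tendsto_divide_0[OF tendsto_const] filterlim_at_top_imp_at_infinity filterlim_real_sequentially) auto
  ultimately show ?thesis by simp
qed

lemma of_rat_fact: "real_of_rat (fact n) = fact n"
  by (metis of_nat_fact of_rat_of_nat_eq)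

text \<open>
  Along a sequence that is asymptotic to the ray through \<open>t\<close>, only the top form
  survives. Allowing arbitrary such sequences, instead of multiples of \<open>t\<close>, shows
  that shifts of the argument are irrelevant in the limit.
\<close>

lemma tendsto_binomial_sum:
  fixes u :: "nat \<Rightarrow> 'p::finite \<Rightarrow> nat"
  assumes u: "\<And>i. (\<lambda>l. real (u l i) / real l) \<longlonglongrightarrow> real (t i)"
    and e: "finite_support e" "\<And>c. e c \<noteq> 0 \<Longrightarrow> sum c UNIV \<le> s"
  shows "(\<lambda>l. real_of_rat (binomial_sum e (u l)) / real l ^ s) \<longlonglongrightarrow> real_of_rat (top_form e s t)"
proof -
  have *: "(\<lambda>l. real_of_rat (e c) * ((\<Prod>i\<in>UNIV. real ((u l i + c i) choose c i) / real l ^ c i) * (1 / real l ^ (s - sum c UNIV))))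
     \<longlonglongrightarrow> (if sum c UNIV = s then real_of_rat (e c) * (\<Prod>i\<in>UNIV. real (t i) ^ c i / fact (c i)) else 0)"
    if "e c \<noteq> 0" for c
  proof -
    have one: "(\<lambda>l. 1 / real l ^ k) \<longlonglongrightarrow> (if k = 0 then 1 else 0)" for k
    proof (cases k)
      case (Suc k')
      have "filterlim (\<lambda>l. real l ^ k) at_infinity sequentially"
        using Suc by (intro filterlim_at_top_imp_at_infinity filterlim_pow_at_top filterlim_real_sequentially) auto
      then show ?thesis using Suc tendsto_divide_0[OF tendsto_const] by fastforce
    qed simp
    have "(\<lambda>l. real_of_rat (e c) * ((\<Prod>i\<in>UNIV. real ((u l i + c i) choose c i) / real l ^ c i) * (1 / real l ^ (s - sum c UNIV))))
      \<longlonglongrightarrow> real_of_rat (e c) * ((\<Prod>i\<in>UNIV. real (t i) ^ c i / fact (c i)) * (if s - sum c UNIV = 0 then 1 else 0))"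
      by (intro tendsto_mult tendsto_const tendsto_prod tendsto_choose_quotient u one)
    then show ?thesis using e(2)[OF that] by (cases "sum c UNIV = s") auto
  qed
  have eq: "real_of_rat (binomial_sum e (u l)) / real l ^ s =
      (\<Sum>c | e c \<noteq> 0. real_of_rat (e c) * ((\<Prod>i\<in>UNIV. real ((u l i + c i) choose c i) / real l ^ c i) * (1 / real l ^ (s - sum c UNIV))))"
    for l
  proof -
    have "real_of_rat (e c * binomial_product c (u l)) / real l ^ s =
      real_of_rat (e c) * ((\<Prod>i\<in>UNIV. real ((u l i + c i) choose c i) / real l ^ c i) * (1 / real l ^ (s - sum c UNIV)))"
      if "e c \<noteq> 0" for c
    proof -
      have "real l ^ s = real l ^ sum c UNIV * real l ^ (s - sum c UNIV)"
        using e(2)[OF that] by (simp flip: power_add)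
      then show ?thesis
        by (simp add: binomial_product_def of_rat_mult of_rat_prod prod_dividef power_sum)
    qed
    then show ?thesis by (simp add: binomial_sum_def of_rat_sum sum_divide_distrib)
  qed
  have fin: "finite {c. e c \<noteq> 0}" using e by (simp add: finite_support_def)
  have "real_of_rat (top_form e s t) =
      (\<Sum>c | e c \<noteq> 0. if sum c UNIV = s then real_of_rat (e c) * (\<Prod>i\<in>UNIV. real (t i) ^ c i / fact (c i)) else 0)"
    unfolding top_form_def of_rat_sum of_rat_mult of_rat_prod of_rat_divide of_rat_power of_rat_fact of_rat_of_nat_eq
    by (rule sum.mono_neutral_cong_left) (use fin in auto)
  then show ?thesis
    unfolding eq by (simp only:) (intro tendsto_sum *, simp)
qed

lemma top_form_eq_0_imp:
  fixes e :: "('p::finite \<Rightarrow> nat) \<Rightarrow> rat"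
  assumes e: "finite_support e" and t: "\<And>t. (\<forall>i. 1 \<le> t i) \<Longrightarrow> top_form e s t = 0" and c: "sum c UNIV = s"
  shows "e c = 0"
proof -
  let ?C = "{c. e c \<noteq> 0 \<and> sum c UNIV = s}"
  let ?Q = "\<Sum>c\<in>?C. Poly_Mapping.single (Abs_poly_mapping c) (e c / (\<Prod>i\<in>UNIV. fact (c i)))"
  have fin: "finite ?C" using e by (auto simp: finite_support_def)
  have L: "Poly_Mapping.lookup (Abs_poly_mapping c) = c" for c :: "'p \<Rightarrow> nat"
    by (simp add: Abs_poly_mapping_inverse)
  have mv: "monomial_value g (Abs_poly_mapping c) = (\<Prod>i\<in>UNIV. g i ^ c i)" for c :: "'p \<Rightarrow> nat" and g :: "'p \<Rightarrow> rat"
    by (subst monomial_value_superset[of UNIV]) (auto simp: L)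
  \<comment> \<open>the top form itself, as a polynomial; it vanishes on the positive orthant\<close>
  have "?Q = 0"
  proof (rule mpol_eq_0_if_eval_eq_0)
    fix t :: "'p \<Rightarrow> nat" assume "\<forall>i. 1 \<le> t i"
    then have "top_form e s t = 0" by (rule t)
    then show "mpol_eval id (\<lambda>i. of_nat (t i)) ?Q = 0"
      by (simp add: rat_eval.eval_sum rat_eval.eval_single mv top_form_def prod_dividef)
  qed
  then have "0 = Poly_Mapping.lookup ?Q (Abs_poly_mapping c)" by simp
  also have "\<dots> = (\<Sum>c'\<in>?C. if c' = c then e c' / (\<Prod>i\<in>UNIV. fact (c' i)) else 0)"
    unfolding lookup_sum lookup_single when_def by (intro sum.cong refl if_cong) (metis L)
  also have "\<dots> = (if c \<in> ?C then e c / (\<Prod>i\<in>UNIV. fact (c i)) else 0)"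
    using fin by simp
  finally show ?thesis using c by (auto split: if_splits)
qed

text \<open>
  Otherwise the top form, of degree greater than \<open>r\<close>, would vanish at all positive
  points.
\<close>

lemma support_bound_of_growth:
  fixes e :: "('p::finite \<Rightarrow> nat) \<Rightarrow> rat"
  assumes e: "finite_support e"
    and growth: "\<And>s t. s > r \<Longrightarrow> (\<forall>i. 1 \<le> t i) \<Longrightarrow>
      (\<lambda>l. real_of_rat (binomial_sum e (\<lambda>i. l * t i)) / real l ^ s) \<longlonglongrightarrow> 0"
    and c: "e c \<noteq> 0"
  shows "sum c UNIV \<le> r"
proof (rule ccontr)
  assume not: "\<not> sum c UNIV \<le> r"
  let ?s = "Max ((\<lambda>c. sum c UNIV) ` {c. e c \<noteq> 0})"
  have fin: "finite {c. e c \<noteq> 0}" using e by (simp add: finite_support_def)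
  have bound: "sum c UNIV \<le> ?s" if "e c \<noteq> 0" for c
    using fin that by auto
  have "?s \<in> (\<lambda>c. sum c UNIV) ` {c. e c \<noteq> 0}"
    using fin c by (intro Max_in) auto
  then obtain c0 where c0: "e c0 \<noteq> 0" "sum c0 UNIV = ?s" by auto
  have "?s > r" using bound[OF c] not by simp
  have "top_form e ?s t = 0" if "\<forall>i. 1 \<le> t i" for t
  proof -
    have "(\<lambda>l. real (l * t i) / real l) \<longlonglongrightarrow> real (t i)" for i
      by (rule tendsto_eventually, rule eventually_sequentiallyI[of 1]) auto
    then have "(\<lambda>l. real_of_rat (binomial_sum e (\<lambda>i. l * t i)) / real l ^ ?s)
        \<longlonglongrightarrow> real_of_rat (top_form e ?s t)"
      by (rule tendsto_binomial_sum) (use e bound in auto)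
    with growth[OF \<open>?s > r\<close> that] show ?thesis
      using LIMSEQ_unique by fastforce
  qed
  with top_form_eq_0_imp[OF e, of ?s c0] c0 show False by blast
qed

text \<open>
  The bound on \<open>hF\<close> limits the degrees of both polynomials to \<open>r\<close>.
  Dividing the two inequalities by \<open>l\<^sup>r\<close> along a ray gives equal limits on both
  sides, so the top forms are proportional at all positive integer points, hence coefficientwise.
\<close>

lemma leading_coefficients_proportional:
  fixes hF hS :: "('p::finite \<Rightarrow> nat) \<Rightarrow> nat"
  assumes eF: "finite_support eF" "\<And>\<nu>. (\<forall>i. \<nu>0 i \<le> \<nu> i) \<Longrightarrow> of_nat (hF \<nu>) = binomial_sum eF \<nu>"
    and eS: "finite_support eS" "\<And>\<nu>. (\<forall>i. \<nu>1 i \<le> \<nu> i) \<Longrightarrow> of_nat (hS \<nu>) = binomial_sum eS \<nu>"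
    and bound: "\<And>\<nu>. hF \<nu> \<le> (1 + (\<Sum>i\<in>UNIV. \<nu> i * \<delta> i)) ^ r"
    and lower: "\<And>\<nu>. D * hF \<nu> \<le> hS (\<lambda>i. \<nu> i + a i)"
    and upper: "\<And>\<nu>. hS \<nu> \<le> D * hF (\<lambda>i. \<nu> i + b i)"
    and d: "sum d UNIV = r"
  shows "eS d = of_nat D * eF d"
proof -
  have ray: "(\<lambda>l. real (l * t i + a' i) / real l) \<longlonglongrightarrow> real (t i)" for t a' :: "'p \<Rightarrow> nat" and i
  proof -
    have "(\<lambda>l. real (t i) + real (a' i) / real l) \<longlonglongrightarrow> real (t i) + 0"
      by (intro tendsto_add tendsto_const tendsto_divide_0[OF tendsto_const]
          filterlim_at_top_imp_at_infinity filterlim_real_sequentially)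
    moreover have "eventually (\<lambda>l. real (t i) + real (a' i) / real l = real (l * t i + a' i) / real l) sequentially"
    proof (rule eventually_sequentiallyI[of 1])
      fix l :: nat assume "1 \<le> l"
      then have "real l \<noteq> 0" by simp
      then show "real (t i) + real (a' i) / real l = real (l * t i + a' i) / real l"
        by (simp add: add_divide_distrib)
    qed
    ultimately show ?thesis by (simp add: tendsto_cong)
  qed
  have far: "eventually (\<lambda>l. \<forall>i. \<mu> i \<le> l * t i + a' i) sequentially"
    if "\<forall>i. 1 \<le> t i" for t a' \<mu> :: "'p \<Rightarrow> nat"
  proof (rule eventually_all_finite, rule eventually_sequentiallyI)
    fix i l assume "\<mu> i \<le> l"
    also have "l \<le> l * t i + a' i" using that by (simp add: trans_le_add1)
    finally show "\<mu> i \<le> l * t i + a' i" .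
  qed
  have limF: "(\<lambda>l. real (hF (\<lambda>i. l * t i + a' i)) / real l ^ s) \<longlonglongrightarrow> real_of_rat (top_form eF s t)"
    if "\<forall>i. 1 \<le> t i" "\<And>c. eF c \<noteq> 0 \<Longrightarrow> sum c UNIV \<le> s" for t a' s
  proof (rule Lim_transform_eventually)
    show "(\<lambda>l. real_of_rat (binomial_sum eF (\<lambda>i. l * t i + a' i)) / real l ^ s) \<longlonglongrightarrow> real_of_rat (top_form eF s t)"
      by (rule tendsto_binomial_sum) (use ray that eF in auto)
    show "\<forall>\<^sub>F l in sequentially. real_of_rat (binomial_sum eF (\<lambda>i. l * t i + a' i)) / real l ^ s = real (hF (\<lambda>i. l * t i + a' i)) / real l ^ s"
      using far[OF that(1), of \<nu>0 a'] by eventually_elim (simp flip: eF(2))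
  qed
  have limS: "(\<lambda>l. real (hS (\<lambda>i. l * t i + a' i)) / real l ^ s) \<longlonglongrightarrow> real_of_rat (top_form eS s t)"
    if "\<forall>i. 1 \<le> t i" "\<And>c. eS c \<noteq> 0 \<Longrightarrow> sum c UNIV \<le> s" for t a' s
  proof (rule Lim_transform_eventually)
    show "(\<lambda>l. real_of_rat (binomial_sum eS (\<lambda>i. l * t i + a' i)) / real l ^ s) \<longlonglongrightarrow> real_of_rat (top_form eS s t)"
      by (rule tendsto_binomial_sum) (use ray that eS in auto)
    show "\<forall>\<^sub>F l in sequentially. real_of_rat (binomial_sum eS (\<lambda>i. l * t i + a' i)) / real l ^ s = real (hS (\<lambda>i. l * t i + a' i)) / real l ^ s"
      using far[OF that(1), of \<nu>1 a'] by eventually_elim (simp flip: eS(2))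
  qed
  \<comment> \<open>\<open>hF\<close> grows at most like \<open>l\<^sup>r\<close> along a shifted ray\<close>
  have growF: "(\<lambda>l. real (hF (\<lambda>i. l * t i + a' i)) / real l ^ s) \<longlonglongrightarrow> 0"
    if "s > r" for t a' s
  proof (rule tendsto_sandwich[OF _ _ tendsto_const])
    let ?A = "real (\<Sum>i\<in>UNIV. t i * \<delta> i)" and ?B = "real (1 + (\<Sum>i\<in>UNIV. a' i * \<delta> i))"
    have inv: "(\<lambda>l. inverse (real l)) \<longlonglongrightarrow> 0"
      by (rule lim_inverse_n)
    have "(\<lambda>l. (?A + ?B * inverse (real l)) ^ r * inverse (real l) ^ (s - r)) \<longlonglongrightarrow> (?A + ?B * 0) ^ r * 0 ^ (s - r)"
      by (intro tendsto_intros inv)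
    then show "(\<lambda>l. (?A + ?B * inverse (real l)) ^ r * inverse (real l) ^ (s - r)) \<longlonglongrightarrow> 0"
      using that by (simp add: power_0_left)
    show "\<forall>\<^sub>F l in sequentially. real (hF (\<lambda>i. l * t i + a' i)) / real l ^ s \<le> (?A + ?B * inverse (real l)) ^ r * inverse (real l) ^ (s - r)"
    proof (rule eventually_sequentiallyI[of 1])
      fix l :: nat assume l: "1 \<le> l"
      have "real (hF (\<lambda>i. l * t i + a' i)) \<le> real ((1 + (\<Sum>i\<in>UNIV. (l * t i + a' i) * \<delta> i)) ^ r)"
        using bound of_nat_le_iff by blast
      also have "\<dots> = (real l * ?A + ?B) ^ r"
        by (simp add: algebra_simps sum.distrib sum_distrib_left)
      also have "\<dots> = (real l * (?A + ?B * inverse (real l))) ^ r"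
        using l by (simp add: field_simps)
      also have "\<dots> / real l ^ s = (?A + ?B * inverse (real l)) ^ r * inverse (real l) ^ (s - r)"
      proof -
        have "real l ^ s = real l ^ r * real l ^ (s - r)" using that by (simp flip: power_add)
        then show ?thesis using l by (simp add: power_mult_distrib field_simps)
      qed
      finally show "real (hF (\<lambda>i. l * t i + a' i)) / real l ^ s \<le> (?A + ?B * inverse (real l)) ^ r * inverse (real l) ^ (s - r)"
        by (simp add: divide_right_mono)
    qed
  qed auto
  have suppF: "sum c UNIV \<le> r" if "eF c \<noteq> 0" for c
  proof (rule support_bound_of_growth[OF eF(1) _ that])
    fix s and t :: "'p \<Rightarrow> nat" assume "s > r" and t: "\<forall>i. 1 \<le> t i"
    from growF[OF this(1), of t "\<lambda>_. 0"]
    show "(\<lambda>l. real_of_rat (binomial_sum eF (\<lambda>i. l * t i)) / real l ^ s) \<longlonglongrightarrow> 0"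
    proof (rule Lim_transform_eventually)
      show "\<forall>\<^sub>F l in sequentially. real (hF (\<lambda>i. l * t i + 0)) / real l ^ s = real_of_rat (binomial_sum eF (\<lambda>i. l * t i)) / real l ^ s"
        using far[OF t, of \<nu>0 "\<lambda>_. 0"] by eventually_elim (simp flip: eF(2))
    qed
  qed
  have suppS: "sum c UNIV \<le> r" if "eS c \<noteq> 0" for c
  proof (rule support_bound_of_growth[OF eS(1) _ that])
    fix s and t :: "'p \<Rightarrow> nat" assume s: "s > r" and t: "\<forall>i. 1 \<le> t i"
    have "(\<lambda>l. real (hS (\<lambda>i. l * t i)) / real l ^ s) \<longlonglongrightarrow> 0"
    proof (rule tendsto_sandwich[OF _ _ tendsto_const])
      have "(\<lambda>l. real D * (real (hF (\<lambda>i. l * t i + b i)) / real l ^ s)) \<longlonglongrightarrow> real D * 0"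
        by (intro tendsto_mult tendsto_const growF s)
      then show "(\<lambda>l. real D * (real (hF (\<lambda>i. l * t i + b i)) / real l ^ s)) \<longlonglongrightarrow> 0" by simp
      show "\<forall>\<^sub>F l in sequentially. real (hS (\<lambda>i. l * t i)) / real l ^ s \<le> real D * (real (hF (\<lambda>i. l * t i + b i)) / real l ^ s)"
        by (intro always_eventually allI)
          (use upper of_nat_mono in \<open>fastforce intro: divide_right_mono simp flip: of_nat_mult\<close>)
    qed auto
    then show "(\<lambda>l. real_of_rat (binomial_sum eS (\<lambda>i. l * t i)) / real l ^ s) \<longlonglongrightarrow> 0"
    proof (rule Lim_transform_eventually)
      show "\<forall>\<^sub>F l in sequentially. real (hS (\<lambda>i. l * t i)) / real l ^ s = real_of_rat (binomial_sum eS (\<lambda>i. l * t i)) / real l ^ s"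
        using far[OF t, of \<nu>1 "\<lambda>_. 0"] by eventually_elim (simp flip: eS(2))
    qed
  qed
  have top: "top_form eS r t = of_nat D * top_form eF r t" if t: "\<forall>i. 1 \<le> t i" for t
  proof -
    have "real_of_rat (top_form eS r t) \<le> real D * real_of_rat (top_form eF r t)"
    proof (rule LIMSEQ_le)
      show "(\<lambda>l. real (hS (\<lambda>i. l * t i + 0)) / real l ^ r) \<longlonglongrightarrow> real_of_rat (top_form eS r t)"
        by (rule limS[OF t suppS])
      show "(\<lambda>l. real D * (real (hF (\<lambda>i. l * t i + b i)) / real l ^ r)) \<longlonglongrightarrow> real D * real_of_rat (top_form eF r t)"
        by (intro tendsto_mult tendsto_const limF[OF t suppF])
      show "\<exists>N. \<forall>l\<ge>N. real (hS (\<lambda>i. l * t i + 0)) / real l ^ r \<le> real D * (real (hF (\<lambda>i. l * t i + b i)) / real l ^ r)"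
        using upper of_nat_mono by (fastforce intro: divide_right_mono simp flip: of_nat_mult)
    qed
    moreover have "real D * real_of_rat (top_form eF r t) \<le> real_of_rat (top_form eS r t)"
    proof (rule LIMSEQ_le)
      show "(\<lambda>l. real D * (real (hF (\<lambda>i. l * t i + 0)) / real l ^ r)) \<longlonglongrightarrow> real D * real_of_rat (top_form eF r t)"
        by (intro tendsto_mult tendsto_const limF[OF t suppF])
      show "(\<lambda>l. real (hS (\<lambda>i. l * t i + a i)) / real l ^ r) \<longlonglongrightarrow> real_of_rat (top_form eS r t)"
        by (rule limS[OF t suppS])
      show "\<exists>N. \<forall>l\<ge>N. real D * (real (hF (\<lambda>i. l * t i + 0)) / real l ^ r) \<le> real (hS (\<lambda>i. l * t i + a i)) / real l ^ r"
        using lower of_nat_mono by (fastforce intro: divide_right_mono simp flip: of_nat_mult)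
    qed
    ultimately have "real_of_rat (top_form eS r t) = real_of_rat (of_nat D * top_form eF r t)"
      by (simp add: of_rat_mult)
    then show ?thesis by (simp only: of_rat_eq_iff)
  qed
  let ?e = "\<lambda>c. 1 * eS c + (- of_nat D) * eF c"
  have "top_form ?e r t = top_form eS r t - of_nat D * top_form eF r t" for t
  proof -
    let ?T = "{c. eS c \<noteq> 0} \<union> {c. eF c \<noteq> 0}" and ?m = "\<lambda>c. \<Prod>i\<in>UNIV. of_nat (t i) ^ c i / fact (c i)"
    have T: "finite ?T" using eS eF by (auto simp: finite_support_def)
    have *: "top_form e r t = (\<Sum>c\<in>?T. if sum c UNIV = r then e c * ?m c else 0)" if "{c. e c \<noteq> 0} \<subseteq> ?T" for e
      unfolding top_form_def by (rule sum.mono_neutral_cong_left) (use T that in auto)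
    have sub: "{c. ?e c \<noteq> 0} \<subseteq> ?T" "{c. eS c \<noteq> 0} \<subseteq> ?T" "{c. eF c \<noteq> 0} \<subseteq> ?T" by auto
    show ?thesis
      unfolding *[OF sub(1)] *[OF sub(2)] *[OF sub(3)] sum_distrib_left sum_subtractf[symmetric]
      by (rule sum.cong) (simp_all add: left_diff_distrib mult.assoc)
  qed
  note diff = this
  have "?e d = 0"
  proof (rule top_form_eq_0_imp[where s = r and e = ?e])
    show "finite_support ?e" by (rule finite_support_linear[OF eS(1) eF(1)])
    show "top_form ?e r t = 0" if "\<forall>i. 1 \<le> t i" for t
      by (simp only: diff top[OF that] diff_self)
  qed (rule d)
  then show ?thesis by simp
qed

section \<open>Pivots of a subspace\<close>

locale pivot_space = vector_space scale
  for scale :: "'a::field \<Rightarrow> 'b::ab_group_add \<Rightarrow> 'b"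
begin

text \<open>
  \<open>a\<close> is a pivot if some element of \<open>M\<close> has leading term \<open>w
  a\<close>. The pivots of \<open>{0}\<close> are the redundant members of the family
  \<open>w\<close>; subtracting them gives the right count for families that are dependent.
\<close>

definition pivots :: "('i \<Rightarrow> 'o::linorder) \<Rightarrow> ('i \<Rightarrow> 'b) \<Rightarrow> 'i set \<Rightarrow> 'b set \<Rightarrow> 'i set" where
  "pivots key w A M = {a \<in> A. \<exists>g\<in>M. g - w a \<in> span (w ` {b \<in> A. key b < key a})}"

lemma pivots_insert_max:
  assumes "\<And>y. y \<in> A \<Longrightarrow> key y < key x"
  shows "pivots key w (insert x A) M = pivots key w A M \<union>
    (if \<exists>g\<in>M. g - w x \<in> span (w ` A) then {x} else {})"
proof -
  have "{b \<in> insert x A. key b < key x} = A" using assms by auto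
  moreover have "{b \<in> insert x A. key b < key a} = {b \<in> A. key b < key a}" if "a \<in> A" for a
    using assms[OF that] by auto
  moreover have "x \<notin> A" using assms by auto
  ultimately show ?thesis unfolding pivots_def by auto
qed

lemma span_insert_cases:
  assumes "g \<in> span (insert v S)"
  obtains c where "g - scale c v \<in> span S"
  using assms by (auto simp: span_insert)

text \<open>
  Adding the largest index \<open>x\<close> enlarges the intersection of \<open>M\<close> with the
  span by at most one dimension. It does so exactly when \<open>x\<close> is a pivot of
  \<open>M\<close> but not of \<open>{0}\<close>.
\<close>

lemma pivots_basis:
  assumes "finite A" "inj_on key A" "subspace M"
  shows "\<exists>B. finite B \<and> independent B \<and> span B = M \<inter> span (w ` A) \<and>
    card B + card (pivots key w A {0}) = card (pivots key w A M)"
  using assms(1,2)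
proof (induction A rule: finite_ranking_induct[where f = key])
  case empty
  have "0 \<in> M" using assms(3) by (rule subspace_0)
  then show ?case
    by (intro exI[of _ "{}"]) (auto simp: pivots_def independent_empty)
next
  case (insert x A)
  show ?case
  proof (cases "x \<in> A")
    case True
    then show ?thesis using insert by (simp add: insert_absorb)
  next
    case False
    have max: "key y < key x" if "y \<in> A" for y
      using insert.hyps(2)[OF that] insert.prems False that by (metis inj_on_contraD insertCI order_le_less)
    obtain B where B: "finite B" "independent B" "span B = M \<inter> span (w ` A)"
      "card B + card (pivots key w A {0}) = card (pivots key w A M)"
      using insert.IH insert.prems by (auto simp: inj_on_def)
    have fin: "finite (pivots key w A N)" "x \<notin> pivots key w A N" for N
      using insert.hyps(1) False by (auto simp: pivots_def)
    have zero: "(\<exists>g\<in>{0}. g - w x \<in> span (w ` A)) \<longleftrightarrow> w x \<in> span (w ` A)"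
      using span_neg by (metis diff_0 minus_minus singletonD singletonI)
    have M0: "0 \<in> M" using assms(3) by (rule subspace_0)
    consider "w x \<in> span (w ` A)" | g where "w x \<notin> span (w ` A)" "g \<in> M" "g - w x \<in> span (w ` A)"
      | "w x \<notin> span (w ` A)" "\<not> (\<exists>g\<in>M. g - w x \<in> span (w ` A))" by blast
    then show ?thesis
    proof cases
      case 1
      then have "span (w ` insert x A) = span (w ` A)" by (simp add: span_redundant)
      moreover have "\<exists>g\<in>M. g - w x \<in> span (w ` A)" using zero 1 M0 by blast
      ultimately show ?thesis
        using B 1 fin zero by (intro exI[of _ B]) (simp add: pivots_insert_max[of A key x, OF max])
    next
      case 2
      have "g \<notin> span (w ` A)" using 2 span_diff[of g "w ` A" "g - w x"] by auto
      then have gB: "g \<notin> span B" using B by auto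
      have "span (insert g B) = M \<inter> span (w ` insert x A)"
      proof (rule antisym)
        have "w x \<in> span (insert (w x) (w ` A))" by (simp add: span_base)
        moreover have "g - w x \<in> span (insert (w x) (w ` A))"
          using 2(3) span_mono[of "w ` A" "insert (w x) (w ` A)"] by blast
        ultimately have "g - w x + w x \<in> span (insert (w x) (w ` A))" by (intro span_add)
        then have "g \<in> span (w ` insert x A)" by simp
        moreover have "B \<subseteq> span B" by (rule span_superset)
        moreover have "span (w ` A) \<subseteq> span (w ` insert x A)" by (intro span_mono) auto
        ultimately have "insert g B \<subseteq> M \<inter> span (w ` insert x A)" using 2 B by auto
        then show "span (insert g B) \<subseteq> M \<inter> span (w ` insert x A)"
          using assms(3) by (intro span_minimal subspace_inter) auto
        show "M \<inter> span (w ` insert x A) \<subseteq> span (insert g B)"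
        proof
          fix h assume h: "h \<in> M \<inter> span (w ` insert x A)"
          then obtain c where c: "h - scale c (w x) \<in> span (w ` A)"
            using span_insert_cases[of h "w x" "w ` A"] by auto
          have "h - scale c g = (h - scale c (w x)) - scale c (g - w x)"
            by (simp add: scale_right_diff_distrib)
          also have "\<dots> \<in> span (w ` A)" by (rule span_diff[OF c span_scale[OF 2(3)]])
          finally have "h - scale c g \<in> span B"
            using B h 2 assms(3) by (auto intro!: subspace_diff subspace_scale)
          then show "h \<in> span (insert g B)" by (auto simp: span_insert)
        qed
      qed
      moreover have "independent (insert g B)" using B gB by (simp add: independent_insert)
      moreover have "g \<notin> B" using gB span_base by blast
      moreover have "pivots key w (insert x A) {0} = pivots key w A {0}"
        using 2 zero by (simp add: pivots_insert_max[of A key x, OF max])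
      moreover have "pivots key w (insert x A) M = insert x (pivots key w A M)"
        using 2 by (auto simp: pivots_insert_max[of A key x, OF max])
      ultimately show ?thesis
        using B fin by (intro exI[of _ "insert g B"]) simp
    next
      case 3
      have "M \<inter> span (w ` insert x A) = M \<inter> span (w ` A)"
      proof (rule antisym; rule subsetI)
        fix h assume h: "h \<in> M \<inter> span (w ` insert x A)"
        then obtain c where c: "h - scale c (w x) \<in> span (w ` A)"
          using span_insert_cases[of h "w x" "w ` A"] by auto
        show "h \<in> M \<inter> span (w ` A)"
        proof (cases "c = 0")
          case False
          have "scale (inverse c) h - w x = scale (inverse c) (h - scale c (w x))"
            using False by (simp add: scale_right_diff_distrib)
          also have "\<dots> \<in> span (w ` A)" by (intro span_scale c)
          finally have "\<exists>g\<in>M. g - w x \<in> span (w ` A)"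
            using h assms(3) by (auto intro: subspace_scale)
          with 3 show ?thesis by blast
        qed (use c h in auto)
      next
        fix h assume "h \<in> M \<inter> span (w ` A)"
        then show "h \<in> M \<inter> span (w ` insert x A)"
          using span_mono[of "w ` A" "w ` insert x A"] by auto
      qed
      moreover have "pivots key w (insert x A) {0} = pivots key w A {0}"
        using 3 zero by (simp add: pivots_insert_max[of A key x, OF max])
      moreover have "pivots key w (insert x A) M = pivots key w A M"
        using 3 by (simp add: pivots_insert_max[of A key x, OF max])
      ultimately show ?thesis using B by (intro exI[of _ B]) simp
    qed
  qed
qed

lemma dim_eq_card_pivots:
  assumes "finite A" "inj_on key A" "subspace M" "M \<subseteq> span (w ` A)"
  shows "dim M + card (pivots key w A {0}) = card (pivots key w A M)"
proof -
  obtain B where "independent B" "span B = M \<inter> span (w ` A)"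
    "card B + card (pivots key w A {0}) = card (pivots key w A M)"
    using pivots_basis[OF assms(1-3)] by blast
  moreover have "M \<inter> span (w ` A) = M" "M = span M" using assms span_eq_iff[of M] by blast+
  ultimately show ?thesis by (metis dim_eq_card)
qed

lemma finite_basis_of_subspace:
  assumes "finite A" "subspace M" "M \<subseteq> span A"
  obtains B where "finite B" "independent B" "span B = M" "dim M = card B"
proof -
  obtain f :: "'b \<Rightarrow> nat" where f: "inj_on f A" using assms(1) finite_imp_inj_to_nat_seg by blast
  obtain B where "finite B" "independent B" "span B = M \<inter> span ((\<lambda>a. a) ` A)"
    using pivots_basis[OF assms(1) f assms(2)] by blast
  moreover have "M \<inter> span ((\<lambda>a. a) ` A) = M" using assms(3) by auto
  moreover have "M = span M" using assms(2) by (metis span_eq_iff)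
  ultimately show ?thesis using that by (metis dim_eq_card)
qed

text \<open>
  Division with remainder: an element of \<open>M\<close> can be reduced by elements of
  \<open>N\<close> with the same leading term, and the process ends since the leading term
  decreases.
\<close>

lemma subspace_eq_if_pivots_le:
  assumes "finite A" "inj_on key A" "subspace M" "M \<subseteq> span (w ` A)" "subspace N" "N \<subseteq> M"
    and "pivots key w A M \<subseteq> pivots key w A N"
  shows "M = N"
proof -
  have "M \<inter> span (w ` A) \<subseteq> N"
    using assms(1,2,7)
  proof (induction A rule: finite_ranking_induct[where f = key])
    case empty
    then show ?case using assms(5) by (auto simp: subspace_0)
  next
    case (insert x A)
    show ?case
    proof (cases "x \<in> A")
      case True
      then show ?thesis using insert by (simp add: insert_absorb)
    next
      case False
      have max: "key y < key x" if "y \<in> A" for y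
        using insert.hyps(2)[OF that] insert.prems False that by (metis inj_on_contraD insertCI order_le_less)
      have x: "x \<notin> pivots key w A M" using False by (auto simp: pivots_def)
      have IH: "M \<inter> span (w ` A) \<subseteq> N"
        using insert x False
        by (intro insert.IH) (auto simp: pivots_insert_max[of A key x, OF max] inj_on_def split: if_splits)
      show ?thesis
      proof
        fix h assume h: "h \<in> M \<inter> span (w ` insert x A)"
        then obtain c where c: "h - scale c (w x) \<in> span (w ` A)"
          using span_insert_cases[of h "w x" "w ` A"] by auto
        show "h \<in> N"
        proof (cases "c = 0")
          case False
          have "scale (inverse c) h - w x = scale (inverse c) (h - scale c (w x))"
            using False by (simp add: scale_right_diff_distrib)
          also have "\<dots> \<in> span (w ` A)" by (intro span_scale c)
          finally have "\<exists>g\<in>M. g - w x \<in> span (w ` A)"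
            using h assms(3) by (auto intro: subspace_scale)
          then have "x \<in> pivots key w (insert x A) N"
            using insert.prems(2) by (auto simp: pivots_insert_max[of A key x, OF max])
          moreover have "x \<notin> pivots key w A N" using \<open>x \<notin> A\<close> by (simp add: pivots_def)
          ultimately obtain g where g: "g \<in> N" "g - w x \<in> span (w ` A)"
            by (auto simp: pivots_insert_max[of A key x, OF max] split: if_splits)
          have "h - scale c g = (h - scale c (w x)) - scale c (g - w x)"
            by (simp add: scale_right_diff_distrib)
          also have "\<dots> \<in> span (w ` A)" by (rule span_diff[OF c span_scale[OF g(2)]])
          finally have "h - scale c g \<in> span (w ` A)" .
          moreover have "h - scale c g \<in> M"
            using h g assms(3,6) by (intro subspace_diff subspace_scale) auto
          ultimately have "h - scale c g \<in> N" using IH by blast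
          then have "h - scale c g + scale c g \<in> N"
            using g assms(5) by (intro subspace_add subspace_scale)
          then show ?thesis by simp
        qed (use c h IH in auto)
      qed
    qed
  qed
  then show ?thesis using assms(4,6) by auto
qed

lemma card_le_dim_of_independent_family:
  assumes I: "finite I" and w: "\<And>c. (\<Sum>i\<in>I. scale (c i) (w i)) = 0 \<Longrightarrow> \<forall>i\<in>I. c i = 0"
    and M: "w ` I \<subseteq> M" "subspace M" "finite A" "M \<subseteq> span A"
  shows "card I \<le> dim M"
proof -
  have inj: "inj_on w I"
  proof (rule inj_onI, rule ccontr)
    fix i j assume ij: "i \<in> I" "j \<in> I" "w i = w j" "i \<noteq> j"
    let ?c = "\<lambda>k. if k = i then 1 else if k = j then -1 else (0::'a)"
    have "(\<Sum>k\<in>I. scale (?c k) (w k)) = scale (?c i) (w i) + (\<Sum>k\<in>I - {i}. scale (?c k) (w k))"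
      by (rule sum.remove[OF I ij(1)])
    also have "(\<Sum>k\<in>I - {i}. scale (?c k) (w k)) = scale (?c j) (w j) + (\<Sum>k\<in>I - {i} - {j}. scale (?c k) (w k))"
      by (rule sum.remove) (use I ij in auto)
    also have "(\<Sum>k\<in>I - {i} - {j}. scale (?c k) (w k)) = 0"
      by (rule sum.neutral) auto
    finally have "(\<Sum>k\<in>I. scale (?c k) (w k)) = 0" using ij by simp
    from w[OF this] ij(1) have "?c i = 0" by (rule bspec)
    then show False by simp
  qed
  have "independent (w ` I)"
    unfolding independent_explicit_module
  proof (intro allI impI)
    fix t u v assume t: "finite t" "t \<subseteq> w ` I" "(\<Sum>v\<in>t. scale (u v) v) = 0" "v \<in> t"
    have "(\<Sum>i\<in>I. scale (if w i \<in> t then u (w i) else 0) (w i)) = (\<Sum>v\<in>w ` I. scale (if v \<in> t then u v else 0) v)"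
      by (subst sum.reindex[OF inj]) simp
    also have "\<dots> = (\<Sum>v\<in>t. scale (u v) v)"
      by (rule sum.mono_neutral_cong_right) (use I t(2) in auto)
    also have "\<dots> = 0" by (rule t(3))
    finally have zero: "\<forall>i\<in>I. (if w i \<in> t then u (w i) else 0) = 0" by (rule w)
    obtain i where i: "i \<in> I" "v = w i" using t(2,4) by blast
    show "u v = 0" using bspec[OF zero i(1)] t(4) i(2) by simp
  qed
  moreover obtain B where B: "finite B" "span B = M" "dim M = card B"
    by (rule finite_basis_of_subspace[OF M(3,2,4)])
  ultimately have "card (w ` I) \<le> card B"
    using independent_span_bound[of B "w ` I"] M(1) by simp
  then show ?thesis using B(3) card_image[OF inj] by simp
qed

end

section \<open>Monomial ideals\<close>

text \<open>
  Fix \<open>u0 \<in> U\<close>. An element that is not above \<open>u0\<close> is smaller than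
  \<open>u0\<close> in some coordinate, so it lies in one of finitely many slices, each of which
  has one coordinate less.
\<close>

lemma dickson:
  fixes U :: "('z \<Rightarrow> nat) set"
  assumes "finite Z" "\<And>u z. u \<in> U \<Longrightarrow> z \<notin> Z \<Longrightarrow> u z = 0"
  shows "\<exists>B. finite B \<and> B \<subseteq> U \<and> (\<forall>u\<in>U. \<exists>b\<in>B. b \<le> u)"
  using assms
proof (induction Z arbitrary: U rule: finite_psubset_induct)
  case (psubset Z)
  show ?case
  proof (cases "U = {}")
    case False
    then obtain u0 where u0: "u0 \<in> U" by blast
    define slice where "slice z t = (\<lambda>u. u(z := 0)) ` {u \<in> U. u z = t}" for z t
    have "\<exists>B. finite B \<and> B \<subseteq> slice z t \<and> (\<forall>u\<in>slice z t. \<exists>b\<in>B. b \<le> u)" if "z \<in> Z" for z t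
      by (rule psubset.IH[of "Z - {z}"]) (use that psubset.prems in \<open>auto simp: slice_def\<close>)
    then obtain B where B: "finite (B z t)" "B z t \<subseteq> slice z t" "\<forall>u\<in>slice z t. \<exists>b\<in>B z t. b \<le> u"
      if "z \<in> Z" for z t by metis
    let ?B = "insert u0 (\<Union>z\<in>Z. \<Union>t\<in>{..<u0 z}. (\<lambda>b. b(z := t)) ` B z t)"
    have "finite ?B" using psubset.hyps B by auto
    moreover have "?B \<subseteq> U"
    proof -
      have "b(z := t) \<in> U" if "z \<in> Z" "b \<in> B z t" for z t b
      proof -
        from B(2)[OF that(1)] that(2) have "b \<in> slice z t" by blast
        then obtain u where "u \<in> U" "u z = t" "b = u(z := 0)" by (auto simp: slice_def)
        then show ?thesis by (metis fun_upd_triv fun_upd_upd)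
      qed
      then show ?thesis using u0 by auto
    qed
    moreover have "\<exists>b\<in>?B. b \<le> u" if u: "u \<in> U" for u
    proof (cases "u0 \<le> u")
      case False
      then obtain z where z: "u z < u0 z" by (auto simp: le_fun_def not_le)
      then have "z \<in> Z" using psubset.prems[OF u0, of z] by (cases "z \<in> Z") auto
      have "u(z := 0) \<in> slice z (u z)" using u by (auto simp: slice_def)
      then obtain b where b: "b \<in> B z (u z)" "b \<le> u(z := 0)" using B(3)[OF \<open>z \<in> Z\<close>] by blast
      have "b(z := u z) \<le> u" using b(2) by (auto simp: le_fun_def split: if_splits)
      moreover have "b(z := u z) \<in> ?B" using b(1) z \<open>z \<in> Z\<close> by auto
      ultimately show ?thesis by blast
    qed auto
    ultimately show ?thesis by blast
  qed auto
qed

text \<open>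
  Exponent vectors on the variables \<open>Y\<close> whose total degree in the variables of colour
  \<open>i\<close> is \<open>\<nu> i\<close>.
\<close>

definition exponents :: "'y set \<Rightarrow> ('y \<Rightarrow> 'p) \<Rightarrow> ('p \<Rightarrow> nat) \<Rightarrow> ('y \<Rightarrow> nat) set" where
  "exponents Y col \<nu> = {\<alpha>. (\<forall>y. y \<notin> Y \<longrightarrow> \<alpha> y = 0) \<and> (\<forall>i. (\<Sum>y | y \<in> Y \<and> col y = i. \<alpha> y) = \<nu> i)}"

lemma finite_exponents:
  fixes col :: "'y \<Rightarrow> 'p::finite"
  assumes "finite Y"
  shows "finite (exponents Y col \<nu>)"
proof (rule finite_subset)
  show "exponents Y col \<nu> \<subseteq> {\<alpha>. \<alpha> ` Y \<subseteq> {..sum \<nu> UNIV} \<and> (\<forall>y. y \<notin> Y \<longrightarrow> \<alpha> y = 0)}"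
  proof safe
    fix \<alpha> y assume \<alpha>: "\<alpha> \<in> exponents Y col \<nu>" and y: "y \<in> Y"
    have "\<alpha> y \<le> (\<Sum>y' | y' \<in> Y \<and> col y' = col y. \<alpha> y')"
      by (rule member_le_sum) (use y assms in auto)
    also have "\<dots> = \<nu> (col y)" using \<alpha> by (simp add: exponents_def)
    also have "\<dots> \<le> sum \<nu> UNIV" by (rule member_le_sum) auto
    finally show "\<alpha> y \<le> sum \<nu> UNIV" .
  qed (auto simp: exponents_def)
  have "finite ({..sum \<nu> UNIV} :: nat set)" by simp
  from finite_set_of_finite_funs[OF assms this, of 0]
  show "finite {\<alpha>. \<alpha> ` Y \<subseteq> {..sum \<nu> UNIV} \<and> (\<forall>y. y \<notin> Y \<longrightarrow> \<alpha> y = 0)}"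
    by (rule rev_finite_subset) auto
qed

text \<open>
  The number of ways to write \<open>n\<close> as an ordered sum of \<open>s\<close> natural
  numbers.
\<close>

fun weak_composition_count :: "nat \<Rightarrow> nat \<Rightarrow> nat" where
  "weak_composition_count 0 n = (if n = 0 then 1 else 0)"
| "weak_composition_count (Suc s) n = (n + s) choose s"

lemma weak_composition_count_Suc:
  "weak_composition_count (Suc s) n = (\<Sum>t\<le>n. weak_composition_count s (n - t))"
proof -
  have "(\<Sum>t\<le>n. weak_composition_count s (n - t)) = (\<Sum>t\<le>n. weak_composition_count s t)"
    by (rule sum.reindex_bij_witness[of _ "\<lambda>t. n - t" "\<lambda>t. n - t"]) auto
  also have "\<dots> = weak_composition_count (Suc s) n"
  proof (cases s)
    case (Suc s')
    then show ?thesis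
      using choose_rising_sum(1)[of s' n] by (simp add: add_ac)
  qed (simp add: sum.delta)
  finally show ?thesis ..
qed

lemma card_exponents:
  fixes col :: "'y \<Rightarrow> 'p::finite"
  assumes "finite Y"
  shows "card (exponents Y col \<nu>) = (\<Prod>i\<in>UNIV. weak_composition_count (card {y \<in> Y. col y = i}) (\<nu> i))"
  using assms
proof (induction Y arbitrary: \<nu> rule: finite_induct)
  case empty
  show ?case
  proof (cases "\<nu> = (\<lambda>_. 0)")
    case True
    then have "exponents {} col \<nu> = {\<lambda>_. 0}" by (auto simp: exponents_def)
    then show ?thesis using True by simp
  next
    case False
    then obtain i where "\<nu> i \<noteq> 0" by auto
    then have "exponents {} col \<nu> = {}" by (force simp: exponents_def)
    moreover have "(\<Prod>i\<in>UNIV. weak_composition_count (card {y \<in> {}. col y = i}) (\<nu> i)) = 0"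
      by (rule prod_zero) (use \<open>\<nu> i \<noteq> 0\<close> in auto)
    ultimately show ?thesis by simp
  qed
next
  case (insert y Y)
  let ?c = "col y"
  let ?\<nu> = "\<lambda>t. \<nu>(?c := \<nu> ?c - t)"
  let ?up = "\<lambda>t \<alpha>. \<alpha>(y := t)"
  have "exponents (insert y Y) col \<nu> = (\<Union>t\<in>{..\<nu> ?c}. ?up t ` exponents Y col (?\<nu> t))"
  proof (rule Set.set_eqI, rule iffI)
    fix \<alpha> assume \<alpha>: "\<alpha> \<in> exponents (insert y Y) col \<nu>"
    have sp: "(\<Sum>y' | y' \<in> insert y Y \<and> col y' = i. \<alpha> y') =
        (if i = ?c then \<alpha> y else 0) + (\<Sum>y' | y' \<in> Y \<and> col y' = i. \<alpha> y')" for i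
    proof (cases "i = ?c")
      case True
      then have "{y'. y' \<in> insert y Y \<and> col y' = i} = insert y {y'. y' \<in> Y \<and> col y' = i}" by auto
      then show ?thesis using True insert by simp
    next
      case False
      then have "{y'. y' \<in> insert y Y \<and> col y' = i} = {y'. y' \<in> Y \<and> col y' = i}" by auto
      then show ?thesis using False by simp
    qed
    have eq: "(\<Sum>y' | y' \<in> Y \<and> col y' = i. (\<alpha>(y := 0)) y') = (\<Sum>y' | y' \<in> Y \<and> col y' = i. \<alpha> y')" for i
      by (rule sum.cong) (use insert in auto)
    have sums: "(if i = ?c then \<alpha> y else 0) + (\<Sum>y' | y' \<in> Y \<and> col y' = i. \<alpha> y') = \<nu> i" for i
      using \<alpha> sp[of i] by (simp add: exponents_def)
    have "\<alpha>(y := 0) \<in> exponents Y col (?\<nu> (\<alpha> y))"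
      unfolding exponents_def
    proof (intro CollectI conjI allI impI)
      fix i
      show "(\<Sum>y' | y' \<in> Y \<and> col y' = i. (\<alpha>(y := 0)) y') = (?\<nu> (\<alpha> y)) i"
        unfolding eq using sums[of i] by (auto split: if_splits)
    qed (use \<alpha> in \<open>auto simp: exponents_def\<close>)
    moreover have "\<alpha> y \<le> \<nu> ?c" using sums[of ?c] by simp
    moreover have "\<alpha> = ?up (\<alpha> y) (\<alpha>(y := 0))" by simp
    ultimately show "\<alpha> \<in> (\<Union>t\<in>{..\<nu> ?c}. ?up t ` exponents Y col (?\<nu> t))" by blast
  next
    fix \<alpha> assume "\<alpha> \<in> (\<Union>t\<in>{..\<nu> ?c}. ?up t ` exponents Y col (?\<nu> t))"
    then obtain t \<beta> where t: "t \<le> \<nu> ?c" and \<beta>: "\<beta> \<in> exponents Y col (?\<nu> t)" and \<alpha>: "\<alpha> = \<beta>(y := t)"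
      by auto
    have "(\<Sum>y' | y' \<in> insert y Y \<and> col y' = i. \<alpha> y') = \<nu> i" for i
    proof -
      have eq: "(\<Sum>y' | y' \<in> Y \<and> col y' = i. \<alpha> y') = (\<Sum>y' | y' \<in> Y \<and> col y' = i. \<beta> y')"
        by (rule sum.cong) (use insert \<alpha> in auto)
      have \<beta>i: "(\<Sum>y' | y' \<in> Y \<and> col y' = i. \<beta> y') = (?\<nu> t) i" using \<beta> by (simp add: exponents_def)
      show ?thesis
      proof (cases "i = ?c")
        case True
        then have "{y'. y' \<in> insert y Y \<and> col y' = i} = insert y {y'. y' \<in> Y \<and> col y' = i}" by auto
        then show ?thesis using True insert \<beta>i eq \<alpha> t by simp
      next
        case False
        then have "{y'. y' \<in> insert y Y \<and> col y' = i} = {y'. y' \<in> Y \<and> col y' = i}" by auto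
        then show ?thesis using False eq \<beta>i by simp
      qed
    qed
    then show "\<alpha> \<in> exponents (insert y Y) col \<nu>"
      using \<beta> \<alpha> by (auto simp: exponents_def)
  qed
  moreover have "card (\<Union>t\<in>{..\<nu> ?c}. ?up t ` exponents Y col (?\<nu> t)) =
      (\<Sum>t\<le>\<nu> ?c. card (?up t ` exponents Y col (?\<nu> t)))"
  proof (rule card_UN_disjoint)
    show "\<forall>t\<in>{..\<nu> ?c}. \<forall>t'\<in>{..\<nu> ?c}. t \<noteq> t' \<longrightarrow>
        ?up t ` exponents Y col (?\<nu> t) \<inter> ?up t' ` exponents Y col (?\<nu> t') = {}"
      by (auto, metis fun_upd_same)
  qed (auto intro: finite_exponents insert)
  moreover have "card (?up t ` exponents Y col \<mu>) = card (exponents Y col \<mu>)" for t \<mu>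
  proof (rule card_image, rule inj_onI)
    fix \<alpha> \<beta> assume "\<alpha> \<in> exponents Y col \<mu>" "\<beta> \<in> exponents Y col \<mu>" "\<alpha>(y := t) = \<beta>(y := t)"
    moreover from this have "\<alpha> y = 0" "\<beta> y = 0" using insert by (auto simp: exponents_def)
    ultimately show "\<alpha> = \<beta>" by (metis fun_upd_triv fun_upd_upd)
  qed
  ultimately have "card (exponents (insert y Y) col \<nu>) = (\<Sum>t\<le>\<nu> ?c.
      \<Prod>i\<in>UNIV. weak_composition_count (card {y \<in> Y. col y = i}) ((?\<nu> t) i))"
    by (simp add: insert.IH)
  also have "\<dots> = (\<Sum>t\<le>\<nu> ?c. weak_composition_count (card {y \<in> Y. col y = ?c}) (\<nu> ?c - t) *
      (\<Prod>i\<in>UNIV - {?c}. weak_composition_count (card {y \<in> Y. col y = i}) (\<nu> i)))"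
  proof (rule sum.cong[OF refl])
    fix t
    have "(\<Prod>i\<in>UNIV. weak_composition_count (card {y \<in> Y. col y = i}) ((?\<nu> t) i)) =
      weak_composition_count (card {y \<in> Y. col y = ?c}) ((?\<nu> t) ?c) *
      (\<Prod>i\<in>UNIV - {?c}. weak_composition_count (card {y \<in> Y. col y = i}) ((?\<nu> t) i))"
      by (rule prod.remove) auto
    also have "(\<Prod>i\<in>UNIV - {?c}. weak_composition_count (card {y \<in> Y. col y = i}) ((?\<nu> t) i)) =
      (\<Prod>i\<in>UNIV - {?c}. weak_composition_count (card {y \<in> Y. col y = i}) (\<nu> i))"
      by (rule prod.cong) auto
    finally show "(\<Prod>i\<in>UNIV. weak_composition_count (card {y \<in> Y. col y = i}) ((?\<nu> t) i)) =
      weak_composition_count (card {y \<in> Y. col y = ?c}) (\<nu> ?c - t) *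
      (\<Prod>i\<in>UNIV - {?c}. weak_composition_count (card {y \<in> Y. col y = i}) (\<nu> i))" by simp
  qed
  also have "\<dots> = weak_composition_count (Suc (card {y \<in> Y. col y = ?c})) (\<nu> ?c) *
      (\<Prod>i\<in>UNIV - {?c}. weak_composition_count (card {y \<in> Y. col y = i}) (\<nu> i))"
    unfolding weak_composition_count_Suc by (simp add: sum_distrib_right)
  also have "\<dots> = (\<Prod>i\<in>UNIV. weak_composition_count (card {y' \<in> insert y Y. col y' = i}) (\<nu> i))"
  proof -
    have "{y' \<in> insert y Y. col y' = ?c} = insert y {y' \<in> Y. col y' = ?c}" by auto
    moreover have "{y' \<in> insert y Y. col y' = i} = {y' \<in> Y. col y' = i}" if "i \<noteq> ?c" for i
      using that by auto
    ultimately show ?thesis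
      using insert by (subst prod.remove[of UNIV ?c]) (auto intro!: arg_cong2[of _ _ _ _ "(*)"] prod.cong)
  qed
  finally show ?case .
qed

text \<open>
  A colour without variables admits only degree \<open>0\<close>, which makes the count eventually
  zero.
\<close>

lemma eventually_polynomial_card_exponents:
  fixes col :: "'y \<Rightarrow> 'p::finite"
  assumes "finite Y"
  shows "eventually_polynomial (\<lambda>\<nu>. of_nat (card (exponents Y col \<nu>)))"
proof (cases "\<exists>i. {y \<in> Y. col y = i} = {}")
  case True
  then obtain i where i: "{y \<in> Y. col y = i} = {}" by blast
  show ?thesis
  proof (rule eventually_polynomial_cong[OF eventually_polynomial_0])
    fix \<nu> :: "'p \<Rightarrow> nat" assume "\<forall>j. 1 \<le> \<nu> j"
    then have "\<nu> i \<noteq> 0" by (metis not_one_le_zero)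
    then have "weak_composition_count (card {y \<in> Y. col y = i}) (\<nu> i) = 0" unfolding i by simp
    then have "(\<Prod>i\<in>UNIV. weak_composition_count (card {y \<in> Y. col y = i}) (\<nu> i)) = 0"
      by (intro prod_zero) auto
    then show "of_nat (card (exponents Y col \<nu>)) = (0::rat)" by (simp add: card_exponents assms)
  qed
next
  case False
  have "weak_composition_count (card {y \<in> Y. col y = i}) n =
      (n + (card {y \<in> Y. col y = i} - 1)) choose (card {y \<in> Y. col y = i} - 1)" for i n
  proof -
    have "card {y \<in> Y. col y = i} \<noteq> 0" using False assms by auto
    then show ?thesis by (cases "card {y \<in> Y. col y = i}") auto
  qed
  then have "of_nat (card (exponents Y col \<nu>)) = binomial_product (\<lambda>i. card {y \<in> Y. col y = i} - 1) \<nu>" for \<nu>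
    by (simp add: card_exponents assms binomial_product_def)
  then show ?thesis by (simp add: eventually_polynomial_binomial_product)
qed

lemma eventually_polynomial_card_cone:
  fixes col :: "'y \<Rightarrow> 'p::finite"
  assumes Y: "finite Y"
  shows "eventually_polynomial (\<lambda>\<nu>. of_nat (card {\<alpha> \<in> exponents Y col \<nu>. b \<le> \<alpha>}))"
proof (cases "\<forall>y. y \<notin> Y \<longrightarrow> b y = 0")
  case False
  then obtain y where y: "y \<notin> Y" "b y \<noteq> 0" by blast
  have "\<not> b \<le> \<alpha>" if "\<alpha> \<in> exponents Y col \<nu>" for \<alpha> \<nu>
  proof
    assume "b \<le> \<alpha>"
    then have "b y \<le> \<alpha> y" by (rule le_funD)
    moreover have "\<alpha> y = 0" using that y(1) by (simp add: exponents_def)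
    ultimately show False using y(2) by simp
  qed
  then have "{\<alpha> \<in> exponents Y col \<nu>. b \<le> \<alpha>} = {}" for \<nu> by blast
  then show ?thesis by (simp only: card.empty of_nat_0 eventually_polynomial_0)
next
  case True
  define a where "a i = (\<Sum>y | y \<in> Y \<and> col y = i. b y)" for i
  have "eventually_polynomial (\<lambda>\<nu>. of_nat (card (exponents Y col (\<lambda>i. \<nu> i - a i))))"
    by (rule eventually_polynomial_shift[OF eventually_polynomial_card_exponents[OF Y]])
  then show ?thesis
  proof (rule eventually_polynomial_cong)
    fix \<nu> assume \<nu>: "\<forall>i. a i \<le> \<nu> i"
    have "bij_betw (\<lambda>\<alpha> y. \<alpha> y + b y) (exponents Y col (\<lambda>i. \<nu> i - a i)) {\<alpha> \<in> exponents Y col \<nu>. b \<le> \<alpha>}"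
    proof (rule bij_betwI[where g = "\<lambda>\<alpha> y. \<alpha> y - b y"])
      show "(\<lambda>\<alpha> y. \<alpha> y + b y) \<in> exponents Y col (\<lambda>i. \<nu> i - a i) \<rightarrow> {\<alpha> \<in> exponents Y col \<nu>. b \<le> \<alpha>}"
        using True \<nu> by (auto simp: exponents_def le_fun_def sum.distrib a_def)
      show "(\<lambda>\<alpha> y. \<alpha> y - b y) \<in> {\<alpha> \<in> exponents Y col \<nu>. b \<le> \<alpha>} \<rightarrow> exponents Y col (\<lambda>i. \<nu> i - a i)"
        by (auto simp: exponents_def le_fun_def sum_subtractf_nat a_def)
    qed (auto simp: le_fun_def)
    then show "(of_nat (card {\<alpha> \<in> exponents Y col \<nu>. b \<le> \<alpha>}) :: rat) = of_nat (card (exponents Y col (\<lambda>i. \<nu> i - a i)))"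
      by (simp add: bij_betw_same_card)
  qed
qed

text \<open>
  Inclusion-exclusion: the intersection of the cone at \<open>b\<close> with the up-closure of
  \<open>B'\<close> is the up-closure of the suprema \<open>sup b' b\<close>, a set that is no
  larger than \<open>B'\<close>.
\<close>

lemma eventually_polynomial_card_up_closure:
  fixes col :: "'y \<Rightarrow> 'p::finite"
  assumes Y: "finite Y" and "finite B"
  shows "eventually_polynomial (\<lambda>\<nu>. of_nat (card {\<alpha> \<in> exponents Y col \<nu>. \<exists>b\<in>B. b \<le> \<alpha>}))"
  using assms(2)
proof (induction "card B" arbitrary: B rule: less_induct)
  case less
  show ?case
  proof (cases "B = {}")
    case False
    then obtain b where b: "b \<in> B" by blast
    define B' where "B' = B - {b}"
    have B: "B = insert b B'" "finite B'" "card B' < card B"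
      using b less.prems card_Diff1_less[OF less.prems b] by (auto simp: B'_def)
    let ?C = "\<lambda>\<nu> B. {\<alpha> \<in> exponents Y col \<nu>. \<exists>b\<in>B. b \<le> \<alpha>}"
    have "card ((\<lambda>b'. sup b' b) ` B') < card B"
      using card_image_le[OF B(2), of "\<lambda>b'. sup b' b"] B(3) by linarith
    then have 1: "eventually_polynomial (\<lambda>\<nu>. of_nat (card (?C \<nu> ((\<lambda>b'. sup b' b) ` B'))))"
      using less.hyps B(2) by blast
    have 2: "eventually_polynomial (\<lambda>\<nu>. of_nat (card (?C \<nu> B')))"
      using less.hyps B(2,3) by blast
    have "(of_nat (card (?C \<nu> B)) :: rat) = of_nat (card (?C \<nu> B')) + of_nat (card {\<alpha> \<in> exponents Y col \<nu>. b \<le> \<alpha>})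
        - of_nat (card (?C \<nu> ((\<lambda>b'. sup b' b) ` B')))" for \<nu>
    proof -
      have un: "?C \<nu> B = ?C \<nu> B' \<union> {\<alpha> \<in> exponents Y col \<nu>. b \<le> \<alpha>}" unfolding B(1) by auto
      have int: "?C \<nu> ((\<lambda>b'. sup b' b) ` B') = ?C \<nu> B' \<inter> {\<alpha> \<in> exponents Y col \<nu>. b \<le> \<alpha>}"
        by auto
      have "card (?C \<nu> B') + card {\<alpha> \<in> exponents Y col \<nu>. b \<le> \<alpha>} =
          card (?C \<nu> B) + card (?C \<nu> ((\<lambda>b'. sup b' b) ` B'))"
        unfolding un int by (rule card_Un_Int) (simp_all add: finite_exponents[OF Y])
      from arg_cong[OF this, of "of_nat :: nat \<Rightarrow> rat"] show ?thesis
        unfolding of_nat_add eq_diff_eq by (rule sym)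
    qed
    note count = this
    have "eventually_polynomial (\<lambda>\<nu>. of_nat (card (?C \<nu> B')) + of_nat (card {\<alpha> \<in> exponents Y col \<nu>. b \<le> \<alpha>})
        - of_nat (card (?C \<nu> ((\<lambda>b'. sup b' b) ` B'))))"
      by (rule eventually_polynomial_diff[OF eventually_polynomial_add[OF 2 eventually_polynomial_card_cone[OF Y]] 1])
    then show ?thesis by (simp only: count)
  qed (simp add: eventually_polynomial_0)
qed

lemma eventually_polynomial_card_upset:
  fixes col :: "'y \<Rightarrow> 'p::finite"
  assumes Y: "finite Y" and supp: "\<And>\<alpha> y. \<alpha> \<in> U \<Longrightarrow> y \<notin> Y \<Longrightarrow> \<alpha> y = 0"
    and up: "\<And>\<alpha> \<beta>. \<alpha> \<in> U \<Longrightarrow> (\<forall>y. y \<notin> Y \<longrightarrow> \<beta> y = 0) \<Longrightarrow> (\<lambda>y. \<alpha> y + \<beta> y) \<in> U"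
  shows "eventually_polynomial (\<lambda>\<nu>. of_nat (card (exponents Y col \<nu> \<inter> U)))"
proof -
  have "\<exists>B. finite B \<and> B \<subseteq> U \<and> (\<forall>u\<in>U. \<exists>b\<in>B. b \<le> u)"
    by (rule dickson[OF Y]) (rule supp)
  then obtain B where "finite B \<and> B \<subseteq> U \<and> (\<forall>u\<in>U. \<exists>b\<in>B. b \<le> u)" by (rule exE)
  then have B: "finite B" "B \<subseteq> U" "\<forall>u\<in>U. \<exists>b\<in>B. b \<le> u" by simp_all
  have "exponents Y col \<nu> \<inter> U = {\<alpha> \<in> exponents Y col \<nu>. \<exists>b\<in>B. b \<le> \<alpha>}" for \<nu>
  proof (rule Set.set_eqI, rule iffI)
    fix \<alpha> assume "\<alpha> \<in> exponents Y col \<nu> \<inter> U"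
    then show "\<alpha> \<in> {\<alpha> \<in> exponents Y col \<nu>. \<exists>b\<in>B. b \<le> \<alpha>}" using B(3) by simp
  next
    fix \<alpha> assume "\<alpha> \<in> {\<alpha> \<in> exponents Y col \<nu>. \<exists>b\<in>B. b \<le> \<alpha>}"
    then obtain b where b: "\<alpha> \<in> exponents Y col \<nu>" "b \<in> U" "b \<le> \<alpha>" using B(2) by auto
    have "(\<lambda>y. b y + (\<alpha> y - b y)) \<in> U"
      by (rule up[OF b(2)]) (use b(1) in \<open>simp add: exponents_def\<close>)
    moreover have "(\<lambda>y. b y + (\<alpha> y - b y)) = \<alpha>" using b(3) by (simp add: le_fun_def)
    ultimately show "\<alpha> \<in> exponents Y col \<nu> \<inter> U" using b(1) by simp
  qed
  then show ?thesis using eventually_polynomial_card_up_closure[OF Y B(1), of col] by (simp only:)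
qed

section \<open>Ideals and vector spaces of forms\<close>

interpretation kvs: pivot_space "\<lambda>(c::'k::field) (g::('v, 'k) mpol). Const c * g"
  by (intro pivot_space.intro vector_space_mpol)

interpretation const_eval: coefficient_hom "Const :: 'c::comm_semiring_1 \<Rightarrow> ('x, 'c) mpol"
  by unfold_locales (auto simp: Const_add Const_mult)

lemma kdim_alt: "kdim V = kvs.dim V"
  by (simp add: kdim_def)

lemma gen_ideal_base: "x \<in> S \<Longrightarrow> x \<in> gen_ideal S"
  unfolding gen_ideal_def by (rule module.span_base[OF module_ring])

lemma gen_ideal_add: "x \<in> gen_ideal S \<Longrightarrow> y \<in> gen_ideal S \<Longrightarrow> x + y \<in> gen_ideal S"
  unfolding gen_ideal_def by (rule module.span_add[OF module_ring])

lemma gen_ideal_0: "0 \<in> gen_ideal S"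
  unfolding gen_ideal_def by (rule module.span_zero[OF module_ring])

lemma gen_ideal_mult: "x \<in> gen_ideal S \<Longrightarrow> c * x \<in> gen_ideal S"
  unfolding gen_ideal_def by (rule module.span_scale[OF module_ring])

lemma gen_ideal_sum: "(\<And>a. a \<in> A \<Longrightarrow> p a \<in> gen_ideal S) \<Longrightarrow> (\<Sum>a\<in>A. p a) \<in> gen_ideal S"
  unfolding gen_ideal_def by (rule module.span_sum[OF module_ring])

lemma gen_ideal_induct [consumes 1, case_names zero step]:
  assumes "x \<in> gen_ideal S" "P 0" "\<And>c x y. x \<in> S \<Longrightarrow> P y \<Longrightarrow> P (c * x + y)"
  shows "P x"
  using assms unfolding gen_ideal_def by (rule module.span_induct_alt[OF module_ring])

text \<open>It suffices to multiply generators.\<close>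

lemma gen_ideal_times:
  assumes a: "a \<in> gen_ideal A" and b: "b \<in> gen_ideal B"
    and AB: "\<And>x y. x \<in> A \<Longrightarrow> y \<in> B \<Longrightarrow> x * y \<in> gen_ideal C"
  shows "a * b \<in> gen_ideal C"
  using a
proof (induction rule: gen_ideal_induct)
  case (step c x y)
  have "x * b \<in> gen_ideal C"
    using b
  proof (induction rule: gen_ideal_induct)
    case (step c' x' y')
    have "x * (c' * x' + y') = c' * (x * x') + x * y'" by (simp add: algebra_simps)
    then show ?case using step AB[OF \<open>x \<in> A\<close> step(1)] by (simp add: gen_ideal_add gen_ideal_mult)
  qed (simp add: gen_ideal_0)
  moreover have "(c * x + y) * b = c * (x * b) + y * b" by (simp add: algebra_simps)
  ultimately show ?case using step by (simp add: gen_ideal_add gen_ideal_mult)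
qed (simp add: gen_ideal_0)

lemma gen_ideal_mono: "(\<And>x. x \<in> A \<Longrightarrow> x \<in> gen_ideal B) \<Longrightarrow> a \<in> gen_ideal A \<Longrightarrow> a \<in> gen_ideal B"
  unfolding gen_ideal_def
  using module.span_minimal[OF module_ring _ module.subspace_span[OF module_ring], of A B] by blast

lemma kspan_times:
  assumes a: "a \<in> kvs.span A" and b: "b \<in> kvs.span B"
    and AB: "\<And>x y. x \<in> A \<Longrightarrow> y \<in> B \<Longrightarrow> x * y \<in> kvs.span C"
  shows "a * b \<in> kvs.span C"
  using a
proof (induction rule: kvs.span_induct_alt)
  case (step c x y)
  have "x * b \<in> kvs.span C"
    using b
  proof (induction rule: kvs.span_induct_alt)
    case (step c' x' y')
    have "x * (Const c' * x' + y') = Const c' * (x * x') + x * y'" by (simp add: algebra_simps)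
    then show ?case using step AB[OF \<open>x \<in> A\<close> step(1)] by (simp add: kvs.span_add kvs.span_scale)
  qed (simp add: kvs.span_zero)
  moreover have "(Const c * x + y) * b = Const c * (x * b) + y * b" by (simp add: algebra_simps)
  ultimately show ?case using step by (simp add: kvs.span_add kvs.span_scale)
qed (simp add: kvs.span_zero)

lemma one_in_ideal_power_0: "1 \<in> ideal_power J 0"
  unfolding ideal_power_def by (rule gen_ideal_base) auto

lemma ideal_power_Suc:
  assumes "x \<in> ideal_power J s" "y \<in> J"
  shows "x * y \<in> ideal_power J (Suc s)"
proof -
  have "y \<in> gen_ideal {y}" by (rule gen_ideal_base) simp
  with assms(1) show ?thesis
    unfolding ideal_power_def
  proof (rule gen_ideal_times)
    fix a b assume "a \<in> {\<Prod>l<s. a l |a. \<forall>l<s. a l \<in> J}" "b \<in> {y}"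
    then obtain c where c: "a = (\<Prod>l<s. c l)" "\<forall>l<s. c l \<in> J" "b = y" by auto
    have "(\<Prod>l<s. (c(s := y)) l) = (\<Prod>l<s. c l)" by (rule prod.cong) auto
    then have "a * b = (\<Prod>l<Suc s. (c(s := y)) l)" using c by simp
    moreover have "\<forall>l<Suc s. (c(s := y)) l \<in> J" using c assms(2) by auto
    ultimately show "a * b \<in> gen_ideal {\<Prod>l<Suc s. a l |a. \<forall>l<Suc s. a l \<in> J}"
      by (intro gen_ideal_base) blast
  qed
qed

lemma prod_powers_in_ideal_power:
  assumes "finite A" "\<And>x. x \<in> A \<Longrightarrow> y x \<in> J"
  shows "(\<Prod>x\<in>A. y x ^ t x) \<in> ideal_power J (\<Sum>x\<in>A. t x)"
  using assms
proof (induction A rule: finite_induct)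
  case (insert x A)
  have "(\<Prod>x\<in>A. y x ^ t x) * y x ^ k \<in> ideal_power J ((\<Sum>x\<in>A. t x) + k)" for k
  proof (induction k)
    case (Suc k)
    then show ?case using ideal_power_Suc[OF Suc, of "y x"] insert.prems by (simp add: mult_ac)
  qed (use insert in simp)
  from this[of "t x"] show ?case using insert(1,2) by (simp add: mult_ac add_ac)
qed (simp add: one_in_ideal_power_0)

subsection \<open>Homogeneous components\<close>

definition monomial_degree :: "('v::finite \<Rightarrow>\<^sub>0 nat) \<Rightarrow> nat" where
  "monomial_degree \<mu> = (\<Sum>x\<in>UNIV. Poly_Mapping.lookup \<mu> x)"

lemma homogeneous_alt: "homogeneous j g \<longleftrightarrow> (\<forall>\<mu>\<in>Poly_Mapping.keys g. monomial_degree \<mu> = j)"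
  by (simp add: homogeneous_def monomial_degree_def)

lemma monomial_degree_add: "monomial_degree (\<mu> + \<nu>) = monomial_degree \<mu> + monomial_degree \<nu>"
  by (simp add: monomial_degree_def lookup_add sum.distrib)

lemma homogeneous_0 [simp]: "homogeneous j 0"
  by (simp add: homogeneous_def)

lemma homogeneous_add: "homogeneous j a \<Longrightarrow> homogeneous j b \<Longrightarrow> homogeneous j (a + b)"
  unfolding homogeneous_alt using keys_add[of a b] by blast

lemma homogeneous_mult:
  "homogeneous i a \<Longrightarrow> homogeneous j b \<Longrightarrow> homogeneous (i + j) (a * b :: ('v::finite, 'c::comm_semiring_1) mpol)"
  unfolding homogeneous_alt using keys_mult[of a b] by (fastforce simp: monomial_degree_add)

lemma homogeneous_Const: "homogeneous 0 (Const c)"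
  by (simp add: homogeneous_alt Const_def monomial_degree_def)

lemma homogeneous_Const_mult:
  "homogeneous j a \<Longrightarrow> homogeneous j (Const c * a :: ('v::finite, 'c::comm_semiring_1) mpol)"
  using homogeneous_mult[OF homogeneous_Const, of j a c] by simp

lemma homogeneous_Var: "homogeneous 1 (Var x)"
  by (auto simp: homogeneous_alt Var_def monomial_degree_def lookup_single when_def)

lemma homogeneous_1: "homogeneous 0 (1 :: ('v::finite, 'c::comm_semiring_1) mpol)"
  using homogeneous_Const[of "1::'c"] by simp

lemma homogeneous_power:
  "homogeneous j a \<Longrightarrow> homogeneous (n * j) (a ^ n :: ('v::finite, 'c::comm_semiring_1) mpol)"
  by (induction n) (auto simp: homogeneous_1 homogeneous_mult)

lemma homogeneous_prod:
  assumes "finite A" "\<And>x. x \<in> A \<Longrightarrow> homogeneous (d x) (p x)"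
  shows "homogeneous (\<Sum>x\<in>A. d x) (\<Prod>x\<in>A. p x :: ('v::finite, 'c::comm_semiring_1) mpol)"
  using assms by (induction A rule: finite_induct) (auto simp: homogeneous_1 homogeneous_mult)

lemma subspace_homogeneous: "kvs.subspace {g. homogeneous j g}"
  by (rule kvs.subspaceI) (auto simp: homogeneous_add homogeneous_Const_mult)

definition homogeneous_component :: "nat \<Rightarrow> ('v::finite, 'c::comm_monoid_add) mpol \<Rightarrow> ('v, 'c) mpol" where
  "homogeneous_component j g =
     (\<Sum>\<mu> | \<mu> \<in> Poly_Mapping.keys g \<and> monomial_degree \<mu> = j. Poly_Mapping.single \<mu> (Poly_Mapping.lookup g \<mu>))"

lemma lookup_homogeneous_component:
  "Poly_Mapping.lookup (homogeneous_component j g) \<mu> = (if monomial_degree \<mu> = j then Poly_Mapping.lookup g \<mu> else 0)"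
  by (auto simp: homogeneous_component_def lookup_sum lookup_single when_def in_keys_iff)

lemma homogeneous_homogeneous_component: "homogeneous j (homogeneous_component j g)"
  by (auto simp: homogeneous_alt in_keys_iff lookup_homogeneous_component split: if_splits)

lemma homogeneous_component_add:
  "homogeneous_component j (a + b) = homogeneous_component j a + homogeneous_component j b"
  by (rule poly_mapping_eqI) (simp add: lookup_homogeneous_component lookup_add)

lemma homogeneous_component_0 [simp]: "homogeneous_component j 0 = 0"
  by (rule poly_mapping_eqI) (simp add: lookup_homogeneous_component)

lemma homogeneous_component_sum:
  "homogeneous_component j (\<Sum>a\<in>A. p a) = (\<Sum>a\<in>A. homogeneous_component j (p a))"
  by (induction A rule: infinite_finite_induct) (auto simp: homogeneous_component_add)

lemma homogeneous_component_of_homogeneous: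
  "homogeneous i g \<Longrightarrow> homogeneous_component j g = (if i = j then g else 0)"
  by (rule poly_mapping_eqI) (auto simp: lookup_homogeneous_component homogeneous_alt in_keys_iff)

lemma sum_homogeneous_components:
  "g = (\<Sum>j\<in>monomial_degree ` Poly_Mapping.keys g. homogeneous_component j g)"
  by (rule poly_mapping_eqI) (auto simp: lookup_sum lookup_homogeneous_component in_keys_iff)

text \<open>Multiplication by a form shifts the homogeneous components.\<close>

lemma homogeneous_component_mult:
  fixes a b :: "('v::finite, 'c::comm_semiring_1) mpol"
  assumes b: "homogeneous d b"
  shows "homogeneous_component (d + j) (a * b) = homogeneous_component j a * b"
proof -
  let ?J = "monomial_degree ` Poly_Mapping.keys a"
  have "a * b = (\<Sum>i\<in>?J. homogeneous_component i a * b)"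
    by (subst (1) sum_homogeneous_components[of a]) (simp add: sum_distrib_right)
  then have "homogeneous_component (d + j) (a * b) =
      (\<Sum>i\<in>?J. homogeneous_component (d + j) (homogeneous_component i a * b))"
    by (simp only: homogeneous_component_sum)
  also have "\<dots> = (\<Sum>i\<in>?J. if i = j then homogeneous_component i a * b else 0)"
  proof (rule sum.cong[OF refl])
    fix i
    have "homogeneous (i + d) (homogeneous_component i a * b)"
      by (rule homogeneous_mult[OF homogeneous_homogeneous_component b])
    then show "homogeneous_component (d + j) (homogeneous_component i a * b) =
        (if i = j then homogeneous_component i a * b else 0)"
      by (subst homogeneous_component_of_homogeneous) auto
  qed
  also have "\<dots> = (if j \<in> ?J then homogeneous_component j a * b else 0)"
    by (simp add: sum.delta)
  also have "\<dots> = homogeneous_component j a * b"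
  proof -
    have "homogeneous_component j a = 0" if "j \<notin> ?J"
      by (rule poly_mapping_eqI) (use that in \<open>auto simp: lookup_homogeneous_component in_keys_iff\<close>)
    then show ?thesis by auto
  qed
  finally show ?thesis .
qed

lemma single_eq_Const_monomial_value:
  "Poly_Mapping.single \<mu> c = Const c * (monomial_value Var \<mu> :: ('x, 'c::comm_semiring_1) mpol)"
proof -
  have pw: "Var x ^ n = (Poly_Mapping.single (Poly_Mapping.single x n) 1 :: ('x, 'c) mpol)" for x n
    by (induction n) (auto simp: Var_def mult_single single_add[symmetric])
  have pr: "(\<Prod>x\<in>A. Var x ^ n x) = (Poly_Mapping.single (\<Sum>x\<in>A. Poly_Mapping.single x (n x)) 1 :: ('x, 'c) mpol)"
    if "finite A" for A n
    using that by (induction A rule: finite_induct) (auto simp: pw mult_single)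
  have "\<mu> = (\<Sum>x\<in>Poly_Mapping.keys \<mu>. Poly_Mapping.single x (Poly_Mapping.lookup \<mu> x))"
    by (rule poly_mapping_sum_singles)
  then show ?thesis
    by (simp add: monomial_value_def pr Const_def mult_single)
qed

section \<open>The Rees algebra\<close>

lemma exponent_split:
  fixes \<alpha> :: "'x \<Rightarrow> nat"
  assumes "finite A" "(\<Sum>x\<in>A. \<alpha> x) = e + e'"
  obtains \<beta> where "\<And>x. \<beta> x \<le> \<alpha> x" "\<And>x. x \<notin> A \<Longrightarrow> \<beta> x = 0" "(\<Sum>x\<in>A. \<beta> x) = e"
proof -
  have "\<exists>\<beta>. (\<forall>x. \<beta> x \<le> \<alpha> x) \<and> (\<forall>x. x \<notin> A \<longrightarrow> \<beta> x = 0) \<and> (\<Sum>x\<in>A. \<beta> x) = e"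
    using assms(2)
  proof (induction e arbitrary: e')
    case 0
    show ?case by (rule exI[of _ "\<lambda>_. 0"]) auto
  next
    case (Suc e)
    then obtain \<beta> where \<beta>: "\<forall>x. \<beta> x \<le> \<alpha> x" "\<forall>x. x \<notin> A \<longrightarrow> \<beta> x = 0" "(\<Sum>x\<in>A. \<beta> x) = e"
      using Suc.IH[of "Suc e'"] by auto
    have "\<not> (\<forall>x\<in>A. \<alpha> x \<le> \<beta> x)"
      using sum_mono[of A \<alpha> \<beta>] \<beta>(3) Suc.prems by fastforce
    then obtain x where x: "x \<in> A" "\<beta> x < \<alpha> x" by (auto simp: not_le)
    have "(\<Sum>y\<in>A. (\<beta>(x := Suc (\<beta> x))) y) = Suc (\<Sum>y\<in>A. \<beta> y)"
      using assms(1) x(1) by (subst (1 2) sum.remove[of A x]) (auto intro!: sum.cong)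
    then show ?case using \<beta> x by (intro exI[of _ "\<beta>(x := Suc (\<beta> x))"]) auto
  qed
  then show ?thesis using that by blast
qed

definition generator_index :: "('p \<Rightarrow> nat) \<Rightarrow> ('v + 'p \<times> nat) set" where
  "generator_index m = range Inl \<union> Inr ` {(i, j). j \<le> m i}"

text \<open>
  The variables of the polynomial ring are the generators without a colour; a form has the index
  of its ideal as colour.
\<close>

definition generator_colour :: "'v + 'p \<times> nat \<Rightarrow> 'p option" where
  "generator_colour z = (case z of Inl v \<Rightarrow> None | Inr y \<Rightarrow> Some (fst y))"

locale rational_map =
  fixes m \<delta> :: "'p::{finite,linorder} \<Rightarrow> nat"
    and f :: "'p \<Rightarrow> nat \<Rightarrow> ('v::{finite,linorder}, 'k::field) mpol"
  assumes forms: "\<And>i j. j \<le> m i \<Longrightarrow> homogeneous (\<delta> i) (f i j)"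
    and nontrivial: "\<And>i. \<exists>j\<le>m i. f i j \<noteq> 0"
begin

abbreviation (input) Z :: "('v + 'p \<times> nat) set" where "Z \<equiv> generator_index m"

definition generator :: "'v + 'p \<times> nat \<Rightarrow> ('v, 'k) mpol" where
  "generator z = (case z of Inl v \<Rightarrow> Var v | Inr y \<Rightarrow> f (fst y) (snd y))"

definition generator_monomial :: "('v + 'p \<times> nat \<Rightarrow> nat) \<Rightarrow> ('v, 'k) mpol" where
  "generator_monomial \<alpha> = (\<Prod>z\<in>Z. generator z ^ \<alpha> z)"

text \<open>
  Exponents of the monomials \<open>x\<^sup>a f\<^sup>b\<close> with \<open>\<bar>a\<bar> =
  e\<close> and \<open>b\<close> of multidegree \<open>n\<close>.
\<close>

definition bidegree :: "nat \<Rightarrow> ('p \<Rightarrow> nat) \<Rightarrow> ('v + 'p \<times> nat \<Rightarrow> nat) set" where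
  "bidegree e n = exponents Z generator_colour (case_option e n)"

text \<open>
  By \<open>rees_part_subset_fibre_ideal\<close> and \<open>fibre_ideal_homogeneous\<close>, the
  component in bidegree \<open>(e, n)\<close> is the space of forms of degree
  \<open>n\<cdot>\<delta> + e\<close> in \<open>\<^bold>I\<^sup>n\<close>.
\<close>

definition rees_part :: "nat \<Rightarrow> ('p \<Rightarrow> nat) \<Rightarrow> ('v, 'k) mpol set" where
  "rees_part e n = kvs.span (generator_monomial ` bidegree e n)"

lemma finite_Z [simp]: "finite Z"
proof -
  have "{(i, j). j \<le> m i} = (SIGMA i:UNIV. {..m i})" by auto
  then show ?thesis by (simp add: generator_index_def)
qed

lemma finite_bidegree [simp]: "finite (bidegree e n)"
  unfolding bidegree_def by (rule finite_exponents) simp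

lemma generator_simps [simp]:
  "generator_colour (Inl v) = None" "generator_colour (Inr y) = Some (fst y)"
  "Inl v \<in> generator_index m" "Inr y \<in> generator_index m \<longleftrightarrow> snd y \<le> m (fst y)"
  by (auto simp: generator_colour_def generator_index_def)

lemma form_index_eq: "{(i, j). j \<le> m i} = (SIGMA i:UNIV. {..m i})"
  by auto

lemma bidegree_iff:
  "\<alpha> \<in> bidegree e n \<longleftrightarrow> (\<forall>z. z \<notin> Z \<longrightarrow> \<alpha> z = 0) \<and> (\<Sum>v\<in>UNIV. \<alpha> (Inl v)) = e
     \<and> (\<forall>i. (\<Sum>j\<le>m i. \<alpha> (Inr (i, j))) = n i)"
proof -
  have A: "z \<in> Z \<and> generator_colour z = None \<longleftrightarrow> z \<in> range Inl" for z :: "'v + 'p \<times> nat"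
    by (cases z) auto
  have "{z. z \<in> Z \<and> generator_colour z = None} = range Inl"
    by (rule Set.set_eqI) (simp only: A mem_Collect_eq)
  then have 1: "(\<Sum>z | z \<in> Z \<and> generator_colour z = None. \<alpha> z) = (\<Sum>v\<in>UNIV. \<alpha> (Inl v))"
    by (simp add: sum.reindex)
  have B: "z \<in> Z \<and> generator_colour z = Some i \<longleftrightarrow> z \<in> (\<lambda>j. Inr (i, j)) ` {..m i}" for i and z :: "'v + 'p \<times> nat"
    by (cases z) auto
  have "{z. z \<in> Z \<and> generator_colour z = Some i} = (\<lambda>j. Inr (i, j)) ` {..m i}" for i
    by (rule Set.set_eqI) (simp only: B mem_Collect_eq)
  then have 2: "(\<Sum>z | z \<in> Z \<and> generator_colour z = Some i. \<alpha> z) = (\<Sum>j\<le>m i. \<alpha> (Inr (i, j)))" for i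
    by (simp add: sum.reindex inj_on_def)
  have "(\<forall>q. (\<Sum>z | z \<in> Z \<and> generator_colour z = q. \<alpha> z) = case_option e n q) \<longleftrightarrow>
    (\<Sum>v\<in>UNIV. \<alpha> (Inl v)) = e \<and> (\<forall>i. (\<Sum>j\<le>m i. \<alpha> (Inr (i, j))) = n i)"
    by (simp only: split_option_all 1 2 option.case)
  then show ?thesis by (simp add: bidegree_def exponents_def)
qed

lemma bidegree_add:
  "\<alpha> \<in> bidegree e n \<Longrightarrow> \<beta> \<in> bidegree e' n' \<Longrightarrow> (\<lambda>z. \<alpha> z + \<beta> z) \<in> bidegree (e + e') (\<lambda>i. n i + n' i)"
  by (simp add: bidegree_iff sum.distrib)

lemma bidegree_0: "(\<lambda>_. 0) \<in> bidegree 0 (\<lambda>_. 0)"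
  by (simp add: bidegree_iff)

lemma generator_monomial_add:
  "generator_monomial (\<lambda>z. \<alpha> z + \<beta> z) = generator_monomial \<alpha> * generator_monomial \<beta>"
  by (simp add: generator_monomial_def power_add prod.distrib)

lemma generator_monomial_0 [simp]: "generator_monomial (\<lambda>_. 0) = 1"
  by (simp add: generator_monomial_def)

lemma generator_monomial_split:
  "generator_monomial \<alpha> =
    (\<Prod>v\<in>UNIV. Var v ^ \<alpha> (Inl v)) * (\<Prod>i\<in>UNIV. \<Prod>j\<le>m i. f i j ^ \<alpha> (Inr (i, j)))"
proof -
  have "generator_monomial \<alpha> = (\<Prod>z\<in>range Inl. generator z ^ \<alpha> z) *
      (\<Prod>z\<in>Inr ` {(i, j). j \<le> m i}. generator z ^ \<alpha> z)"
    unfolding generator_monomial_def generator_index_def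
    using finite_Z[unfolded generator_index_def] by (intro prod.union_disjoint) auto
  also have "(\<Prod>z\<in>range Inl. generator z ^ \<alpha> z) = (\<Prod>v\<in>UNIV. Var v ^ \<alpha> (Inl v))"
    by (subst prod.reindex) (auto simp: generator_def)
  also have "(\<Prod>z\<in>Inr ` {(i, j). j \<le> m i}. generator z ^ \<alpha> z) =
      (\<Prod>(i, j)\<in>(SIGMA i:UNIV. {..m i}). f i j ^ \<alpha> (Inr (i, j)))"
    unfolding form_index_eq by (subst prod.reindex) (auto simp: generator_def intro!: prod.cong)
  also have "\<dots> = (\<Prod>i\<in>UNIV. \<Prod>j\<le>m i. f i j ^ \<alpha> (Inr (i, j)))"
    by (rule prod.Sigma[symmetric]) auto
  finally show ?thesis .
qed

lemma homogeneous_generator_monomial: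
  assumes "\<alpha> \<in> bidegree e n"
  shows "homogeneous (e + (\<Sum>i\<in>UNIV. n i * \<delta> i)) (generator_monomial \<alpha>)"
proof -
  have "homogeneous ((\<Sum>v\<in>UNIV. \<alpha> (Inl v) * 1) + (\<Sum>i\<in>UNIV. \<Sum>j\<le>m i. \<alpha> (Inr (i, j)) * \<delta> i))
      (generator_monomial \<alpha>)"
    unfolding generator_monomial_split
    by (intro homogeneous_mult homogeneous_prod homogeneous_power homogeneous_Var forms) auto
  moreover have "(\<Sum>j\<le>m i. \<alpha> (Inr (i, j)) * \<delta> i) = n i * \<delta> i" for i
    using assms by (simp add: bidegree_iff flip: sum_distrib_right)
  ultimately show ?thesis using assms by (simp add: bidegree_iff)
qed

lemma subspace_rees_part: "kvs.subspace (rees_part e n)"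
  by (simp add: rees_part_def)

lemma rees_part_0 [simp]: "0 \<in> rees_part e n"
  by (simp add: rees_part_def kvs.span_zero)

lemma rees_part_add: "a \<in> rees_part e n \<Longrightarrow> b \<in> rees_part e n \<Longrightarrow> a + b \<in> rees_part e n"
  by (simp add: rees_part_def kvs.span_add)

lemma rees_part_uminus: "a \<in> rees_part e n \<Longrightarrow> - a \<in> rees_part e n"
  by (simp add: rees_part_def kvs.span_neg)

lemma rees_part_scale: "a \<in> rees_part e n \<Longrightarrow> Const c * a \<in> rees_part e n"
  by (simp add: rees_part_def kvs.span_scale)

lemma rees_part_sum: "(\<And>x. x \<in> A \<Longrightarrow> p x \<in> rees_part e n) \<Longrightarrow> (\<Sum>x\<in>A. p x) \<in> rees_part e n"
  by (simp add: rees_part_def kvs.span_sum)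

lemma rees_part_base: "\<alpha> \<in> bidegree e n \<Longrightarrow> generator_monomial \<alpha> \<in> rees_part e n"
  by (simp add: rees_part_def kvs.span_base)

lemma rees_part_mult:
  "a \<in> rees_part e n \<Longrightarrow> b \<in> rees_part e' n' \<Longrightarrow> a * b \<in> rees_part (e + e') (\<lambda>i. n i + n' i)"
  unfolding rees_part_def
proof (erule kspan_times, assumption)
  fix x y assume "x \<in> generator_monomial ` bidegree e n" "y \<in> generator_monomial ` bidegree e' n'"
  then obtain \<alpha> \<beta> where "\<alpha> \<in> bidegree e n" "x = generator_monomial \<alpha>"
    "\<beta> \<in> bidegree e' n'" "y = generator_monomial \<beta>" by blast
  then show "x * y \<in> kvs.span (generator_monomial ` bidegree (e + e') (\<lambda>i. n i + n' i))"
    by (intro kvs.span_base image_eqI[of _ _ "\<lambda>z. \<alpha> z + \<beta> z"])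
      (simp_all add: generator_monomial_add bidegree_add)
qed

lemma homogeneous_rees_part:
  assumes "a \<in> rees_part e n" shows "homogeneous (e + (\<Sum>i\<in>UNIV. n i * \<delta> i)) a"
proof -
  have "rees_part e n \<subseteq> {g. homogeneous (e + (\<Sum>i\<in>UNIV. n i * \<delta> i)) g}"
    unfolding rees_part_def
    by (rule kvs.span_minimal[OF _ subspace_homogeneous]) (auto intro: homogeneous_generator_monomial)
  then show ?thesis using assms by blast
qed

lemma rees_part_of_homogeneous: "u \<in> rees_part e (\<lambda>_. 0) \<longleftrightarrow> homogeneous e u"
proof
  assume "u \<in> rees_part e (\<lambda>_. 0)"
  from homogeneous_rees_part[OF this] show "homogeneous e u" by simp
next
  assume u: "homogeneous e u"
  have "Poly_Mapping.single \<mu> (Poly_Mapping.lookup u \<mu>) \<in> rees_part e (\<lambda>_. 0)"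
    if "\<mu> \<in> Poly_Mapping.keys u" for \<mu>
  proof -
    define \<alpha> :: "'v + 'p \<times> nat \<Rightarrow> nat" where
      "\<alpha> z = (case z of Inl v \<Rightarrow> Poly_Mapping.lookup \<mu> v | Inr _ \<Rightarrow> 0)" for z
    have "\<alpha> \<in> bidegree e (\<lambda>_. 0)"
      using u that
      by (auto simp: bidegree_iff \<alpha>_def homogeneous_def generator_index_def split: sum.splits)
    moreover have "generator_monomial \<alpha> = monomial_value Var \<mu>"
      unfolding generator_monomial_split monomial_value_superset[OF finite_UNIV subset_UNIV]
      by (simp add: \<alpha>_def)
    ultimately show ?thesis
      unfolding single_eq_Const_monomial_value by (metis rees_part_base rees_part_scale)
  qed
  then have "(\<Sum>\<mu>\<in>Poly_Mapping.keys u. Poly_Mapping.single \<mu> (Poly_Mapping.lookup u \<mu>)) \<in> rees_part e (\<lambda>_. 0)"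
    by (rule rees_part_sum)
  then show "u \<in> rees_part e (\<lambda>_. 0)" using poly_mapping_sum_singles[of u] by simp
qed

lemma rees_part_mult_homogeneous:
  "homogeneous e u \<Longrightarrow> a \<in> rees_part e' n \<Longrightarrow> u * a \<in> rees_part (e + e') n"
  using rees_part_mult[of u e "\<lambda>_. 0" a e' n] by (simp add: rees_part_of_homogeneous)

lemma bidegree_split:
  assumes "\<alpha> \<in> bidegree (e + e') n"
  obtains \<beta> \<gamma> where "\<beta> \<in> bidegree e (\<lambda>_. 0)" "\<gamma> \<in> bidegree e' n" "\<alpha> = (\<lambda>z. \<beta> z + \<gamma> z)"
proof -
  have "(\<Sum>v\<in>UNIV. \<alpha> (Inl v)) = e + e'" using assms by (simp add: bidegree_iff)
  from exponent_split[OF finite_UNIV this]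
  obtain b where b: "\<And>v. b v \<le> \<alpha> (Inl v)" "\<And>v. v \<notin> UNIV \<Longrightarrow> b v = 0" "(\<Sum>v\<in>UNIV. b v) = e"
    by metis
  define \<beta> :: "'v + 'p \<times> nat \<Rightarrow> nat" where "\<beta> z = (case z of Inl v \<Rightarrow> b v | Inr _ \<Rightarrow> 0)" for z
  have le: "\<beta> z \<le> \<alpha> z" for z using b by (auto simp: \<beta>_def split: sum.splits)
  have 1: "\<beta> \<in> bidegree e (\<lambda>_. 0)"
    using b by (auto simp: bidegree_iff \<beta>_def generator_index_def split: sum.splits)
  have "(\<Sum>v\<in>UNIV. \<alpha> (Inl v) - \<beta> (Inl v)) = e'"
    using assms b by (subst sum_subtractf_nat) (auto simp: \<beta>_def bidegree_iff)
  moreover have "\<beta> (Inr y) = 0" for y by (simp add: \<beta>_def)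
  ultimately have 2: "(\<lambda>z. \<alpha> z - \<beta> z) \<in> bidegree e' n"
    using assms by (simp add: bidegree_iff)
  show ?thesis using that[OF 1 2] le by (auto simp: fun_eq_iff)
qed

text \<open>
  Another description of \<open>\<^bold>I\<^sup>n\<close>, by the products of the given forms; see
  \<open>ideal_multipower_eq\<close>.
\<close>

definition fibre_ideal :: "('p \<Rightarrow> nat) \<Rightarrow> ('v, 'k) mpol set" where
  "fibre_ideal n = gen_ideal (generator_monomial ` bidegree 0 n)"

lemma rees_part_subset_fibre_ideal:
  assumes "a \<in> rees_part e n" shows "a \<in> fibre_ideal n"
  using assms unfolding rees_part_def
proof (induction rule: kvs.span_induct_alt)
  case (step c x y)
  then obtain \<alpha> where \<alpha>: "\<alpha> \<in> bidegree (e + 0) n" "x = generator_monomial \<alpha>" by auto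
  from bidegree_split[OF \<alpha>(1)] obtain \<beta> \<gamma> where "\<gamma> \<in> bidegree 0 n" "\<alpha> = (\<lambda>z. \<beta> z + \<gamma> z)" by blast
  then have "x \<in> fibre_ideal n"
    unfolding fibre_ideal_def \<alpha>(2) by (simp add: generator_monomial_add gen_ideal_mult gen_ideal_base)
  then show ?case using step(2) by (simp add: fibre_ideal_def gen_ideal_add gen_ideal_mult)
qed (simp add: fibre_ideal_def gen_ideal_0)

text \<open>
  The products of the given forms of multidegree \<open>n\<close> are all homogeneous of degree
  \<open>n\<cdot>\<delta>\<close>. So in an expression of \<open>a\<close> by them the
  coefficients can be replaced by their components of degree \<open>e\<close>.
\<close>

lemma fibre_ideal_homogeneous:
  assumes "a \<in> fibre_ideal n" "homogeneous (e + (\<Sum>i\<in>UNIV. n i * \<delta> i)) a"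
  shows "a \<in> rees_part e n"
proof -
  let ?d = "\<Sum>i\<in>UNIV. n i * \<delta> i"
  have "homogeneous_component (?d + e) a \<in> rees_part e n"
    using assms(1) unfolding fibre_ideal_def
  proof (induction rule: gen_ideal_induct)
    case (step c x y)
    then obtain \<alpha> where \<alpha>: "\<alpha> \<in> bidegree 0 n" "x = generator_monomial \<alpha>" by auto
    have "homogeneous ?d x" using homogeneous_generator_monomial[OF \<alpha>(1)] \<alpha>(2) by simp
    then have "homogeneous_component (?d + e) (c * x) = homogeneous_component e c * x"
      by (rule homogeneous_component_mult)
    moreover have "homogeneous_component e c * x \<in> rees_part (e + 0) n"
      using \<alpha> by (intro rees_part_mult_homogeneous homogeneous_homogeneous_component) (simp add: rees_part_base)
    ultimately show ?case using step by (simp add: homogeneous_component_add rees_part_add)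
  qed simp
  then show ?thesis using assms(2) by (simp add: homogeneous_component_of_homogeneous add.commute)
qed

lemma fibre_ideal_mult:
  assumes "a \<in> fibre_ideal n" "b \<in> fibre_ideal n'"
  shows "a * b \<in> fibre_ideal (\<lambda>i. n i + n' i)"
  using assms unfolding fibre_ideal_def
proof (rule gen_ideal_times)
  fix x y assume "x \<in> generator_monomial ` bidegree 0 n" "y \<in> generator_monomial ` bidegree 0 n'"
  then obtain \<alpha> \<beta> where "\<alpha> \<in> bidegree 0 n" "x = generator_monomial \<alpha>"
    "\<beta> \<in> bidegree 0 n'" "y = generator_monomial \<beta>" by blast
  then show "x * y \<in> gen_ideal (generator_monomial ` bidegree 0 (\<lambda>i. n i + n' i))"
    using bidegree_add[of \<alpha> 0 n \<beta> 0 n']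
    by (intro gen_ideal_base image_eqI[of _ _ "\<lambda>z. \<alpha> z + \<beta> z"])
      (simp_all add: generator_monomial_add)
qed

lemma one_in_fibre_ideal: "1 \<in> fibre_ideal (\<lambda>_. 0)"
  unfolding fibre_ideal_def
  by (rule gen_ideal_base, rule image_eqI[where x = "\<lambda>_. 0"]) (simp_all add: bidegree_0)

lemma form_in_fibre_ideal:
  assumes "j \<le> m i" shows "f i j \<in> fibre_ideal (\<lambda>i'. if i' = i then 1 else 0)"
proof -
  define \<alpha> :: "'v + 'p \<times> nat \<Rightarrow> nat" where "\<alpha> z = (if z = Inr (i, j) then 1 else 0)" for z
  have "(\<Sum>j'\<le>m i'. \<alpha> (Inr (i', j'))) = (if i' = i then 1 else 0)" for i'
    using assms by (auto simp: \<alpha>_def)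
  then have "\<alpha> \<in> bidegree 0 (\<lambda>i'. if i' = i then 1 else 0)"
    using assms by (auto simp: bidegree_iff \<alpha>_def generator_index_def)
  moreover have "generator_monomial \<alpha> = f i j"
  proof -
    have "Inr (i, j) \<in> Z" using assms by (auto simp: generator_index_def)
    then have "generator_monomial \<alpha> = generator (Inr (i, j)) ^ \<alpha> (Inr (i, j)) * (\<Prod>z\<in>Z - {Inr (i, j)}. generator z ^ \<alpha> z)"
      unfolding generator_monomial_def by (intro prod.remove) auto
    moreover have "(\<Prod>z\<in>Z - {Inr (i, j)}. generator z ^ \<alpha> z) = 1"
      by (rule prod.neutral) (auto simp: \<alpha>_def)
    moreover have "\<alpha> (Inr (i, j)) = 1" by (simp add: \<alpha>_def)
    ultimately show ?thesis by (simp add: generator_def)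
  qed
  ultimately show ?thesis unfolding fibre_ideal_def by (intro gen_ideal_base) (metis image_eqI)
qed

lemma ideal_multipower_eq: "ideal_multipower (form_ideal m f) n = fibre_ideal n"
proof (rule antisym; rule subsetI)
  fix a assume a: "a \<in> ideal_multipower (form_ideal m f) n"
  have form: "y \<in> fibre_ideal (\<lambda>i'. if i' = i then 1 else 0)" if "y \<in> form_ideal m f i" for y i
    using that unfolding form_ideal_def
    by (subst fibre_ideal_def, elim gen_ideal_mono[rotated]) (use form_in_fibre_ideal in \<open>auto simp: fibre_ideal_def\<close>)
  have pow: "y \<in> fibre_ideal (\<lambda>i'. if i' = i then s else 0)" if "y \<in> ideal_power (form_ideal m f i) s" for y i s
  proof -
    have "(\<Prod>l<t. c l) \<in> fibre_ideal (\<lambda>i'. if i' = i then t else 0)" if "\<forall>l<t. c l \<in> form_ideal m f i" for c t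
      using that
    proof (induction t)
      case 0
      then show ?case using one_in_fibre_ideal by simp
    next
      case (Suc t)
      then have "(\<Prod>l<t. c l) * c t \<in> fibre_ideal (\<lambda>i'. (if i' = i then t else 0) + (if i' = i then 1 else 0))"
        by (intro fibre_ideal_mult form) auto
      moreover have "(\<lambda>i'. (if i' = i then t else 0) + (if i' = i then 1 else 0)) = (\<lambda>i'. if i' = i then Suc t else 0)"
        by auto
      ultimately show ?case by simp
    qed
    then show ?thesis
      using that unfolding ideal_power_def
      by (subst fibre_ideal_def, elim gen_ideal_mono[rotated]) (auto simp: fibre_ideal_def)
  qed
  have "(\<Prod>i\<in>A. c i) \<in> fibre_ideal (\<lambda>i. if i \<in> A then n i else 0)"
    if "\<forall>i. c i \<in> ideal_power (form_ideal m f i) (n i)" for c and A :: "'p set"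
    using finite[of A]
  proof (induction A rule: finite_induct)
    case empty
    then show ?case using one_in_fibre_ideal by simp
  next
    case (insert i A)
    have "c i * (\<Prod>i\<in>A. c i) \<in> fibre_ideal (\<lambda>i'. (if i' = i then n i else 0) + (if i' \<in> A then n i' else 0))"
      using that insert.IH by (intro fibre_ideal_mult pow) auto
    moreover have "(\<lambda>i'. (if i' = i then n i else 0) + (if i' \<in> A then n i' else 0)) = (\<lambda>i'. if i' \<in> insert i A then n i' else 0)"
      using insert(2) by auto
    ultimately show ?case using insert(1,2) by simp
  qed
  from this[of _ UNIV] have "(\<Prod>i\<in>UNIV. c i) \<in> fibre_ideal n"
    if "\<forall>i. c i \<in> ideal_power (form_ideal m f i) (n i)" for c
    using that by simp
  then show "a \<in> fibre_ideal n"
    using a unfolding ideal_multipower_def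
    by (subst fibre_ideal_def, elim gen_ideal_mono[rotated]) (auto simp: fibre_ideal_def)
next
  fix a assume "a \<in> fibre_ideal n"
  then show "a \<in> ideal_multipower (form_ideal m f) n"
    unfolding fibre_ideal_def ideal_multipower_def
  proof (elim gen_ideal_mono[rotated])
    fix x assume "x \<in> generator_monomial ` bidegree 0 n"
    then obtain \<alpha> where \<alpha>: "\<alpha> \<in> bidegree 0 n" "x = generator_monomial \<alpha>" by auto
    have "\<alpha> (Inl v) = 0" for v using \<alpha>(1) by (simp add: bidegree_iff)
    then have x: "x = (\<Prod>i\<in>UNIV. \<Prod>j\<le>m i. f i j ^ \<alpha> (Inr (i, j)))"
      by (simp add: \<alpha>(2) generator_monomial_split)
    have "(\<Prod>j\<le>m i. f i j ^ \<alpha> (Inr (i, j))) \<in> ideal_power (form_ideal m f i) (\<Sum>j\<le>m i. \<alpha> (Inr (i, j)))" for i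
      by (rule prod_powers_in_ideal_power) (auto simp: form_ideal_def intro!: gen_ideal_base)
    then have "\<forall>i. (\<Prod>j\<le>m i. f i j ^ \<alpha> (Inr (i, j))) \<in> ideal_power (form_ideal m f i) (n i)"
      using \<alpha>(1) by (simp add: bidegree_iff)
    then show "x \<in> gen_ideal {\<Prod>i\<in>UNIV. a i |a. \<forall>i. a i \<in> ideal_power (form_ideal m f i) (n i)}"
      unfolding x by (intro gen_ideal_base) blast
  qed
qed

lemma special_fiber_eq: "special_fiber m \<delta> f n = rees_part 0 n"
proof (rule Set.set_eqI, rule iffI)
  fix g assume "g \<in> special_fiber m \<delta> f n"
  then have "g \<in> fibre_ideal n" "homogeneous (0 + (\<Sum>i\<in>UNIV. n i * \<delta> i)) g"
    by (simp_all add: special_fiber_def graded_part_def ideal_multipower_eq)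
  then show "g \<in> rees_part 0 n" by (rule fibre_ideal_homogeneous)
next
  fix g assume g: "g \<in> rees_part 0 n"
  from homogeneous_rees_part[OF g] rees_part_subset_fibre_ideal[OF g]
  show "g \<in> special_fiber m \<delta> f n"
    by (simp add: special_fiber_def graded_part_def ideal_multipower_eq)
qed

lemma homogeneous_in_irrelevant_power:
  fixes u :: "('v, 'k) mpol"
  assumes "homogeneous s u" shows "u \<in> ideal_power irrelevant_ideal s"
proof -
  have single: "Poly_Mapping.single \<mu> c \<in> ideal_power irrelevant_ideal (monomial_degree \<mu>)" for \<mu> :: "'v \<Rightarrow>\<^sub>0 nat" and c :: 'k
  proof -
    have "monomial_value Var \<mu> = (\<Prod>v\<in>UNIV. Var v ^ Poly_Mapping.lookup \<mu> v :: ('v, 'k) mpol)"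
      by (rule monomial_value_superset) auto
    also have "\<dots> \<in> ideal_power irrelevant_ideal (monomial_degree \<mu>)"
      unfolding monomial_degree_def
      by (rule prod_powers_in_ideal_power) (auto simp: irrelevant_ideal_def intro!: gen_ideal_base)
    finally show ?thesis
      unfolding single_eq_Const_monomial_value ideal_power_def by (rule gen_ideal_mult)
  qed
  have "(\<Sum>\<mu>\<in>Poly_Mapping.keys u. Poly_Mapping.single \<mu> (Poly_Mapping.lookup u \<mu>)) \<in> ideal_power irrelevant_ideal s"
    unfolding ideal_power_def
  proof (rule gen_ideal_sum)
    fix \<mu> assume "\<mu> \<in> Poly_Mapping.keys u"
    then have "monomial_degree \<mu> = s" using assms by (simp add: homogeneous_alt)
    with single[of \<mu> "Poly_Mapping.lookup u \<mu>"]
    show "Poly_Mapping.single \<mu> (Poly_Mapping.lookup u \<mu>) \<in> gen_ideal {\<Prod>l<s. a l |a. \<forall>l<s. a l \<in> irrelevant_ideal}"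
      by (simp only: ideal_power_def)
  qed
  then show ?thesis using poly_mapping_sum_singles[of u] by simp
qed

lemma irrelevant_power_generated:
  assumes "h \<in> ideal_power (irrelevant_ideal :: ('v, 'k) mpol set) s"
  shows "h \<in> gen_ideal {u. homogeneous s u}"
proof -
  have irr: "y \<in> gen_ideal {u. homogeneous 1 u}" if "y \<in> (irrelevant_ideal :: ('v, 'k) mpol set)" for y
    using that unfolding irrelevant_ideal_def
    by (elim gen_ideal_mono[rotated]) (auto intro!: gen_ideal_base homogeneous_Var[simplified])
  have "(\<Prod>l<t. c l) \<in> gen_ideal {u :: ('v, 'k) mpol. homogeneous t u}" if "\<forall>l<t. c l \<in> irrelevant_ideal" for c t
    using that
  proof (induction t)
    case 0
    then show ?case by (auto intro!: gen_ideal_base homogeneous_1)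
  next
    case (Suc t)
    have "(\<Prod>l<t. c l) * c t \<in> gen_ideal {u. homogeneous (Suc t) u}"
    proof (rule gen_ideal_times)
      show "(\<Prod>l<t. c l) \<in> gen_ideal {u. homogeneous t u}" "c t \<in> gen_ideal {u. homogeneous 1 u}"
        using Suc irr by auto
      show "x * y \<in> gen_ideal {u. homogeneous (Suc t) u}"
        if "x \<in> {u. homogeneous t u}" "y \<in> {u. homogeneous 1 u}" for x y :: "('v, 'k) mpol"
        using that homogeneous_mult[of t x 1 y] by (auto intro!: gen_ideal_base)
    qed
    then show ?case by simp
  qed
  then show ?thesis
    using assms unfolding ideal_power_def by (elim gen_ideal_mono[rotated]) auto
qed

text \<open>
  The powers of the irrelevant ideal are generated by forms of one degree, and multiplying by such
  forms keeps track of the degree, so membership in \<open>\<^bold>I\<^sup>n\<close> becomes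
  membership in a component of the Rees algebra.
\<close>

lemma saturated_special_fiber_iff:
  "g \<in> saturated_special_fiber m \<delta> f n \<longleftrightarrow> homogeneous (\<Sum>i\<in>UNIV. n i * \<delta> i) g \<and>
     (\<exists>s. \<forall>u. homogeneous s u \<longrightarrow> u * g \<in> rees_part s n)"
proof -
  have "(\<forall>h\<in>ideal_power irrelevant_ideal s. g * h \<in> fibre_ideal n) \<longleftrightarrow>
      (\<forall>u. homogeneous s u \<longrightarrow> u * g \<in> rees_part s n)"
    if g: "homogeneous (\<Sum>i\<in>UNIV. n i * \<delta> i) g" for s
  proof safe
    fix u :: "('v, 'k) mpol" assume *: "\<forall>h\<in>ideal_power irrelevant_ideal s. g * h \<in> fibre_ideal n" and u: "homogeneous s u"
    have "g * u \<in> fibre_ideal n" using * homogeneous_in_irrelevant_power[OF u] by blast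
    then have "u * g \<in> fibre_ideal n" by (simp only: mult.commute)
    then show "u * g \<in> rees_part s n"
      by (rule fibre_ideal_homogeneous) (rule homogeneous_mult[OF u g])
  next
    fix h assume *: "\<forall>u. homogeneous s u \<longrightarrow> u * g \<in> rees_part s n" and "h \<in> ideal_power (irrelevant_ideal :: ('v, 'k) mpol set) s"
    then have "h \<in> gen_ideal {u. homogeneous s u}" by (intro irrelevant_power_generated)
    moreover have "g \<in> gen_ideal {g}" by (rule gen_ideal_base) simp
    ultimately have "h * g \<in> fibre_ideal n"
      unfolding fibre_ideal_def
    proof (rule gen_ideal_times)
      fix x y :: "('v, 'k) mpol" assume "x \<in> {u. homogeneous s u}" "y \<in> {g}"
      then have "x * y \<in> rees_part s n" using * by simp
      then show "x * y \<in> gen_ideal (generator_monomial ` bidegree 0 n)"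
        using rees_part_subset_fibre_ideal by (simp only: fibre_ideal_def)
    qed
    then show "g * h \<in> fibre_ideal n" by (simp only: mult.commute)
  qed
  then show ?thesis
    unfolding saturated_special_fiber_def graded_part_def saturation_def ideal_multipower_eq by blast
qed

lemma multiform_add: "multiform m n A \<Longrightarrow> multiform m n B \<Longrightarrow> multiform m n (A + B)"
  unfolding multiform_def by (rule ballI, drule subsetD[OF keys_add]) (elim UnE bspec; assumption)

lemma multiform_Const_mult:
  assumes "multiform m n A" shows "multiform m n (Const c * A :: ('p \<times> nat, 'k) mpol)"
proof -
  have "Poly_Mapping.keys (Const c * A) \<subseteq> Poly_Mapping.keys A"
    by (auto simp: in_keys_iff lookup_Const_mult)
  then show ?thesis using assms unfolding multiform_def by blast
qed

lemma pullback_add: "pullback f (A + B) = pullback f A + pullback f B"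
  by (simp add: pullback_def const_eval.eval_add)

text \<open>
  The special fiber ring is the coordinate ring of \<open>Y\<close>; this identifies the function
  field of \<open>Y\<close> with its field of homogeneous fractions of degree zero.
\<close>

lemma pullback_multiforms: "{pullback f A | A. multiform m n A} = rees_part 0 n"
proof (rule antisym; rule subsetI)
  fix a assume "a \<in> {pullback f A | A. multiform m n A}"
  then obtain A where A: "multiform m n A" "a = pullback f A" by blast
  have "Const (Poly_Mapping.lookup A \<mu>) * monomial_value (\<lambda>(i, j). f i j) \<mu> \<in> rees_part 0 n"
    if "\<mu> \<in> Poly_Mapping.keys A" for \<mu>
  proof -
    define \<alpha> :: "'v + 'p \<times> nat \<Rightarrow> nat" where
      "\<alpha> z = (case z of Inl v \<Rightarrow> 0 | Inr y \<Rightarrow> Poly_Mapping.lookup \<mu> y)" for z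
    have \<mu>: "\<forall>(i, j)\<in>Poly_Mapping.keys \<mu>. j \<le> m i" "\<forall>i. (\<Sum>j\<le>m i. Poly_Mapping.lookup \<mu> (i, j)) = n i"
      using A that unfolding multiform_def by blast+
    then have "\<alpha> \<in> bidegree 0 n"
      by (auto simp: bidegree_iff \<alpha>_def generator_index_def in_keys_iff split: sum.splits)
    moreover have "generator_monomial \<alpha> = monomial_value (\<lambda>(i, j). f i j) \<mu>"
    proof -
      have S: "{(i, j). j \<le> m i} = (SIGMA i:UNIV. {..m i})" by auto
      have "monomial_value (\<lambda>(i, j). f i j) \<mu> = (\<Prod>y\<in>(SIGMA i:UNIV. {..m i}). (\<lambda>(i, j). f i j) y ^ Poly_Mapping.lookup \<mu> y)"
        by (rule monomial_value_superset) (use \<mu>(1) in auto)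
      also have "\<dots> = (\<Prod>i\<in>UNIV. \<Prod>j\<le>m i. f i j ^ Poly_Mapping.lookup \<mu> (i, j))"
        by (subst prod.Sigma) (auto simp: case_prod_beta intro!: prod.cong)
      finally show ?thesis by (simp add: generator_monomial_split \<alpha>_def)
    qed
    ultimately show ?thesis by (metis rees_part_base rees_part_scale)
  qed
  then show "a \<in> rees_part 0 n"
    unfolding A(2) pullback_def mpol_eval_alt by (rule rees_part_sum)
next
  fix a assume a: "a \<in> rees_part 0 n"
  have "kvs.subspace {pullback f A | A. multiform m n A}"
  proof (rule kvs.subspaceI)
    show "0 \<in> {pullback f A | A. multiform m n A}"
      by (auto intro!: exI[of _ 0] simp: pullback_def multiform_def)
    show "x + y \<in> {pullback f A | A. multiform m n A}"
      if "x \<in> {pullback f A | A. multiform m n A}" "y \<in> {pullback f A | A. multiform m n A}" for x y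
      using that by (auto simp: pullback_add[symmetric] intro: multiform_add)
    show "Const c * x \<in> {pullback f A | A. multiform m n A}" if "x \<in> {pullback f A | A. multiform m n A}" for c x
    proof -
      from that obtain A where A: "multiform m n A" "x = pullback f A" by blast
      have "Const c * x = pullback f (Const c * A)"
        by (simp add: A(2) pullback_def const_eval.eval_mult)
      then show ?thesis using multiform_Const_mult[OF A(1)] by blast
    qed
  qed
  moreover have "generator_monomial ` bidegree 0 n \<subseteq> {pullback f A | A. multiform m n A}"
  proof (rule image_subsetI)
    fix \<alpha> assume \<alpha>: "\<alpha> \<in> bidegree 0 n"
    define \<mu> where "\<mu> = Abs_poly_mapping (\<lambda>y. \<alpha> (Inr y))"
    have "finite {y. \<alpha> (Inr y) \<noteq> 0}"
    proof (rule finite_subset)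
      show "{y. \<alpha> (Inr y) \<noteq> 0} \<subseteq> (SIGMA i:UNIV. {..m i})"
        using \<alpha> by (force simp: bidegree_iff generator_index_def)
    qed auto
    then have \<mu>: "Poly_Mapping.lookup \<mu> y = \<alpha> (Inr y)" for y
      by (simp add: \<mu>_def Abs_poly_mapping_inverse)
    have keys: "Poly_Mapping.keys \<mu> \<subseteq> (SIGMA i:UNIV. {..m i})"
      using \<alpha> by (force simp: bidegree_iff generator_index_def in_keys_iff \<mu>)
    have "monomial_value (\<lambda>(i, j). f i j) \<mu> = (\<Prod>y\<in>(SIGMA i:UNIV. {..m i}). (\<lambda>(i, j). f i j) y ^ Poly_Mapping.lookup \<mu> y)"
      by (rule monomial_value_superset) (use keys in auto)
    also have "\<dots> = (\<Prod>i\<in>UNIV. \<Prod>j\<le>m i. f i j ^ Poly_Mapping.lookup \<mu> (i, j))"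
      by (subst prod.Sigma) (auto simp: case_prod_beta intro!: prod.cong)
    finally have "generator_monomial \<alpha> = pullback f (Poly_Mapping.single \<mu> 1)"
      using \<alpha> by (simp add: pullback_def const_eval.eval_single generator_monomial_split \<mu> bidegree_iff)
    moreover have "multiform m n (Poly_Mapping.single \<mu> (1::'k))"
      using \<alpha> keys by (auto simp: multiform_def \<mu> bidegree_iff)
    ultimately show "generator_monomial \<alpha> \<in> {pullback f A | A. multiform m n A}" by blast
  qed
  ultimately show "a \<in> {pullback f A | A. multiform m n A}"
    using a kvs.span_minimal unfolding rees_part_def by blast
qed

lemma exists_nonzero_in_fiber: "\<exists>b. b \<in> rees_part 0 n \<and> b \<noteq> 0"
proof -
  obtain j where j: "\<And>i. j i \<le> m i" "\<And>i. f i (j i) \<noteq> 0" using nontrivial by metis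
  define \<alpha> :: "'v + 'p \<times> nat \<Rightarrow> nat" where
    "\<alpha> z = (case z of Inl v \<Rightarrow> 0 | Inr y \<Rightarrow> if snd y = j (fst y) then n (fst y) else 0)" for z
  have "(\<Sum>k\<le>m i. \<alpha> (Inr (i, k))) = n i" for i
    using j by (simp add: \<alpha>_def)
  then have "\<alpha> \<in> bidegree 0 n"
    using j by (auto simp: bidegree_iff \<alpha>_def generator_index_def split: sum.splits)
  moreover have "generator_monomial \<alpha> \<noteq> 0"
    using j by (auto simp: generator_monomial_split \<alpha>_def)
  ultimately show ?thesis using rees_part_base by blast
qed

section \<open>Noetherianity of the Rees algebra\<close>

definition generator_list :: "('v + 'p \<times> nat) list" where
  "generator_list = (SOME zs. set zs = Z)"

lemma set_generator_list: "set generator_list = Z"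
  unfolding generator_list_def by (rule someI_ex) (rule finite_list, simp)

text \<open>The lexicographic order on lists serves as monomial order.\<close>

definition exponent_key :: "('v + 'p \<times> nat \<Rightarrow> nat) \<Rightarrow> nat list" where
  "exponent_key \<alpha> = map \<alpha> generator_list"

lemma map_less_add:
  fixes \<alpha> \<beta> \<gamma> :: "'z \<Rightarrow> nat"
  shows "map \<alpha> zs < map \<beta> zs \<Longrightarrow> map (\<lambda>z. \<gamma> z + \<alpha> z) zs < map (\<lambda>z. \<gamma> z + \<beta> z) zs"
proof (induction zs)
  case (Cons z zs)
  then show ?case by (simp only: list.map Cons_less_Cons) (elim disjE conjE; simp)
qed simp

lemma exponent_key_add: "exponent_key \<alpha> < exponent_key \<beta> \<Longrightarrow>
    exponent_key (\<lambda>z. \<gamma> z + \<alpha> z) < exponent_key (\<lambda>z. \<gamma> z + \<beta> z)"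
  unfolding exponent_key_def by (rule map_less_add)

lemma inj_on_exponent_key: "inj_on exponent_key (bidegree e n)"
proof (rule inj_onI)
  fix \<alpha> \<beta> assume "\<alpha> \<in> bidegree e n" "\<beta> \<in> bidegree e n" "exponent_key \<alpha> = exponent_key \<beta>"
  then show "\<alpha> = \<beta>"
    using set_generator_list by (intro ext) (metis bidegree_iff exponent_key_def map_eq_conv)
qed

definition leading_exponents :: "('v, 'k) mpol set \<Rightarrow> nat \<Rightarrow> ('p \<Rightarrow> nat) \<Rightarrow> ('v + 'p \<times> nat \<Rightarrow> nat) set" where
  "leading_exponents M e n = kvs.pivots exponent_key generator_monomial (bidegree e n) M"

lemma leading_exponents_iff:
  "\<alpha> \<in> leading_exponents M e n \<longleftrightarrow> \<alpha> \<in> bidegree e n \<and> (\<exists>g\<in>M. g - generator_monomial \<alpha> \<in>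
     kvs.span (generator_monomial ` {\<beta> \<in> bidegree e n. exponent_key \<beta> < exponent_key \<alpha>}))"
  by (simp add: leading_exponents_def kvs.pivots_def)

lemma leading_exponents_shift:
  assumes \<alpha>: "\<alpha> \<in> leading_exponents M e n" and \<beta>: "\<beta> \<in> bidegree e' n'"
    and M: "\<And>g. g \<in> M \<Longrightarrow> generator_monomial \<beta> * g \<in> M'"
  shows "(\<lambda>z. \<beta> z + \<alpha> z) \<in> leading_exponents M' (e' + e) (\<lambda>i. n' i + n i)"
proof -
  obtain g where g: "\<alpha> \<in> bidegree e n" "g \<in> M" "g - generator_monomial \<alpha> \<in>
     kvs.span (generator_monomial ` {\<beta> \<in> bidegree e n. exponent_key \<beta> < exponent_key \<alpha>})"
    using \<alpha> by (auto simp: leading_exponents_iff)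
  have "generator_monomial \<beta> \<in> kvs.span {generator_monomial \<beta>}" by (rule kvs.span_base) simp
  then have "generator_monomial \<beta> * (g - generator_monomial \<alpha>) \<in>
     kvs.span (generator_monomial ` {\<gamma> \<in> bidegree (e' + e) (\<lambda>i. n' i + n i). exponent_key \<gamma> < exponent_key (\<lambda>z. \<beta> z + \<alpha> z)})"
    using g(3)
  proof (rule kspan_times)
    fix x y assume "x \<in> {generator_monomial \<beta>}"
      "y \<in> generator_monomial ` {\<beta> \<in> bidegree e n. exponent_key \<beta> < exponent_key \<alpha>}"
    then obtain \<gamma> where \<gamma>: "\<gamma> \<in> bidegree e n" "exponent_key \<gamma> < exponent_key \<alpha>"
      "x = generator_monomial \<beta>" "y = generator_monomial \<gamma>" by auto
    have "x * y = generator_monomial (\<lambda>z. \<beta> z + \<gamma> z)" by (simp add: \<gamma>(3,4) generator_monomial_add)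
    moreover have "(\<lambda>z. \<beta> z + \<gamma> z) \<in> {\<gamma> \<in> bidegree (e' + e) (\<lambda>i. n' i + n i). exponent_key \<gamma> < exponent_key (\<lambda>z. \<beta> z + \<alpha> z)}"
      using bidegree_add[OF \<beta> \<gamma>(1)] exponent_key_add[OF \<gamma>(2)] by simp
    ultimately show "x * y \<in> kvs.span (generator_monomial `
        {\<gamma> \<in> bidegree (e' + e) (\<lambda>i. n' i + n i). exponent_key \<gamma> < exponent_key (\<lambda>z. \<beta> z + \<alpha> z)})"
      by (intro kvs.span_base image_eqI[of _ _ "\<lambda>z. \<beta> z + \<gamma> z"])
  qed
  then have "generator_monomial \<beta> * g - generator_monomial (\<lambda>z. \<beta> z + \<alpha> z) \<in>
     kvs.span (generator_monomial ` {\<gamma> \<in> bidegree (e' + e) (\<lambda>i. n' i + n i). exponent_key \<gamma> < exponent_key (\<lambda>z. \<beta> z + \<alpha> z)})"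
    by (simp only: right_diff_distrib generator_monomial_add)
  then show ?thesis
    unfolding leading_exponents_iff using M[OF g(2)] bidegree_add[OF \<beta> g(1)] by (intro conjI bexI)
qed

text \<open>
  The component in bidegree \<open>(e, n)\<close> of the ideal of the Rees algebra generated by
  the bihomogeneous elements \<open>G\<close>, which carry their bidegrees.
\<close>

definition generated :: "(nat \<times> ('p \<Rightarrow> nat) \<times> ('v, 'k) mpol) set \<Rightarrow> nat \<Rightarrow> ('p \<Rightarrow> nat) \<Rightarrow> ('v, 'k) mpol set" where
  "generated G e n = kvs.span {generator_monomial \<beta> * g | \<beta> g e' n' e0 n0.
     (e0, n0, g) \<in> G \<and> \<beta> \<in> bidegree e' n' \<and> e = e' + e0 \<and> n = (\<lambda>i. n' i + n0 i)}"

lemma subspace_generated: "kvs.subspace (generated G e n)"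
  by (simp add: generated_def)

lemma generatedI:
  "(e0, n0, g) \<in> G \<Longrightarrow> \<beta> \<in> bidegree e' n' \<Longrightarrow> generator_monomial \<beta> * g \<in> generated G (e' + e0) (\<lambda>i. n' i + n0 i)"
  unfolding generated_def by (rule kvs.span_base) blast

lemma generated_base: "(e, n, g) \<in> G \<Longrightarrow> g \<in> generated G e n"
  using generatedI[OF _ bidegree_0, of e n g G] by simp

lemma generated_least:
  assumes h: "h \<in> generated G e n" and S: "kvs.subspace S"
    and G: "\<And>\<beta> g e' n' e0 n0. (e0, n0, g) \<in> G \<Longrightarrow> \<beta> \<in> bidegree e' n' \<Longrightarrow> e = e' + e0 \<Longrightarrow> n = (\<lambda>i. n' i + n0 i)
       \<Longrightarrow> generator_monomial \<beta> * g \<in> S"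
  shows "h \<in> S"
proof -
  have "generated G e n \<subseteq> S"
    unfolding generated_def by (rule kvs.span_minimal[OF _ S]) (use G in auto)
  then show ?thesis using h by blast
qed

lemma subspace_preimage_mult:
  assumes "kvs.subspace S" shows "kvs.subspace {h. p * h \<in> S}"
proof (rule kvs.subspaceI)
  show "0 \<in> {h. p * h \<in> S}" using kvs.subspace_0[OF assms] by simp
  show "x + y \<in> {h. p * h \<in> S}" if "x \<in> {h. p * h \<in> S}" "y \<in> {h. p * h \<in> S}" for x y
    using that kvs.subspace_add[OF assms] by (simp add: distrib_left)
  show "Const c * x \<in> {h. p * h \<in> S}" if "x \<in> {h. p * h \<in> S}" for c x
    using that kvs.subspace_scale[OF assms, of "p * x" c] by (simp add: mult.left_commute)
qed

lemma subspace_image_mult: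
  assumes "kvs.subspace S" shows "kvs.subspace ((*) p ` S)"
proof (rule kvs.subspaceI)
  show "0 \<in> (*) p ` S" using kvs.subspace_0[OF assms] by (intro image_eqI[of _ _ 0]) auto
  show "x + y \<in> (*) p ` S" if xy: "x \<in> (*) p ` S" "y \<in> (*) p ` S" for x y
  proof -
    from xy obtain a b where "a \<in> S" "b \<in> S" "x = p * a" "y = p * b" by blast
    then show ?thesis using kvs.subspace_add[OF assms] by (intro image_eqI[of _ _ "a + b"]) (auto simp: distrib_left)
  qed
  show "Const c * x \<in> (*) p ` S" if x: "x \<in> (*) p ` S" for c x
  proof -
    from x obtain a where "a \<in> S" "x = p * a" by blast
    then show ?thesis using kvs.subspace_scale[OF assms] by (intro image_eqI[of _ _ "Const c * a"]) (auto simp: mult.left_commute)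
  qed
qed

lemma generated_shift:
  assumes h: "h \<in> generated G e n" and \<beta>: "\<beta> \<in> bidegree e' n'"
  shows "generator_monomial \<beta> * h \<in> generated G (e' + e) (\<lambda>i. n' i + n i)"
proof -
  have "h \<in> {h. generator_monomial \<beta> * h \<in> generated G (e' + e) (\<lambda>i. n' i + n i)}"
    using h subspace_preimage_mult[OF subspace_generated]
  proof (rule generated_least)
    fix \<gamma> g e1 n1 e0 n0
    assume *: "(e0, n0, g) \<in> G" "\<gamma> \<in> bidegree e1 n1" "e = e1 + e0" "n = (\<lambda>i. n1 i + n0 i)"
    have "generator_monomial (\<lambda>z. \<beta> z + \<gamma> z) * g \<in> generated G (e' + e1 + e0) (\<lambda>i. n' i + n1 i + n0 i)"
      by (rule generatedI[OF *(1) bidegree_add[OF \<beta> *(2)]])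
    then show "generator_monomial \<gamma> * g \<in> {h. generator_monomial \<beta> * h \<in> generated G (e' + e) (\<lambda>i. n' i + n i)}"
      by (simp add: *(3,4) generator_monomial_add add.assoc mult.assoc)
  qed
  then show ?thesis by simp
qed

lemma generated_mono:
  assumes "G \<subseteq> G'" "h \<in> generated G e n" shows "h \<in> generated G' e n"
  using assms(2) subspace_generated
proof (rule generated_least)
  fix \<gamma> g e1 n1 e0 n0
  assume *: "(e0, n0, g) \<in> G" "\<gamma> \<in> bidegree e1 n1" "e = e1 + e0" "n = (\<lambda>i. n1 i + n0 i)"
  have "(e0, n0, g) \<in> G'" using *(1) assms(1) by blast
  from generatedI[OF this *(2)] show "generator_monomial \<gamma> * g \<in> generated G' e n" by (simp add: *(3,4))
qed

lemma generated_subset: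
  assumes G: "\<And>e n g. (e, n, g) \<in> G \<Longrightarrow> g \<in> rees_part e n" and h: "h \<in> generated G e n"
  shows "h \<in> rees_part e n"
  using h subspace_rees_part
proof (rule generated_least)
  fix \<gamma> g e1 n1 e0 n0
  assume *: "(e0, n0, g) \<in> G" "\<gamma> \<in> bidegree e1 n1" "e = e1 + e0" "n = (\<lambda>i. n1 i + n0 i)"
  from rees_part_mult[OF rees_part_base[OF *(2)] G[OF *(1)]]
  show "generator_monomial \<gamma> * g \<in> rees_part e n" by (simp add: *(3,4))
qed

lemma generated_finite:
  assumes "h \<in> generated G e n"
  shows "\<exists>G0. finite G0 \<and> G0 \<subseteq> G \<and> h \<in> generated G0 e n"
  using assms unfolding generated_def[of G]
proof (induction rule: kvs.span_induct_alt)
  case base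
  then show ?case using kvs.subspace_0[OF subspace_generated[of "{}"]] by blast
next
  case (step c x y)
  obtain G0 where G0: "finite G0" "G0 \<subseteq> G" "y \<in> generated G0 e n" using step.IH by (elim exE conjE)
  obtain \<beta> g e' n' e0 n0 where x: "(e0, n0, g) \<in> G" "\<beta> \<in> bidegree e' n'" "e = e' + e0" "n = (\<lambda>i. n' i + n0 i)"
    "x = generator_monomial \<beta> * g" using step.hyps by (elim CollectE exE conjE)
  let ?G = "insert (e0, n0, g) G0"
  have "x \<in> generated ?G e n"
    unfolding x(3,4,5) by (rule generatedI[OF _ x(2)]) simp
  moreover have "y \<in> generated ?G e n" by (rule generated_mono[OF _ G0(3)]) blast
  ultimately have "Const c * x + y \<in> generated ?G e n"
    by (intro kvs.subspace_add[OF subspace_generated] kvs.subspace_scale[OF subspace_generated])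
  moreover have "finite ?G" "?G \<subseteq> G" using G0 x(1) by auto
  ultimately show ?case by blast
qed

lemma bidegree_diff:
  assumes "b \<le> u" "b \<in> bidegree e0 n0" "u \<in> bidegree e n"
  shows "(\<lambda>z. u z - b z) \<in> bidegree (e - e0) (\<lambda>i. n i - n0 i)" "e = e - e0 + e0" "n = (\<lambda>i. n i - n0 i + n0 i)"
proof -
  have le: "b z \<le> u z" for z using assms(1) by (rule le_funD)
  have b: "(\<Sum>v\<in>UNIV. b (Inl v)) = e0" "\<And>i. (\<Sum>j\<le>m i. b (Inr (i, j))) = n0 i"
    and u: "\<And>z. z \<notin> Z \<Longrightarrow> u z = 0" "(\<Sum>v\<in>UNIV. u (Inl v)) = e" "\<And>i. (\<Sum>j\<le>m i. u (Inr (i, j))) = n i"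
    using assms(2,3) by (simp_all add: bidegree_iff)
  show "(\<lambda>z. u z - b z) \<in> bidegree (e - e0) (\<lambda>i. n i - n0 i)"
    unfolding bidegree_iff using u le b by (simp add: sum_subtractf_nat)
  have "e0 \<le> e" unfolding b(1)[symmetric] u(2)[symmetric] by (rule sum_mono) (rule le)
  then show "e = e - e0 + e0" by simp
  have "n0 i \<le> n i" for i unfolding b(2)[symmetric] u(3)[symmetric] by (rule sum_mono) (rule le)
  then show "n = (\<lambda>i. n i - n0 i + n0 i)" by simp
qed

text \<open>
  Hilbert's basis theorem for the Rees algebra. By Dickson's lemma finitely many leading exponents
  generate all those of the ideal; each belongs to an element that uses finitely many members of
  \<open>G\<close>. These members generate a subideal with the same leading exponents, hence the
  whole ideal.
\<close>

theorem finitely_generated: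
  assumes G: "\<And>e n g. (e, n, g) \<in> G \<Longrightarrow> g \<in> rees_part e n"
  shows "\<exists>G0. finite G0 \<and> G0 \<subseteq> G \<and> (\<forall>e n g. (e, n, g) \<in> G \<longrightarrow> g \<in> generated G0 e n)"
proof -
  define U where "U = (\<Union>e. \<Union>n. leading_exponents (generated G e n) e n)"
  have supp: "u z = 0" if "u \<in> U" "z \<notin> Z" for u z
    using that by (auto simp: U_def leading_exponents_iff bidegree_iff)
  have "\<exists>B. finite B \<and> B \<subseteq> U \<and> (\<forall>u\<in>U. \<exists>b\<in>B. b \<le> u)"
    by (rule dickson[OF finite_Z]) (rule supp)
  then obtain B where "finite B \<and> B \<subseteq> U \<and> (\<forall>u\<in>U. \<exists>b\<in>B. b \<le> u)" by (rule exE)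
  then have B: "finite B" "B \<subseteq> U" "\<forall>u\<in>U. \<exists>b\<in>B. b \<le> u" by simp_all
  have "\<exists>e n G0. finite G0 \<and> G0 \<subseteq> G \<and> b \<in> leading_exponents (generated G0 e n) e n" if "b \<in> B" for b
  proof -
    obtain e n where b: "b \<in> leading_exponents (generated G e n) e n"
      using \<open>b \<in> B\<close> B(2) unfolding U_def by blast
    obtain g where g: "b \<in> bidegree e n" "g \<in> generated G e n" "g - generator_monomial b \<in>
       kvs.span (generator_monomial ` {\<beta> \<in> bidegree e n. exponent_key \<beta> < exponent_key b})"
      using b unfolding leading_exponents_iff by (elim conjE bexE)
    obtain G0 where G0: "finite G0" "G0 \<subseteq> G" "g \<in> generated G0 e n"
      using generated_finite[OF g(2)] by (elim exE conjE)
    have "b \<in> leading_exponents (generated G0 e n) e n"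
      unfolding leading_exponents_iff by (intro conjI bexI) (rule g G0)+
    then show ?thesis using G0 by (intro exI conjI)
  qed
  then obtain eb nb Gb where Gb: "\<And>b. b \<in> B \<Longrightarrow> finite (Gb b)" "\<And>b. b \<in> B \<Longrightarrow> Gb b \<subseteq> G"
    "\<And>b. b \<in> B \<Longrightarrow> b \<in> leading_exponents (generated (Gb b) (eb b) (nb b)) (eb b) (nb b)"
    by metis
  define G0 where "G0 = (\<Union>b\<in>B. Gb b)"
  have 1: "finite G0" "G0 \<subseteq> G" using Gb B(1) by (auto simp: G0_def)
  have "g \<in> generated G0 e n" if "(e, n, g) \<in> G" for e n g
  proof -
    have "generated G e n = generated G0 e n"
    proof (rule kvs.subspace_eq_if_pivots_le[OF finite_bidegree inj_on_exponent_key subspace_generated _ subspace_generated])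
      show "generated G e n \<subseteq> kvs.span (generator_monomial ` bidegree e n)"
        using generated_subset[OF G] unfolding rees_part_def by blast
      show "generated G0 e n \<subseteq> generated G e n" using generated_mono[OF 1(2)] by blast
      show "kvs.pivots exponent_key generator_monomial (bidegree e n) (generated G e n) \<subseteq>
        kvs.pivots exponent_key generator_monomial (bidegree e n) (generated G0 e n)"
        unfolding leading_exponents_def[symmetric]
      proof
        fix u assume u: "u \<in> leading_exponents (generated G e n) e n"
        then have "u \<in> U" unfolding U_def by blast
        then obtain b where b: "b \<in> B" "b \<le> u" using B(3) by blast
        have sub: "Gb b \<subseteq> G0" using b(1) unfolding G0_def by blast
        have bb: "b \<in> bidegree (eb b) (nb b)" using Gb(3)[OF b(1)] by (simp add: leading_exponents_iff)
        have uu: "u \<in> bidegree e n" using u by (simp add: leading_exponents_iff)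
        note d = bidegree_diff[OF b(2) bb uu]
        have "(\<lambda>z. (u z - b z) + b z) \<in> leading_exponents (generated G0 (e - eb b + eb b) (\<lambda>i. n i - nb b i + nb b i))
            (e - eb b + eb b) (\<lambda>i. n i - nb b i + nb b i)"
        proof (rule leading_exponents_shift[OF Gb(3)[OF b(1)] d(1)])
          fix g assume "g \<in> generated (Gb b) (eb b) (nb b)"
          then have "g \<in> generated G0 (eb b) (nb b)" by (rule generated_mono[OF sub])
          from generated_shift[OF this d(1)]
          show "generator_monomial (\<lambda>z. u z - b z) * g \<in> generated G0 (e - eb b + eb b) (\<lambda>i. n i - nb b i + nb b i)" .
        qed
        moreover have "(\<lambda>z. (u z - b z) + b z) = u"
          using le_funD[OF b(2)] by (intro ext) simp
        ultimately show "u \<in> leading_exponents (generated G0 e n) e n"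
          unfolding d(2)[symmetric] d(3)[symmetric] by simp
      qed
    qed
    then show ?thesis using generated_base[OF that] by simp
  qed
  with 1 show ?thesis by (intro exI conjI allI impI)
qed

section \<open>A uniform bound for the saturation\<close>

abbreviation (input) saturated_fiber :: "('p \<Rightarrow> nat) \<Rightarrow> ('v, 'k) mpol set" where
  "saturated_fiber n \<equiv> saturated_special_fiber m \<delta> f n"

lemma Var_nonzero: "(Var v :: ('v, 'k) mpol) \<noteq> 0"
proof
  assume "(Var v :: ('v, 'k) mpol) = 0"
  then have "Poly_Mapping.lookup (Var v :: ('v, 'k) mpol) (Poly_Mapping.single v 1) = 0" by simp
  then show False by (simp add: Var_def)
qed

lemma homogeneous_Var_power: "homogeneous t (Var v ^ t :: ('v, 'k) mpol)"
  using homogeneous_power[OF homogeneous_Var, of t v] by (simp only: mult_1_right)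

text \<open>
  The bound \<open>E\<close> does not depend on \<open>n\<close>. Let \<open>G\<close> be the set
  of homogeneous elements \<open>g\<close> of the Rees algebra that some power of the irrelevant
  ideal multiplies into \<open>(x)\<close>. Since the ideal generated by \<open>G\<close> is
  finitely generated, the elements of \<open>G\<close> of bidegree \<open>(e, n)\<close> with
  \<open>e > E\<close> are \<open>x\<close> times elements of the Rees algebra: a monomial of
  large degree in the variables contains a factor of the degree that a generator needs. If
  \<open>x\<^bsup>t+1\<^esup> g\<close> is in the Rees algebra for a saturated \<open>g\<close>,
  it is in \<open>G\<close>, and so \<open>x\<^sup>t g\<close> is in the Rees algebra as long as
  \<open>t \<ge> E\<close>.
\<close>

theorem uniform_saturation:
  fixes v :: 'v
  shows "\<exists>E. \<forall>n g. g \<in> saturated_fiber n \<longrightarrow> Var v ^ E * g \<in> rees_part E n"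
proof -
  define x :: "('v, 'k) mpol" where "x = Var v"
  define G where "G = {(e1, n, g) | e1 n g. 1 \<le> e1 \<and> g \<in> rees_part e1 n \<and>
     (\<exists>s. \<forall>u. homogeneous s u \<longrightarrow> u * g \<in> (*) x ` rees_part (e1 - 1 + s) n)}"
  have G: "g \<in> rees_part e n" if "(e, n, g) \<in> G" for e n g
    using that unfolding G_def by blast
  have "\<exists>G0. finite G0 \<and> G0 \<subseteq> G \<and> (\<forall>e n g. (e, n, g) \<in> G \<longrightarrow> g \<in> generated G0 e n)"
    by (rule finitely_generated) (rule G)
  then obtain G0 where "finite G0 \<and> G0 \<subseteq> G \<and> (\<forall>e n g. (e, n, g) \<in> G \<longrightarrow> g \<in> generated G0 e n)" by (rule exE)
  then have G0: "finite G0" "G0 \<subseteq> G" "\<And>e n g. (e, n, g) \<in> G \<Longrightarrow> g \<in> generated G0 e n" by simp_all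
  have "\<forall>t\<in>G0. \<exists>s. \<forall>u. homogeneous s u \<longrightarrow> u * snd (snd t) \<in> (*) x ` rees_part (fst t - 1 + s) (fst (snd t))"
    using G0(2) unfolding G_def by fastforce
  then obtain s where s: "\<And>t u. t \<in> G0 \<Longrightarrow> homogeneous (s t) u \<Longrightarrow>
      u * snd (snd t) \<in> (*) x ` rees_part (fst t - 1 + s t) (fst (snd t))"
    by metis
  define E where "E = (\<Sum>t\<in>G0. fst t + s t)"
  have bound: "fst t + s t \<le> E" if "t \<in> G0" for t
    unfolding E_def by (rule member_le_sum) (use that G0(1) in auto)
  \<comment> \<open>only generators of degree at most \<open>E\<close> minus their own \<open>s\<close> occur, so the cofactor \<open>\<beta>\<close> has degree at least \<open>s\<close> in the variables\<close>
  have divisible: "g \<in> (*) x ` rees_part e n" if "(Suc e, n, g) \<in> G" "E \<le> e" for e n g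
    using G0(3)[OF that(1)] subspace_image_mult[OF subspace_rees_part]
  proof (rule generated_least)
    fix \<beta> g0 e' n' e0 n0
    assume *: "(e0, n0, g0) \<in> G0" "\<beta> \<in> bidegree e' n'" "Suc e = e' + e0" "n = (\<lambda>i. n' i + n0 i)"
    let ?s = "s (e0, n0, g0)"
    have e0: "1 \<le> e0" using *(1) G0(2) unfolding G_def by blast
    have "e0 + ?s \<le> E" using bound[OF *(1)] by simp
    then have e': "e' = ?s + (e' - ?s)" using *(3) that(2) by simp
    from *(2) e' have "\<beta> \<in> bidegree (?s + (e' - ?s)) n'" by simp
    then obtain \<beta>1 \<beta>2 where \<beta>: "\<beta>1 \<in> bidegree ?s (\<lambda>_. 0)" "\<beta>2 \<in> bidegree (e' - ?s) n'" "\<beta> = (\<lambda>z. \<beta>1 z + \<beta>2 z)"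
      by (rule bidegree_split)
    have "homogeneous ?s (generator_monomial \<beta>1)"
      using homogeneous_generator_monomial[OF \<beta>(1)] by simp
    from s[OF *(1) this] obtain h where h: "h \<in> rees_part (e0 - 1 + ?s) n0" "generator_monomial \<beta>1 * g0 = x * h"
      by auto
    have eq: "generator_monomial \<beta> * g0 = x * (generator_monomial \<beta>2 * h)"
      using h(2) by (simp add: \<beta>(3) generator_monomial_add mult_ac)
    have mem: "generator_monomial \<beta>2 * h \<in> rees_part (e' - ?s + (e0 - 1 + ?s)) (\<lambda>i. n' i + n0 i)"
      by (rule rees_part_mult[OF rees_part_base[OF \<beta>(2)] h(1)])
    have "e' - ?s + (e0 - 1 + ?s) = e" using e' e0 *(3) by linarith
    with mem have "generator_monomial \<beta>2 * h \<in> rees_part e n" by (simp only: *(4))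
    then show "generator_monomial \<beta> * g0 \<in> (*) x ` rees_part e n" unfolding eq by (rule imageI)
  qed
  have x0: "x \<noteq> 0" unfolding x_def by (rule Var_nonzero)
  have xh: "homogeneous t (x ^ t)" for t unfolding x_def by (rule homogeneous_Var_power)
  have "x ^ E * g \<in> rees_part E n" if g: "g \<in> saturated_fiber n" for n g
  proof -
    obtain s where s: "\<And>u. homogeneous s u \<Longrightarrow> u * g \<in> rees_part s n"
      using g unfolding saturated_special_fiber_iff by blast
    \<comment> \<open>\<open>x\<^bsup>t+1\<^esup> g\<close> belongs to \<open>G\<close>: a form \<open>u\<close> of degree \<open>s\<close> sends it to \<open>x \<cdot> x\<^sup>t (u g)\<close>\<close>
    have down: "x ^ t * g \<in> rees_part t n" if t: "E \<le> t" "x ^ Suc t * g \<in> rees_part (Suc t) n" for t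
    proof -
      have "u * (x ^ Suc t * g) \<in> (*) x ` rees_part (Suc t - 1 + s) n" if u: "homogeneous s u" for u
      proof (rule image_eqI)
        show "u * (x ^ Suc t * g) = x * (x ^ t * (u * g))" by (simp add: mult_ac)
        show "x ^ t * (u * g) \<in> rees_part (Suc t - 1 + s) n"
          using rees_part_mult_homogeneous[OF xh s[OF u]] by simp
      qed
      then have "(Suc t, n, x ^ Suc t * g) \<in> G" unfolding G_def using t(2) by auto
      from divisible[OF this t(1)] obtain h where "h \<in> rees_part t n" "x ^ Suc t * g = x * h" by auto
      then show ?thesis using x0 by (simp add: mult.assoc)
    qed
    have "x ^ (s + E) * g \<in> rees_part (s + E) n"
      using rees_part_mult_homogeneous[OF xh s[OF xh], of E] by (simp add: power_add mult_ac add.commute)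
    then have "x ^ (E + s) * g \<in> rees_part (E + s) n" by (simp only: add.commute)
    moreover have "x ^ (E + k) * g \<in> rees_part (E + k) n \<Longrightarrow> x ^ E * g \<in> rees_part E n" for k
    proof (induction k)
      case (Suc k)
      show ?case
      proof (rule Suc.IH, rule down)
        show "x ^ Suc (E + k) * g \<in> rees_part (Suc (E + k)) n"
          using Suc.prems by (simp only: add_Suc_right)
      qed simp
    qed simp
    ultimately show ?thesis by blast
  qed
  then show ?thesis unfolding x_def by (intro exI[of _ E] allI impI)
qed

section \<open>Hilbert functions\<close>

lemma case_sum_bidegree_iff:
  "case_sum \<xi> \<beta> \<in> bidegree e n \<longleftrightarrow> (\<Sum>v\<in>UNIV. \<xi> v) = e \<and> \<beta> \<in> exponents {(i, j). j \<le> m i} fst n"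
proof -
  have "{y. y \<in> {(i, j). j \<le> m i} \<and> fst y = i} = (\<lambda>j. (i, j)) ` {..m i}" for i by auto
  then have "(\<Sum>y | y \<in> {(i, j). j \<le> m i} \<and> fst y = i. \<beta> y) = (\<Sum>j\<le>m i. \<beta> (i, j))" for i
    by (simp add: sum.reindex inj_on_def)
  moreover have "(\<forall>z. z \<notin> Z \<longrightarrow> case_sum \<xi> \<beta> z = 0) \<longleftrightarrow> (\<forall>y. y \<notin> {(i, j). j \<le> m i} \<longrightarrow> \<beta> y = 0)"
  proof (intro iffI allI impI)
    fix y assume *: "\<forall>z. z \<notin> Z \<longrightarrow> case_sum \<xi> \<beta> z = 0" and y: "y \<notin> {(i, j). j \<le> m i}"
    have "Inr y \<notin> Z" using y by (auto simp: generator_index_def)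
    with * have "case_sum \<xi> \<beta> (Inr y) = 0" by blast
    then show "\<beta> y = 0" by simp
  next
    fix z assume *: "\<forall>y. y \<notin> {(i, j). j \<le> m i} \<longrightarrow> \<beta> y = 0" and z: "z \<notin> Z"
    then show "case_sum \<xi> \<beta> z = 0" by (cases z) (auto simp: generator_index_def)
  qed
  ultimately show ?thesis by (auto simp: bidegree_iff exponents_def)
qed

lemma finite_form_index: "finite {(i, j). j \<le> m i}"
proof -
  have "{(i, j). j \<le> m i} = (SIGMA i:UNIV. {..m i})" by auto
  then show ?thesis by simp
qed

text \<open>
  For each of the finitely many exponents of degree \<open>e\<close> in the variables, the
  possible exponents in the forms are an upset.
\<close>

lemma eventually_polynomial_card_leading_exponents:
  assumes M: "\<And>n n' \<beta> g. g \<in> M n \<Longrightarrow> \<beta> \<in> bidegree 0 n' \<Longrightarrow> generator_monomial \<beta> * g \<in> M (\<lambda>i. n' i + n i)"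
  shows "eventually_polynomial (\<lambda>n. of_nat (card (leading_exponents (M n) e n)))"
proof -
  let ?Y = "{(i, j). j \<le> m i} :: ('p \<times> nat) set"
  define VE where "VE = {\<xi> :: 'v \<Rightarrow> nat. (\<Sum>v\<in>UNIV. \<xi> v) = e}"
  define U where "U \<xi> = {\<beta>. \<exists>n. case_sum \<xi> \<beta> \<in> leading_exponents (M n) e n}" for \<xi>
  have "VE = exponents UNIV (\<lambda>_. ()) (\<lambda>_. e)" by (auto simp: VE_def exponents_def)
  then have VE: "finite VE" using finite_exponents[of "UNIV :: 'v set"] by simp
  have bid: "\<xi> \<in> VE \<and> \<beta> \<in> exponents ?Y fst n" if "case_sum \<xi> \<beta> \<in> leading_exponents (M n) e n" for \<xi> \<beta> n
    using that unfolding leading_exponents_iff case_sum_bidegree_iff VE_def by simp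
  have uniq: "n = n'" if "\<beta> \<in> exponents ?Y fst n" "\<beta> \<in> exponents ?Y fst n'" for \<beta> and n n' :: "'p \<Rightarrow> nat"
  proof
    fix i show "n i = n' i" using that unfolding exponents_def by (elim CollectE conjE) metis
  qed
  have "leading_exponents (M n) e n = (\<Union>\<xi>\<in>VE. case_sum \<xi> ` (exponents ?Y fst n \<inter> U \<xi>))" for n
  proof (rule Set.set_eqI, rule iffI)
    fix \<alpha> assume \<alpha>: "\<alpha> \<in> leading_exponents (M n) e n"
    define \<xi> \<beta> where "\<xi> = (\<lambda>v. \<alpha> (Inl v))" and "\<beta> = (\<lambda>y. \<alpha> (Inr y))"
    have eq: "\<alpha> = case_sum \<xi> \<beta>" by (rule ext) (simp add: \<xi>_def \<beta>_def split: sum.splits)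
    have "\<xi> \<in> VE" "\<beta> \<in> exponents ?Y fst n" "\<beta> \<in> U \<xi>"
      using bid[of \<xi> \<beta> n] \<alpha> unfolding U_def eq by auto
    then show "\<alpha> \<in> (\<Union>\<xi>\<in>VE. case_sum \<xi> ` (exponents ?Y fst n \<inter> U \<xi>))" unfolding eq by blast
  next
    fix \<alpha> assume "\<alpha> \<in> (\<Union>\<xi>\<in>VE. case_sum \<xi> ` (exponents ?Y fst n \<inter> U \<xi>))"
    then obtain \<xi> \<beta> n' where *: "\<beta> \<in> exponents ?Y fst n" "case_sum \<xi> \<beta> \<in> leading_exponents (M n') e n'" "\<alpha> = case_sum \<xi> \<beta>"
      unfolding U_def by blast
    have "n' = n" using uniq bid[OF *(2)] *(1) by blast
    then show "\<alpha> \<in> leading_exponents (M n) e n" using * by simp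
  qed
  moreover have "card (\<Union>\<xi>\<in>VE. case_sum \<xi> ` (exponents ?Y fst n \<inter> U \<xi>)) = (\<Sum>\<xi>\<in>VE. card (exponents ?Y fst n \<inter> U \<xi>))" for n
  proof -
    have "card (\<Union>\<xi>\<in>VE. case_sum \<xi> ` (exponents ?Y fst n \<inter> U \<xi>)) = (\<Sum>\<xi>\<in>VE. card (case_sum \<xi> ` (exponents ?Y fst n \<inter> U \<xi>)))"
    proof (rule card_UN_disjoint[OF VE])
      show "\<forall>\<xi>\<in>VE. finite (case_sum \<xi> ` (exponents ?Y fst n \<inter> U \<xi>))"
        using finite_exponents[OF finite_form_index, of fst n] by simp
      show "\<forall>\<xi>\<in>VE. \<forall>\<xi>'\<in>VE. \<xi> \<noteq> \<xi>' \<longrightarrow> case_sum \<xi> ` (exponents ?Y fst n \<inter> U \<xi>) \<inter> case_sum \<xi>' ` (exponents ?Y fst n \<inter> U \<xi>') = {}"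
      proof (intro ballI impI equals0I)
        fix \<xi> \<xi>' \<alpha> assume "\<xi> \<noteq> \<xi>'" "\<alpha> \<in> case_sum \<xi> ` (exponents ?Y fst n \<inter> U \<xi>) \<inter> case_sum \<xi>' ` (exponents ?Y fst n \<inter> U \<xi>')"
        then obtain \<beta> \<beta>' where "\<alpha> = case_sum \<xi> \<beta>" "\<alpha> = case_sum \<xi>' \<beta>'" by (elim IntE imageE)
        then have "case_sum \<xi> \<beta> (Inl v) = case_sum \<xi>' \<beta>' (Inl v)" for v by simp
        then show False using \<open>\<xi> \<noteq> \<xi>'\<close> by (simp add: fun_eq_iff)
      qed
    qed
    also have "\<dots> = (\<Sum>\<xi>\<in>VE. card (exponents ?Y fst n \<inter> U \<xi>))"
    proof (rule sum.cong[OF refl], rule card_image, rule inj_onI)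
      fix \<xi> and \<beta> \<beta>' :: "'p \<times> nat \<Rightarrow> nat" assume eq: "case_sum \<xi> \<beta> = case_sum \<xi> \<beta>'"
      show "\<beta> = \<beta>'" by (rule ext) (metis eq sum.case(2))
    qed
    finally show ?thesis .
  qed
  ultimately have count: "card (leading_exponents (M n) e n) = (\<Sum>\<xi>\<in>VE. card (exponents ?Y fst n \<inter> U \<xi>))" for n
    by simp
  have "eventually_polynomial (\<lambda>n. of_nat (card (exponents ?Y fst n \<inter> U \<xi>)))" for \<xi>
  proof (rule eventually_polynomial_card_upset[OF finite_form_index])
    fix \<beta> y assume "\<beta> \<in> U \<xi>" and y: "y \<notin> ?Y"
    then obtain n where "case_sum \<xi> \<beta> \<in> leading_exponents (M n) e n" unfolding U_def by blast
    from bid[OF this] have "\<forall>y. y \<notin> ?Y \<longrightarrow> \<beta> y = 0" unfolding exponents_def by (elim conjE CollectE)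
    with y show "\<beta> y = 0" by (elim allE impE)
  next
    fix \<beta> \<gamma> :: "'p \<times> nat \<Rightarrow> nat" assume "\<beta> \<in> U \<xi>" and \<gamma>: "\<forall>y. y \<notin> ?Y \<longrightarrow> \<gamma> y = 0"
    then obtain n where n: "case_sum \<xi> \<beta> \<in> leading_exponents (M n) e n" unfolding U_def by blast
    define n' where "n' i = (\<Sum>y | y \<in> ?Y \<and> fst y = i. \<gamma> y)" for i
    have \<gamma>': "case_sum (\<lambda>_. 0) \<gamma> \<in> bidegree 0 n'"
      unfolding case_sum_bidegree_iff using \<gamma> by (simp add: exponents_def n'_def)
    have "(\<lambda>z. case_sum (\<lambda>_. 0) \<gamma> z + case_sum \<xi> \<beta> z) \<in> leading_exponents (M (\<lambda>i. n' i + n i)) (0 + e) (\<lambda>i. n' i + n i)"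
      by (rule leading_exponents_shift[OF n \<gamma>']) (rule M[OF _ \<gamma>'])
    moreover have "(\<lambda>z. case_sum (\<lambda>_. 0) \<gamma> z + case_sum \<xi> \<beta> z) = case_sum \<xi> (\<lambda>y. \<beta> y + \<gamma> y)"
      by (rule ext) (simp split: sum.splits)
    ultimately show "(\<lambda>y. \<beta> y + \<gamma> y) \<in> U \<xi>" unfolding U_def by auto
  qed
  then have "eventually_polynomial (\<lambda>n. \<Sum>\<xi>\<in>VE. of_nat (card (exponents ?Y fst n \<inter> U \<xi>)))"
    by (rule eventually_polynomial_sum)
  then show ?thesis by (simp only: count of_nat_sum)
qed

text \<open>
  The dimension is the number of leading exponents of \<open>M n\<close> minus that of the zero
  space.
\<close>

theorem hilbert_function_eventually_polynomial:
  assumes sub: "\<And>n. kvs.subspace (M n)" "\<And>n. M n \<subseteq> rees_part e n"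
    and M: "\<And>n n' \<beta> g. g \<in> M n \<Longrightarrow> \<beta> \<in> bidegree 0 n' \<Longrightarrow> generator_monomial \<beta> * g \<in> M (\<lambda>i. n' i + n i)"
  shows "eventually_polynomial (\<lambda>n. of_nat (kdim (M n)))"
proof -
  have "kdim (M n) + card (leading_exponents {0} e n) = card (leading_exponents (M n) e n)" for n
    unfolding kdim_alt leading_exponents_def
    by (rule kvs.dim_eq_card_pivots[OF finite_bidegree inj_on_exponent_key sub(1)])
      (use sub(2) in \<open>simp add: rees_part_def\<close>)
  then have "(of_nat (kdim (M n)) :: rat) = of_nat (card (leading_exponents (M n) e n)) - of_nat (card (leading_exponents {0} e n))" for n
    unfolding eq_diff_eq of_nat_add[symmetric] by (rule arg_cong)
  then have eq: "(\<lambda>n. of_nat (kdim (M n)) :: rat) = (\<lambda>n. of_nat (card (leading_exponents (M n) e n)) - of_nat (card (leading_exponents {0} e n)))"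
    by (rule ext)
  have 1: "eventually_polynomial (\<lambda>n. of_nat (card (leading_exponents (M n) e n)))"
    by (rule eventually_polynomial_card_leading_exponents[where M = M]) (rule M)
  have 2: "eventually_polynomial (\<lambda>n. of_nat (card (leading_exponents {0} e n)))"
    by (rule eventually_polynomial_card_leading_exponents[where M = "\<lambda>_. {0}"]) simp
  show ?thesis unfolding eq by (rule eventually_polynomial_diff[OF 1 2])
qed

end

section \<open>Bases of the field extension\<close>

lemma ring_of_type_algebra_simps [simp]:
  "carrier ring_of_type_algebra = UNIV" "x \<otimes>\<^bsub>ring_of_type_algebra\<^esub> y = x * y"
  "x \<oplus>\<^bsub>ring_of_type_algebra\<^esub> y = x + y"
  "\<one>\<^bsub>ring_of_type_algebra\<^esub> = 1" "\<zero>\<^bsub>ring_of_type_algebra\<^esub> = 0"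
  by (simp_all add: ring_of_type_algebra_def)

text \<open>
  Coordinates with respect to a basis, as sums over an initial segment of the natural numbers.
\<close>

lemma basis_of_finite_dimension:
  fixes K E :: "'a::field set"
  assumes K: "1 \<in> K" "\<And>x. x \<in> K \<Longrightarrow> - x \<in> K" "\<And>x y. x \<in> K \<Longrightarrow> y \<in> K \<Longrightarrow> x * y \<in> K"
      "\<And>x y. x \<in> K \<Longrightarrow> y \<in> K \<Longrightarrow> x + y \<in> K" "\<And>x. x \<in> K \<Longrightarrow> inverse x \<in> K"
    and fin: "ring.finite_dimension ring_of_type_algebra K E"
    and D: "D = ring.dim ring_of_type_algebra K E"
  shows "\<exists>b. E = {\<Sum>i<D. \<kappa> i * b i | \<kappa>. \<forall>i<D. \<kappa> i \<in> K} \<and>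
    (\<forall>\<kappa>. (\<forall>i<D. \<kappa> i \<in> K) \<longrightarrow> (\<Sum>i<D. \<kappa> i * b i) = 0 \<longrightarrow> (\<forall>i<D. \<kappa> i = 0))"
proof -
  let ?R = "ring_of_type_algebra :: 'a ring"
  interpret R: Ring.field ?R by (rule field_from_type_algebra)
  have neg: "\<ominus>\<^bsub>?R\<^esub> x = - x" for x
    by (rule R.minus_equality) simp_all
  have inv: "inv\<^bsub>?R\<^esub> x = inverse x" if "x \<noteq> 0" for x
    by (rule R.inv_unique'[symmetric]) (use that in simp_all)
  have "subring K ?R"
    by (rule R.subringI) (simp_all add: K neg)
  then have sub: "subfield K ?R"
    by (rule R.subfieldI') (simp add: inv K)
  have "R.dimension D K E"
    using R.finite_dimensionE[OF sub fin] by (simp add: over_def D)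
  then have "\<exists>Vs. set Vs \<subseteq> carrier ?R \<and> R.independent K Vs \<and> length Vs = D \<and> R.Span K Vs = E"
    by (rule R.exists_base[OF sub])
  then obtain Vs where Vs: "R.independent K Vs" "length Vs = D" "R.Span K Vs = E" by (elim exE conjE)
  have combine: "R.combine Ks Us = (\<Sum>i<length Us. Ks ! i * Us ! i)" if "length Ks = length Us" for Ks Us
    using that
  proof (induction Ks Us rule: list_induct2)
    case (Cons k Ks u Us)
    have "R.combine (k # Ks) (u # Us) = k * u + R.combine Ks Us" by simp
    also have "\<dots> = (\<Sum>i<length (u # Us). (k # Ks) ! i * (u # Us) ! i)"
      by (simp only: Cons.IH length_Cons sum.lessThan_Suc_shift nth_Cons_0 nth_Cons_Suc)
    finally show ?case .
  qed simp
  have E: "E = {R.combine Ks Vs | Ks. length Ks = length Vs \<and> set Ks \<subseteq> K}"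
    unfolding Vs(3)[symmetric] by (rule R.Span_eq_combine_set_length_version[OF sub]) simp
  show ?thesis
  proof (intro exI conjI allI impI)
    show "E = {\<Sum>i<D. \<kappa> i * Vs ! i | \<kappa>. \<forall>i<D. \<kappa> i \<in> K}"
    proof (rule Set.set_eqI, rule iffI)
      fix z assume "z \<in> E"
      then obtain Ks where Ks: "z = R.combine Ks Vs" "length Ks = length Vs" "set Ks \<subseteq> K"
        unfolding E by blast
      have "\<forall>i<D. Ks ! i \<in> K" using Ks Vs(2) by auto
      moreover have "z = (\<Sum>i<D. Ks ! i * Vs ! i)" using Ks combine[OF Ks(2)] Vs(2) by simp
      ultimately show "z \<in> {\<Sum>i<D. \<kappa> i * Vs ! i | \<kappa>. \<forall>i<D. \<kappa> i \<in> K}" by blast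
    next
      fix z assume "z \<in> {\<Sum>i<D. \<kappa> i * Vs ! i | \<kappa>. \<forall>i<D. \<kappa> i \<in> K}"
      then obtain \<kappa> where \<kappa>: "z = (\<Sum>i<D. \<kappa> i * Vs ! i)" "\<forall>i<D. \<kappa> i \<in> K" by blast
      have "z = R.combine (map \<kappa> [0..<D]) Vs"
        using combine[of "map \<kappa> [0..<D]" Vs] Vs(2) \<kappa>(1) by simp
      moreover have "length (map \<kappa> [0..<D]) = length Vs" "set (map \<kappa> [0..<D]) \<subseteq> K"
        using Vs(2) \<kappa>(2) by auto
      ultimately show "z \<in> E" unfolding E by blast
    qed
  next
    fix \<kappa> i assume \<kappa>: "\<forall>i<D. \<kappa> i \<in> K" "(\<Sum>i<D. \<kappa> i * Vs ! i) = 0" and i: "i < D"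
    have "R.combine (map \<kappa> [0..<D]) Vs = \<zero>\<^bsub>?R\<^esub>"
      using combine[of "map \<kappa> [0..<D]" Vs] Vs(2) \<kappa>(2) by simp
    moreover have "set (map \<kappa> [0..<D]) \<subseteq> K" using \<kappa>(1) by auto
    ultimately have "set (take (length Vs) (map \<kappa> [0..<D])) \<subseteq> {\<zero>\<^bsub>?R\<^esub>}"
      using R.independent_imp_trivial_combine[OF sub Vs(1)] by blast
    moreover have "\<kappa> i \<in> set (take (length Vs) (map \<kappa> [0..<D]))" using i Vs(2) by auto
    ultimately have "\<kappa> i \<in> {\<zero>\<^bsub>?R\<^esub>}" by (rule subsetD)
    then show "\<kappa> i = 0" by simp
  qed
qed

text \<open>
  Stated for an arbitrary multiplicative grading \<open>P\<close>, since it is used both for forms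
  and for elements of the fiber ring.
\<close>

lemma common_denominator:
  fixes P :: "'g \<Rightarrow> 'a::idom set"
  assumes mult: "\<And>g h a b. a \<in> P g \<Longrightarrow> b \<in> P h \<Longrightarrow> a * b \<in> P (op_add g h)" and one: "1 \<in> P g0"
    and fin: "finite A"
    and \<kappa>: "\<And>x. x \<in> A \<Longrightarrow> \<exists>a b g. a \<in> P g \<and> b \<in> P g \<and> b \<noteq> 0 \<and> \<kappa> x = Fract a b"
  shows "\<exists>g b. b \<in> P g \<and> b \<noteq> 0 \<and> (\<forall>x\<in>A. \<exists>a\<in>P g. \<kappa> x = Fract a b)"
  using fin \<kappa>
proof (induction A rule: finite_induct)
  case empty
  show ?case using one by (intro exI[of _ g0] exI[of _ 1]) simp
next
  case (insert x A)
  have "\<exists>g b. b \<in> P g \<and> b \<noteq> 0 \<and> (\<forall>x\<in>A. \<exists>a\<in>P g. \<kappa> x = Fract a b)"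
    by (rule insert.IH) (rule insert.prems, simp)
  then obtain g b where gb: "b \<in> P g" "b \<noteq> 0" "\<forall>x\<in>A. \<exists>a\<in>P g. \<kappa> x = Fract a b" by (elim exE conjE)
  have "\<exists>a b g. a \<in> P g \<and> b \<in> P g \<and> b \<noteq> 0 \<and> \<kappa> x = Fract a b" by (rule insert.prems) simp
  then obtain a' b' g' where x: "a' \<in> P g'" "b' \<in> P g'" "b' \<noteq> 0" "\<kappa> x = Fract a' b'" by (elim exE conjE)
  have "\<exists>a\<in>P (op_add g g'). \<kappa> y = Fract a (b * b')" if "y \<in> insert x A" for y
  proof (cases "y = x")
    case True
    have "Fract a' b' = Fract (b * a') (b * b')" using gb(2) x(3) by (simp add: eq_fract)
    then show ?thesis using True x(4) mult[OF gb(1) x(1)] by (intro bexI[of _ "b * a'"]) simp_all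
  next
    case False
    then have "y \<in> A" using that by simp
    from gb(3) this have "\<exists>a\<in>P g. \<kappa> y = Fract a b" by (rule bspec)
    then obtain a where a: "a \<in> P g" "\<kappa> y = Fract a b" by (rule bexE)
    have "Fract a b = Fract (a * b') (b * b')" using gb(2) x(3) by (simp add: eq_fract)
    then show ?thesis using a(2) mult[OF a(1) x(2)] by (intro bexI[of _ "a * b'"]) simp_all
  qed
  then show ?case using mult[OF gb(1) x(2)] gb(2) x(3)
    by (intro exI[of _ "op_add g g'"] exI[of _ "b * b'"]) simp
qed

context rational_map
begin

lemma rees_part_fiber_mult:
  "a \<in> rees_part 0 n \<Longrightarrow> b \<in> rees_part 0 n' \<Longrightarrow> a * b \<in> rees_part 0 (\<lambda>i. n i + n' i)"
  using rees_part_mult[of a 0 n b 0 n'] by simp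

lemma one_in_fiber: "1 \<in> rees_part 0 (\<lambda>_. 0)"
  using rees_part_base[OF bidegree_0] by simp

lemma function_field_image_eq:
  "function_field_image m f = {Fract a b | a b n. a \<in> rees_part 0 n \<and> b \<in> rees_part 0 n \<and> b \<noteq> 0}"
proof (rule Set.set_eqI, rule iffI)
  fix z assume "z \<in> function_field_image m f"
  then obtain A B n where *: "multiform m n A" "multiform m n B" "pullback f B \<noteq> 0"
    "z = Fract (pullback f A) (pullback f B)"
    unfolding function_field_image_def vanishes_on_image_closure_def by (elim CollectE exE conjE)
  have pull: "pullback f C \<in> rees_part 0 n" if "multiform m n C" for C
    unfolding pullback_multiforms[symmetric] by (intro CollectI exI[of _ C] conjI refl that)
  from pull[OF *(1)] pull[OF *(2)] show "z \<in> {Fract a b | a b n. a \<in> rees_part 0 n \<and> b \<in> rees_part 0 n \<and> b \<noteq> 0}"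
    using *(3,4) by (intro CollectI exI[of _ "pullback f A"] exI[of _ "pullback f B"] exI[of _ n] conjI)
next
  fix z assume "z \<in> {Fract a b | a b n. a \<in> rees_part 0 n \<and> b \<in> rees_part 0 n \<and> b \<noteq> 0}"
  then obtain a b n where *: "a \<in> rees_part 0 n" "b \<in> rees_part 0 n" "b \<noteq> 0" "z = Fract a b"
    by (elim CollectE exE conjE)
  obtain A where A: "a = pullback f A" "multiform m n A"
    using *(1) unfolding pullback_multiforms[symmetric] by (elim CollectE exE conjE)
  obtain B where B: "b = pullback f B" "multiform m n B"
    using *(2) unfolding pullback_multiforms[symmetric] by (elim CollectE exE conjE)
  show "z \<in> function_field_image m f"
    unfolding function_field_image_def vanishes_on_image_closure_def
    by (intro CollectI exI[of _ A] exI[of _ B] exI[of _ n] conjI) (use A B * in simp_all)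
qed

lemma function_field_imageI:
  "a \<in> rees_part 0 n \<Longrightarrow> b \<in> rees_part 0 n \<Longrightarrow> b \<noteq> 0 \<Longrightarrow> Fract a b \<in> function_field_image m f"
  unfolding function_field_image_eq
  by (intro CollectI exI[of _ a] exI[of _ b] exI[of _ n] conjI refl)

lemma function_field_imageE:
  assumes "z \<in> function_field_image m f"
  obtains a b n where "a \<in> rees_part 0 n" "b \<in> rees_part 0 n" "b \<noteq> 0" "z = Fract a b"
  using assms unfolding function_field_image_eq by (elim CollectE exE conjE) (rule that)

lemma function_field_image_closed:
  "1 \<in> function_field_image m f"
  "x \<in> function_field_image m f \<Longrightarrow> - x \<in> function_field_image m f"
  "x \<in> function_field_image m f \<Longrightarrow> y \<in> function_field_image m f \<Longrightarrow> x * y \<in> function_field_image m f"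
  "x \<in> function_field_image m f \<Longrightarrow> y \<in> function_field_image m f \<Longrightarrow> x + y \<in> function_field_image m f"
  "x \<in> function_field_image m f \<Longrightarrow> inverse x \<in> function_field_image m f"
proof -
  have "Fract 1 1 \<in> function_field_image m f"
    by (rule function_field_imageI[OF one_in_fiber one_in_fiber]) simp
  then show "1 \<in> function_field_image m f" by (simp only: One_fract_def)
  have zero: "0 \<in> function_field_image m f"
    unfolding Zero_fract_def by (rule function_field_imageI[OF _ one_in_fiber]) simp_all
  show "- x \<in> function_field_image m f" if "x \<in> function_field_image m f"
    using that
  proof (rule function_field_imageE)
    fix a b n assume *: "a \<in> rees_part 0 n" "b \<in> rees_part 0 n" "b \<noteq> 0" "x = Fract a b"
    show ?thesis unfolding *(4) minus_fract by (rule function_field_imageI[OF rees_part_uminus[OF *(1)] *(2,3)])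
  qed
  show "inverse x \<in> function_field_image m f" if "x \<in> function_field_image m f"
    using that
  proof (rule function_field_imageE)
    fix a b n assume *: "a \<in> rees_part 0 n" "b \<in> rees_part 0 n" "b \<noteq> 0" "x = Fract a b"
    show ?thesis
    proof (cases "a = 0")
      case True
      then have "inverse x = 0" using *(4) by (simp add: Zero_fract_def[symmetric] fract_collapse)
      then show ?thesis using zero by simp
    next
      case False
      show ?thesis unfolding *(4) inverse_fract by (rule function_field_imageI[OF *(2,1) False])
    qed
  qed
  assume "x \<in> function_field_image m f" "y \<in> function_field_image m f"
  then obtain a b n a' b' n' where *: "a \<in> rees_part 0 n" "b \<in> rees_part 0 n" "b \<noteq> 0" "x = Fract a b"
    and **: "a' \<in> rees_part 0 n'" "b' \<in> rees_part 0 n'" "b' \<noteq> 0" "y = Fract a' b'"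
    by (elim function_field_imageE) (rule that)
  have b: "b * b' \<in> rees_part 0 (\<lambda>i. n i + n' i)" "b * b' \<noteq> 0"
    using rees_part_fiber_mult[OF *(2) **(2)] *(3) **(3) by simp_all
  show "x * y \<in> function_field_image m f"
    unfolding *(4) **(4) mult_fract by (rule function_field_imageI[OF rees_part_fiber_mult[OF *(1) **(1)] b])
  have "a * b' + a' * b \<in> rees_part 0 (\<lambda>i. n i + n' i)"
    using rees_part_add[OF rees_part_fiber_mult[OF *(1) **(2)] rees_part_fiber_mult[OF *(2) **(1)]]
    by (simp only: mult.commute)
  from function_field_imageI[OF this b]
  show "x + y \<in> function_field_image m f"
    unfolding *(4) **(4) by (simp only: add_fract[OF *(3) **(3)])
qed

lemma function_field_proj_eq:
  "(function_field_proj :: ('v, 'k) mpol fract set) =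
     {z. \<exists>a b j. homogeneous j a \<and> homogeneous j b \<and> b \<noteq> 0 \<and> z = Fract a b}"
  unfolding function_field_proj_def by (rule Set.set_eqI) (auto)

text \<open>
  A basis of the extension has a common denominator \<open>r\<close>, a form of some degree
  \<open>d\<close>, and replacing \<open>r\<close> by \<open>x\<^sup>d\<close> multiplies the
  basis by one element of the field. The last clause expands \<open>u / x\<^sup>e\<close> in the
  basis \<open>p\<^sub>i / x\<^sup>d\<close>, with denominators cleared.
\<close>

theorem basis_of_forms:
  fixes v :: 'v
  assumes fin: "generically_finite m f" and D: "D = map_degree m f"
  shows "\<exists>d p. (\<forall>i<D. homogeneous d (p i)) \<and>
     (\<forall>n q. (\<forall>i<D. q i \<in> rees_part 0 n) \<longrightarrow> (\<Sum>i<D. q i * p i) = 0 \<longrightarrow> (\<forall>i<D. q i = 0)) \<and>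
     (\<forall>e u. homogeneous e u \<longrightarrow> (\<exists>n b c. b \<in> rees_part 0 n \<and> b \<noteq> 0 \<and> (\<forall>i<D. c i \<in> rees_part 0 n) \<and>
        b * u * Var v ^ d = Var v ^ e * (\<Sum>i<D. c i * p i)))"
proof -
  let ?K = "function_field_image m f" and ?L = "function_field_proj :: ('v, 'k) mpol fract set"
  have "\<exists>\<beta>. ?L = {\<Sum>i<D. \<kappa> i * \<beta> i | \<kappa>. \<forall>i<D. \<kappa> i \<in> ?K} \<and>
    (\<forall>\<kappa>. (\<forall>i<D. \<kappa> i \<in> ?K) \<longrightarrow> (\<Sum>i<D. \<kappa> i * \<beta> i) = 0 \<longrightarrow> (\<forall>i<D. \<kappa> i = 0))"
  proof (rule basis_of_finite_dimension)
    show "D = ring.dim ring_of_type_algebra ?K ?L" by (simp only: D map_degree_def)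
    show "ring.finite_dimension ring_of_type_algebra ?K ?L"
      using fin by (simp only: generically_finite_def)
  qed (fact function_field_image_closed)+
  then obtain \<beta> where L: "?L = {\<Sum>i<D. \<kappa> i * \<beta> i | \<kappa>. \<forall>i<D. \<kappa> i \<in> ?K}"
    and ind: "\<And>\<kappa>. (\<forall>i<D. \<kappa> i \<in> ?K) \<Longrightarrow> (\<Sum>i<D. \<kappa> i * \<beta> i) = 0 \<Longrightarrow> (\<forall>i<D. \<kappa> i = 0)"
    by (elim exE conjE) simp
  have zero: "0 \<in> ?K" unfolding Zero_fract_def by (rule function_field_imageI[OF _ one_in_fiber]) simp_all
  have \<beta>: "\<beta> i \<in> ?L" if "i < D" for i
  proof -
    have "\<beta> i = (\<Sum>j<D. (if j = i then 1 else 0) * \<beta> j)"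
      using that by (simp add: if_distrib[where f = "\<lambda>x. x * _"] cong: if_cong)
    moreover have "\<forall>j<D. (if j = i then 1 else 0) \<in> ?K" using zero function_field_image_closed(1) by simp
    ultimately show ?thesis
      unfolding L by (intro CollectI exI[of _ "\<lambda>j. if j = i then 1 else 0"] conjI)
  qed
  have "\<exists>d b. b \<in> {u. homogeneous d u} \<and> b \<noteq> 0 \<and> (\<forall>i\<in>{..<D}. \<exists>a\<in>{u. homogeneous d u}. \<beta> i = Fract a b)"
  proof (rule common_denominator[where op_add = "(+)" and ?g0.0 = 0])
    show "a * b \<in> {u. homogeneous (g + h) u}" if "a \<in> {u. homogeneous g u}" "b \<in> {u. homogeneous h u}" for g h and a b :: "('v, 'k) mpol"
      using that by (simp add: homogeneous_mult)
    fix i assume "i \<in> {..<D}"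
    then have "\<beta> i \<in> ?L" using \<beta> by simp
    then show "\<exists>a b g. a \<in> {u. homogeneous g u} \<and> b \<in> {u. homogeneous g u} \<and> b \<noteq> 0 \<and> \<beta> i = Fract a b"
      unfolding function_field_proj_eq by simp
  qed (simp_all add: homogeneous_1)
  then obtain d r where r: "homogeneous d r" "r \<noteq> 0" and "\<forall>i\<in>{..<D}. \<exists>a\<in>{u. homogeneous d u}. \<beta> i = Fract a r"
    by (elim exE conjE CollectE)
  then have "\<forall>i\<in>{..<D}. \<exists>a. homogeneous d a \<and> \<beta> i = Fract a r" by simp
  then obtain p where p: "\<forall>i\<in>{..<D}. homogeneous d (p i) \<and> \<beta> i = Fract (p i) r" by (rule bchoice[THEN exE])
  have sum_eq: "(\<Sum>i<D. Fract (c i) b * \<beta> i) = to_fract (\<Sum>i<D. c i * p i) / (to_fract b * to_fract r)" for c b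
  proof -
    have "(\<Sum>i<D. Fract (c i) b * \<beta> i) = (\<Sum>i<D. to_fract (c i * p i) / (to_fract b * to_fract r))"
      by (rule sum.cong[OF refl]) (use p in \<open>simp add: Fract_conv_to_fract\<close>)
    then show ?thesis by (simp add: to_fract_sum sum_divide_distrib)
  qed
  have indep: "\<forall>i<D. q i = 0" if q: "\<forall>i<D. q i \<in> rees_part 0 n" "(\<Sum>i<D. q i * p i) = 0" for n q
  proof -
    obtain b where b: "b \<in> rees_part 0 n" "b \<noteq> 0" using exists_nonzero_in_fiber by blast
    have "\<forall>i<D. Fract (q i) b \<in> ?K" using q(1) function_field_imageI[OF _ b] by simp
    moreover have "(\<Sum>i<D. Fract (q i) b * \<beta> i) = 0" unfolding sum_eq q(2) by simp
    ultimately have "\<forall>i<D. Fract (q i) b = 0" by (rule ind)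
    then show ?thesis using b(2) by (simp add: Zero_fract_def eq_fract)
  qed
  have span: "\<exists>n b c. b \<in> rees_part 0 n \<and> b \<noteq> 0 \<and> (\<forall>i<D. c i \<in> rees_part 0 n) \<and>
        b * u * Var v ^ d = Var v ^ e * (\<Sum>i<D. c i * p i)" if u: "homogeneous e u" for e u
  proof -
    have x: "(Var v :: ('v, 'k) mpol) ^ t \<noteq> 0" for t by (simp add: Var_nonzero)
    have "homogeneous (e + d) (u * Var v ^ d)" "homogeneous (e + d) (Var v ^ e * r)"
      by (rule homogeneous_mult[OF u homogeneous_Var_power], rule homogeneous_mult[OF homogeneous_Var_power r(1)])
    then have "Fract (u * Var v ^ d) (Var v ^ e * r) \<in> ?L"
      unfolding function_field_proj_eq using x r(2) by (intro CollectI exI conjI) simp_all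
    then obtain \<kappa> where \<kappa>: "Fract (u * Var v ^ d) (Var v ^ e * r) = (\<Sum>i<D. \<kappa> i * \<beta> i)" "\<forall>i<D. \<kappa> i \<in> ?K"
      unfolding L by (elim CollectE exE conjE)
    have "\<exists>n b. b \<in> rees_part 0 n \<and> b \<noteq> 0 \<and> (\<forall>i\<in>{..<D}. \<exists>a\<in>rees_part 0 n. \<kappa> i = Fract a b)"
    proof (rule common_denominator[where op_add = "\<lambda>n n' i. n i + n' i" and ?g0.0 = "\<lambda>_. 0"])
      show "a * b \<in> rees_part 0 (\<lambda>i. n i + n' i)" if "a \<in> rees_part 0 n" "b \<in> rees_part 0 n'" for n n' a b
        by (rule rees_part_fiber_mult[OF that])
      show "1 \<in> rees_part 0 (\<lambda>_. 0)" by (rule one_in_fiber)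
      fix i assume "i \<in> {..<D}"
      then have "\<kappa> i \<in> ?K" using \<kappa>(2) by simp
      then show "\<exists>a b n. a \<in> rees_part 0 n \<and> b \<in> rees_part 0 n \<and> b \<noteq> 0 \<and> \<kappa> i = Fract a b"
        by (rule function_field_imageE) (intro exI conjI)
    qed simp
    then obtain n b where b: "b \<in> rees_part 0 n" "b \<noteq> 0" "\<forall>i\<in>{..<D}. \<exists>a. a \<in> rees_part 0 n \<and> \<kappa> i = Fract a b"
      by (elim exE conjE) (simp add: Bex_def)
    from b(3) obtain c where c: "\<forall>i\<in>{..<D}. c i \<in> rees_part 0 n \<and> \<kappa> i = Fract (c i) b" by (rule bchoice[THEN exE])
    have s: "(\<Sum>i<D. \<kappa> i * \<beta> i) = (\<Sum>i<D. Fract (c i) b * \<beta> i)"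
      by (rule sum.cong[OF refl]) (use c in simp)
    have "Fract (u * Var v ^ d) (Var v ^ e * r) = to_fract (\<Sum>i<D. c i * p i) / (to_fract b * to_fract r)"
      by (simp only: \<kappa>(1) s sum_eq)
    then have "to_fract (u * Var v ^ d) / to_fract (Var v ^ e * r) = to_fract (\<Sum>i<D. c i * p i) / (to_fract b * to_fract r)"
      by (simp only: Fract_conv_to_fract)
    then have "to_fract (u * Var v ^ d) * (to_fract b * to_fract r) = to_fract (\<Sum>i<D. c i * p i) * to_fract (Var v ^ e * r)"
      by (subst (asm) frac_eq_eq) (use x b(2) r(2) in simp_all)
    then have "to_fract (u * Var v ^ d * (b * r)) = to_fract ((\<Sum>i<D. c i * p i) * (Var v ^ e * r))"
      by (simp only: to_fract_mult)
    then have "u * Var v ^ d * (b * r) = (\<Sum>i<D. c i * p i) * (Var v ^ e * r)"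
      by (simp only: to_fract_eq_iff)
    then have "r * (b * u * Var v ^ d) = r * (Var v ^ e * (\<Sum>i<D. c i * p i))"
      by (simp only: mult_ac)
    then have "b * u * Var v ^ d = Var v ^ e * (\<Sum>i<D. c i * p i)"
      using r(2) by simp
    moreover have "\<forall>i<D. c i \<in> rees_part 0 n" using c by auto
    ultimately show ?thesis
      using b(1,2) by (intro exI[of _ n] exI[of _ b] exI[of _ c] conjI)
  qed
  show ?thesis
  proof (intro exI[of _ d] exI[of _ p] conjI allI impI)
    show "homogeneous d (p i)" if "i < D" for i using p that by auto
    show "q i = 0" if "\<forall>i<D. q i \<in> rees_part 0 n" "(\<Sum>i<D. q i * p i) = 0" "i < D" for n q i
      using indep[OF that(1,2)] that(3) by simp
  qed (fact span)
qed

end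

section \<open>Divisibility by variables and the saturated fiber ring\<close>

lemma lookup_Var_power_mult:
  fixes h :: "('v::finite, 'k::comm_semiring_1) mpol"
  shows "Poly_Mapping.lookup (Poly_Mapping.single \<sigma> 1 * h) (\<sigma> + \<mu>) = Poly_Mapping.lookup h \<mu>"
proof -
  have "Poly_Mapping.single \<sigma> 1 * h =
      (\<Sum>\<nu>\<in>Poly_Mapping.keys h. Poly_Mapping.single (\<sigma> + \<nu>) (Poly_Mapping.lookup h \<nu>))"
    by (subst (1) poly_mapping_sum_singles[of h]) (simp add: sum_distrib_left mult_single)
  then show ?thesis
    by (simp add: lookup_sum lookup_single when_def in_keys_iff)
qed

lemma Var_power_eq_single: "Var v ^ d = (Poly_Mapping.single (Poly_Mapping.single v d) 1 :: ('v, 'k::comm_semiring_1) mpol)"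
  by (induction d) (auto simp: Var_def mult_single single_add[symmetric])

text \<open>Divisibility by a power of a variable can be read off the exponents.\<close>

lemma Var_power_dvd_iff:
  fixes h :: "('v::finite, 'k::comm_semiring_1) mpol"
  shows "Var v ^ d dvd h \<longleftrightarrow> (\<forall>\<mu>\<in>Poly_Mapping.keys h. d \<le> Poly_Mapping.lookup \<mu> v)"
proof
  assume "Var v ^ d dvd h"
  then obtain g where "h = Var v ^ d * g" by (rule dvdE)
  then have h: "h = Poly_Mapping.single (Poly_Mapping.single v d) 1 * g" by (simp only: Var_power_eq_single)
  show "\<forall>\<mu>\<in>Poly_Mapping.keys h. d \<le> Poly_Mapping.lookup \<mu> v"
  proof
    fix \<mu> assume "\<mu> \<in> Poly_Mapping.keys h"
    then obtain a b where "\<mu> = a + b" "a \<in> Poly_Mapping.keys (Poly_Mapping.single (Poly_Mapping.single v d) (1::'k))"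
      using keys_mult[of "Poly_Mapping.single (Poly_Mapping.single v d) 1" g] unfolding h by blast
    then have "\<mu> = Poly_Mapping.single v d + b" by simp
    then show "d \<le> Poly_Mapping.lookup \<mu> v" by (simp add: lookup_add)
  qed
next
  assume *: "\<forall>\<mu>\<in>Poly_Mapping.keys h. d \<le> Poly_Mapping.lookup \<mu> v"
  have "Var v ^ d dvd Poly_Mapping.single \<mu> (Poly_Mapping.lookup h \<mu>)" if "\<mu> \<in> Poly_Mapping.keys h" for \<mu>
  proof -
    have "\<mu> = Poly_Mapping.single v d + (\<mu> - Poly_Mapping.single v d)"
      by (rule poly_mapping_eqI) (use * that in \<open>auto simp: lookup_add lookup_minus lookup_single when_def\<close>)
    then have "Poly_Mapping.single \<mu> (Poly_Mapping.lookup h \<mu>) =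
        Var v ^ d * Poly_Mapping.single (\<mu> - Poly_Mapping.single v d) (Poly_Mapping.lookup h \<mu>)"
      by (simp add: Var_power_eq_single mult_single)
    then show ?thesis by (rule dvdI)
  qed
  then have "Var v ^ d dvd (\<Sum>\<mu>\<in>Poly_Mapping.keys h. Poly_Mapping.single \<mu> (Poly_Mapping.lookup h \<mu>))"
    by (rule dvd_sum)
  then show "Var v ^ d dvd h" by (simp only: poly_mapping_sum_singles[symmetric])
qed

lemma Var_power_dvd_of_dvd_mult:
  fixes h :: "('v::finite, 'k::comm_semiring_1) mpol"
  assumes "Var v ^ d dvd Var v' ^ e * h" "v' \<noteq> v"
  shows "Var v ^ d dvd h"
  unfolding Var_power_dvd_iff
proof
  fix \<mu> assume \<mu>: "\<mu> \<in> Poly_Mapping.keys h"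
  have "Poly_Mapping.single v' e + \<mu> \<in> Poly_Mapping.keys (Var v' ^ e * h)"
    using \<mu> by (simp add: in_keys_iff Var_power_eq_single lookup_Var_power_mult)
  with assms(1) have "d \<le> Poly_Mapping.lookup (Poly_Mapping.single v' e + \<mu>) v"
    unfolding Var_power_dvd_iff by (rule bspec)
  then show "d \<le> Poly_Mapping.lookup \<mu> v" using assms(2) by (simp add: lookup_add lookup_single)
qed

text \<open>Over \<open>\<P>\<^sup>0\<close> there is no second variable, but then every form of degree \<open>d\<close> is a multiple of \<open>x\<^sup>d\<close>.\<close>

lemma Var_power_dvd_homogeneous:
  fixes h :: "('v::finite, 'k::comm_semiring_1) mpol"
  assumes "homogeneous d h" "\<And>v'. v' = v"
  shows "Var v ^ d dvd h"
  unfolding Var_power_dvd_iff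
proof
  fix \<mu> assume "\<mu> \<in> Poly_Mapping.keys h"
  then have "(\<Sum>x\<in>UNIV. Poly_Mapping.lookup \<mu> x) = d" using assms(1) by (simp add: homogeneous_def)
  moreover have "(\<Sum>x\<in>UNIV. Poly_Mapping.lookup \<mu> x) = (\<Sum>x\<in>{v}. Poly_Mapping.lookup \<mu> x)"
    by (rule sum.cong) (use assms(2) in auto)
  ultimately show "d \<le> Poly_Mapping.lookup \<mu> v" by simp
qed

lemma homogeneous_of_Var_power_mult:
  fixes g :: "('v::finite, 'k::comm_semiring_1) mpol"
  assumes "homogeneous (d + e) (Var v ^ d * g)" shows "homogeneous e g"
  unfolding homogeneous_alt
proof
  fix \<mu> assume "\<mu> \<in> Poly_Mapping.keys g"
  then have "Poly_Mapping.single v d + \<mu> \<in> Poly_Mapping.keys (Var v ^ d * g)"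
    by (simp add: in_keys_iff Var_power_eq_single lookup_Var_power_mult)
  with assms have "monomial_degree (Poly_Mapping.single v d + \<mu>) = d + e"
    unfolding homogeneous_alt by (rule bspec)
  moreover have "monomial_degree (Poly_Mapping.single v d) = d"
    by (simp add: monomial_degree_def lookup_single when_def)
  ultimately show "monomial_degree \<mu> = e" by (simp add: monomial_degree_add)
qed

context rational_map
begin

lemma fiber_subset_saturated:
  assumes "g \<in> rees_part 0 n" shows "g \<in> saturated_fiber n"
  unfolding saturated_special_fiber_iff
proof
  show "homogeneous (\<Sum>i\<in>UNIV. n i * \<delta> i) g" using homogeneous_rees_part[OF assms] by simp
  show "\<exists>s. \<forall>u. homogeneous s u \<longrightarrow> u * g \<in> rees_part s n"
    using rees_part_mult_homogeneous[OF _ assms] by (intro exI[of _ 0]) simp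
qed

lemma saturated_fiber_mult_fiber:
  assumes b: "b \<in> rees_part 0 n'" and g: "g \<in> saturated_fiber n"
  shows "b * g \<in> saturated_fiber (\<lambda>i. n' i + n i)"
proof -
  obtain s where hg: "homogeneous (\<Sum>i\<in>UNIV. n i * \<delta> i) g" and s: "\<And>u. homogeneous s u \<Longrightarrow> u * g \<in> rees_part s n"
    using g unfolding saturated_special_fiber_iff by blast
  have "homogeneous (\<Sum>i\<in>UNIV. (n' i + n i) * \<delta> i) (b * g)"
    using homogeneous_mult[OF homogeneous_rees_part[OF b] hg] by (simp add: distrib_right sum.distrib)
  moreover have "u * (b * g) \<in> rees_part s (\<lambda>i. n' i + n i)" if "homogeneous s u" for u
    using rees_part_mult[OF b s[OF that]] by (simp add: mult.left_commute)
  ultimately show ?thesis unfolding saturated_special_fiber_iff by blast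
qed

text \<open>
  Two elements may need different degrees \<open>s\<close> and \<open>t\<close>; both admit
  \<open>s + t\<close>, because a form of degree \<open>s + t\<close> is a sum of products.
\<close>

lemma subspace_saturated_fiber: "kvs.subspace (saturated_fiber n)"
proof (rule kvs.subspaceI)
  show "0 \<in> saturated_fiber n" by (rule fiber_subset_saturated) simp
  show "Const c * g \<in> saturated_fiber n" if "g \<in> saturated_fiber n" for c g
  proof -
    obtain s where s: "homogeneous (\<Sum>i\<in>UNIV. n i * \<delta> i) g" "\<And>u. homogeneous s u \<Longrightarrow> u * g \<in> rees_part s n"
      using \<open>g \<in> saturated_fiber n\<close> unfolding saturated_special_fiber_iff by blast
    have "u * (Const c * g) \<in> rees_part s n" if "homogeneous s u" for u
      using rees_part_scale[OF s(2)[OF that]] by (simp only: mult.left_commute)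
    then show ?thesis
      unfolding saturated_special_fiber_iff using homogeneous_Const_mult[OF s(1)] by blast
  qed
  fix g h assume g: "g \<in> saturated_fiber n" and h: "h \<in> saturated_fiber n"
  obtain s where s: "homogeneous (\<Sum>i\<in>UNIV. n i * \<delta> i) g" "\<And>u. homogeneous s u \<Longrightarrow> u * g \<in> rees_part s n"
    using g unfolding saturated_special_fiber_iff by blast
  obtain t where t: "homogeneous (\<Sum>i\<in>UNIV. n i * \<delta> i) h" "\<And>u. homogeneous t u \<Longrightarrow> u * h \<in> rees_part t n"
    using h unfolding saturated_special_fiber_iff by blast
  \<comment> \<open>raising the degree of the test forms\<close>
  have lift: "u * g' \<in> rees_part (s' + t') n"
    if u: "homogeneous (s' + t') u" and g': "\<And>u. homogeneous s' u \<Longrightarrow> u * g' \<in> rees_part s' n" for u g' s' t'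
  proof -
    have "u \<in> {u. g' * u \<in> rees_part (s' + t') n}"
    proof (rule set_mp[OF kvs.span_minimal[OF _ subspace_preimage_mult[OF subspace_rees_part]]])
      show "u \<in> kvs.span (generator_monomial ` bidegree (s' + t') (\<lambda>_. 0))"
        using u by (simp only: rees_part_of_homogeneous[symmetric] rees_part_def)
      show "generator_monomial ` bidegree (s' + t') (\<lambda>_. 0) \<subseteq> {u. g' * u \<in> rees_part (s' + t') n}"
      proof (rule image_subsetI)
        fix \<alpha> assume "\<alpha> \<in> bidegree (s' + t') (\<lambda>_. 0)"
        then obtain \<beta> \<gamma> where *: "\<beta> \<in> bidegree s' (\<lambda>_. 0)" "\<gamma> \<in> bidegree t' (\<lambda>_. 0)" "\<alpha> = (\<lambda>z. \<beta> z + \<gamma> z)"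
          by (rule bidegree_split)
        have "homogeneous s' (generator_monomial \<beta>)" "homogeneous t' (generator_monomial \<gamma>)"
          using homogeneous_generator_monomial[OF *(1)] homogeneous_generator_monomial[OF *(2)] by simp_all
        then have "generator_monomial \<gamma> * (generator_monomial \<beta> * g') \<in> rees_part (t' + s') n"
          by (intro rees_part_mult_homogeneous g')
        then show "generator_monomial \<alpha> \<in> {u. g' * u \<in> rees_part (s' + t') n}"
          by (simp add: *(3) generator_monomial_add mult_ac add.commute)
      qed
    qed
    then show ?thesis by (simp add: mult.commute)
  qed
  have "u * (g + h) \<in> rees_part (s + t) n" if u: "homogeneous (s + t) u" for u
  proof -
    have "u * g \<in> rees_part (s + t) n" by (rule lift[OF u s(2)])
    moreover have "u * h \<in> rees_part (t + s) n" by (rule lift[OF _ t(2)]) (use u in \<open>simp_all add: add.commute\<close>)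
    ultimately show ?thesis by (simp add: distrib_left rees_part_add add.commute)
  qed
  then show "g + h \<in> saturated_fiber n"
    unfolding saturated_special_fiber_iff using homogeneous_add[OF s(1) t(1)] by blast
qed

section \<open>Hilbert functions of the fiber rings\<close>

lemma kdim_image_mult:
  fixes p :: "('v, 'k) mpol"
  assumes "p \<noteq> 0" "finite A" "kvs.subspace M" "M \<subseteq> kvs.span A"
  shows "kdim ((*) p ` M) = kdim M"
proof -
  interpret lin: Vector_Spaces.linear "\<lambda>(c::'k) (g::('v, 'k) mpol). Const c * g" "\<lambda>(c::'k) (g::('v, 'k) mpol). Const c * g" "(*) p"
    by unfold_locales (simp_all add: distrib_left mult.left_commute)
  obtain B where B: "finite B" "kvs.independent B" "kvs.span B = M" "kvs.dim M = card B"
    by (rule kvs.finite_basis_of_subspace[OF assms(2-4)])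
  have inj: "inj_on ((*) p) S" for S using assms(1) by (auto intro: inj_onI)
  have indep: "kvs.independent ((*) p ` B)"
    by (rule lin.independent_injective_image[OF B(2) inj])
  have s1: "kvs.span ((*) p ` B) = (*) p ` M" using lin.span_image[of B] B(3) by simp
  have s2: "kvs.span ((*) p ` M) = (*) p ` M"
    by (rule kvs.span_eq_iff[THEN iffD2, OF subspace_image_mult[OF assms(3)]])
  have "kvs.dim ((*) p ` M) = card ((*) p ` B)"
    by (rule kvs.dim_eq_card[OF _ indep]) (simp only: s1 s2)
  then show ?thesis using B(4) card_image[OF inj, of B] by (simp add: kdim_alt)
qed

lemma saturated_fiber_finite_dimensional:
  "saturated_fiber n \<subseteq> kvs.span (generator_monomial ` bidegree (\<Sum>i\<in>UNIV. n i * \<delta> i) (\<lambda>_. 0))"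
proof
  fix g assume "g \<in> saturated_fiber n"
  then have "homogeneous (\<Sum>i\<in>UNIV. n i * \<delta> i) g" unfolding saturated_special_fiber_iff by blast
  then show "g \<in> kvs.span (generator_monomial ` bidegree (\<Sum>i\<in>UNIV. n i * \<delta> i) (\<lambda>_. 0))"
    by (simp only: rees_part_of_homogeneous[symmetric] rees_part_def)
qed

lemma eventually_polynomial_fiber: "eventually_polynomial (\<lambda>n. of_nat (kdim (special_fiber m \<delta> f n)))"
  unfolding special_fiber_eq
proof (rule hilbert_function_eventually_polynomial[where M = "rees_part 0" and e = 0])
  show "generator_monomial \<beta> * g \<in> rees_part 0 (\<lambda>i. n' i + n i)" if "g \<in> rees_part 0 n" "\<beta> \<in> bidegree 0 n'" for n n' \<beta> g
    by (rule rees_part_fiber_mult[OF rees_part_base[OF that(2)] that(1)])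
qed (rule subspace_rees_part, rule order_refl)

text \<open>
  Multiplication by \<open>x\<^sup>E\<close> embeds the saturated fiber ring in the components
  with \<open>e = E\<close> of the Rees algebra.
\<close>

lemma eventually_polynomial_saturated_fiber: "eventually_polynomial (\<lambda>n. of_nat (kdim (saturated_fiber n)))"
proof -
  fix v :: 'v
  from uniform_saturation[of v]
  obtain E where E: "\<forall>n g. g \<in> saturated_fiber n \<longrightarrow> Var v ^ E * g \<in> rees_part E n" by (rule exE)
  let ?M = "\<lambda>n. (*) (Var v ^ E) ` saturated_fiber n"
  have "eventually_polynomial (\<lambda>n. of_nat (kdim (?M n)))"
  proof (rule hilbert_function_eventually_polynomial[where M = ?M and e = E])
    show "kvs.subspace (?M n)" for n by (rule subspace_image_mult[OF subspace_saturated_fiber])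
    show "?M n \<subseteq> rees_part E n" for n by (rule image_subsetI) (rule E[rule_format])
    show "generator_monomial \<beta> * h \<in> ?M (\<lambda>i. n' i + n i)" if "h \<in> ?M n" "\<beta> \<in> bidegree 0 n'" for n n' \<beta> h
    proof -
      from that(1) obtain g where g: "g \<in> saturated_fiber n" "h = Var v ^ E * g" by (rule imageE)
      have "generator_monomial \<beta> * h = Var v ^ E * (generator_monomial \<beta> * g)"
        by (simp only: g(2) mult.left_commute)
      then show ?thesis
        using saturated_fiber_mult_fiber[OF rees_part_base[OF that(2)] g(1)] by (rule image_eqI)
    qed
  qed
  moreover have "kdim (?M n) = kdim (saturated_fiber n)" for n
    by (rule kdim_image_mult[OF _ _ subspace_saturated_fiber saturated_fiber_finite_dimensional])
      (simp_all add: Var_nonzero)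
  ultimately show ?thesis by (simp only:)
qed

text \<open>
  The component is contained in the space of forms of degree \<open>n\<cdot>\<delta>\<close>, and
  a monomial of given degree is determined by its exponents at \<open>r\<close> of the \<open>r +
  1\<close> variables.
\<close>

lemma kdim_fiber_le:
  assumes "card (UNIV :: 'v set) = r + 1"
  shows "kdim (special_fiber m \<delta> f n) \<le> (1 + (\<Sum>i\<in>UNIV. n i * \<delta> i)) ^ r"
proof -
  fix v0 :: 'v
  let ?e = "\<Sum>i\<in>UNIV. n i * \<delta> i"
  let ?A = "bidegree ?e (\<lambda>_. 0)"
  have sub: "rees_part 0 n \<subseteq> kvs.span (generator_monomial ` ?A)"
    using saturated_fiber_finite_dimensional fiber_subset_saturated by blast
  have "kdim (special_fiber m \<delta> f n) \<le> card (generator_monomial ` ?A)"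
    unfolding special_fiber_eq kdim_alt by (rule kvs.dim_le_card[OF sub]) simp
  also have "\<dots> \<le> card ?A" by (rule card_image_le) simp
  also have "\<dots> \<le> card ((UNIV - {v0}) \<rightarrow>\<^sub>E {..?e})"
  proof (rule card_inj_on_le)
    show "inj_on (\<lambda>\<alpha>. restrict (\<lambda>v. \<alpha> (Inl v)) (UNIV - {v0})) ?A"
    proof (rule inj_onI)
      fix \<alpha> \<beta> assume \<alpha>: "\<alpha> \<in> ?A" and \<beta>: "\<beta> \<in> ?A"
        and eq: "restrict (\<lambda>v. \<alpha> (Inl v)) (UNIV - {v0}) = restrict (\<lambda>v. \<beta> (Inl v)) (UNIV - {v0})"
      have other: "\<alpha> (Inl v) = \<beta> (Inl v)" if "v \<noteq> v0" for v
        using fun_cong[OF eq, of v] that by simp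
      have "(\<Sum>v\<in>UNIV. \<alpha> (Inl v)) = (\<Sum>v\<in>UNIV. \<beta> (Inl v))" using \<alpha> \<beta> by (simp add: bidegree_iff)
      moreover have "(\<Sum>v\<in>UNIV. \<gamma> (Inl v)) = \<gamma> (Inl v0) + (\<Sum>v\<in>UNIV - {v0}. \<gamma> (Inl v))" for \<gamma> :: "'v + 'p \<times> nat \<Rightarrow> nat"
        by (rule sum.remove) simp_all
      moreover have "(\<Sum>v\<in>UNIV - {v0}. \<alpha> (Inl v)) = (\<Sum>v\<in>UNIV - {v0}. \<beta> (Inl v))"
        by (rule sum.cong) (use other in auto)
      ultimately have v0: "\<alpha> (Inl v0) = \<beta> (Inl v0)" by simp
      have zero: "\<gamma> (Inr y) = 0" if "\<gamma> \<in> ?A" for \<gamma> y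
      proof (cases y)
        case (Pair i j)
        show ?thesis
        proof (cases "j \<le> m i")
          case True
          have "(\<Sum>j\<le>m i. \<gamma> (Inr (i, j))) = 0" using that by (simp add: bidegree_iff)
          then show ?thesis using True Pair by simp
        next
          case False
          then have "Inr y \<notin> Z" using Pair by simp
          then show ?thesis using that unfolding bidegree_iff by blast
        qed
      qed
      show "\<alpha> = \<beta>"
      proof
        fix z
        have "\<alpha> (Inl v) = \<beta> (Inl v)" for v using other v0 by (cases "v = v0") simp_all
        then show "\<alpha> z = \<beta> z" using zero[OF \<alpha>] zero[OF \<beta>] by (cases z) simp_all
      qed
    qed
    show "(\<lambda>\<alpha>. restrict (\<lambda>v. \<alpha> (Inl v)) (UNIV - {v0})) ` ?A \<subseteq> (UNIV - {v0}) \<rightarrow>\<^sub>E {..?e}"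
    proof (rule image_subsetI, rule restrict_PiE_iff[THEN iffD2], rule ballI)
      fix \<alpha> v assume "\<alpha> \<in> ?A"
      then have "(\<Sum>v\<in>UNIV. \<alpha> (Inl v)) = ?e" by (simp add: bidegree_iff)
      moreover have "\<alpha> (Inl v) \<le> (\<Sum>v\<in>UNIV. \<alpha> (Inl v))" by (rule member_le_sum) simp_all
      ultimately show "\<alpha> (Inl v) \<in> {..?e}" by simp
    qed
    show "finite ((UNIV - {v0}) \<rightarrow>\<^sub>E {..?e})" by (rule finite_PiE) simp_all
  qed
  also have "\<dots> = (1 + ?e) ^ r"
    using assms by (simp add: card_PiE)
  finally show ?thesis .
qed

text \<open>
  The family \<open>Q\<close> stands for graded submodules; a product of multipliers serves for
  finitely many elements at once.
\<close>

lemma common_multiplier: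
  assumes "finite A"
    and ex: "\<And>\<alpha>. \<alpha> \<in> A \<Longrightarrow> \<exists>n b. b \<in> rees_part 0 n \<and> b \<noteq> 0 \<and> b * \<phi> \<alpha> \<in> Q n"
    and Q: "\<And>n n' b h. b \<in> rees_part 0 n' \<Longrightarrow> h \<in> Q n \<Longrightarrow> b * h \<in> Q (\<lambda>i. n' i + n i)"
  shows "\<exists>n b. b \<in> rees_part 0 n \<and> b \<noteq> 0 \<and> (\<forall>\<alpha>\<in>A. b * \<phi> \<alpha> \<in> Q n)"
  using assms(1) ex
proof (induction A rule: finite_induct)
  case empty
  show ?case using exists_nonzero_in_fiber by simp
next
  case (insert \<alpha> A)
  have "\<exists>n b. b \<in> rees_part 0 n \<and> b \<noteq> 0 \<and> (\<forall>\<alpha>\<in>A. b * \<phi> \<alpha> \<in> Q n)"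
    by (rule insert.IH) (rule insert.prems, simp)
  then obtain n b where b: "b \<in> rees_part 0 n" "b \<noteq> 0" "\<forall>\<alpha>\<in>A. b * \<phi> \<alpha> \<in> Q n" by (elim exE conjE)
  have "\<exists>n b. b \<in> rees_part 0 n \<and> b \<noteq> 0 \<and> b * \<phi> \<alpha> \<in> Q n" by (rule insert.prems) simp
  then obtain n' b' where b': "b' \<in> rees_part 0 n'" "b' \<noteq> 0" "b' * \<phi> \<alpha> \<in> Q n'" by (elim exE conjE)
  have "b' * b * \<phi> \<gamma> \<in> Q (\<lambda>i. n' i + n i)" if "\<gamma> \<in> insert \<alpha> A" for \<gamma>
  proof (cases "\<gamma> = \<alpha>")
    case True
    have "b * (b' * \<phi> \<alpha>) \<in> Q (\<lambda>i. n i + n' i)" by (rule Q[OF b(1) b'(3)])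
    then show ?thesis using True by (simp add: mult_ac add.commute)
  next
    case False
    then have "b' * (b * \<phi> \<gamma>) \<in> Q (\<lambda>i. n' i + n i)" using that by (intro Q[OF b'(1) b(3)[THEN bspec]]) simp
    then show ?thesis by (simp only: mult.assoc)
  qed
  then show ?case
    using rees_part_fiber_mult[OF b'(1) b(1)] b(2) b'(2)
    by (intro exI[of _ "\<lambda>i. n' i + n i"] exI[of _ "b' * b"]) simp
qed

text \<open>
  The elements are \<open>a p\<^sub>i / x\<^sup>d\<close>, where \<open>a\<close> is a common
  denominator for the expansions of all forms of degree \<open>2d\<close>. The degree
  \<open>2d\<close> is large enough to absorb both \<open>p\<^sub>i\<close> and the test forms of
  degree \<open>d\<close>.
\<close>

theorem independent_saturated_elements:
  assumes fin: "generically_finite m f" and D: "D = map_degree m f"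
  shows "\<exists>c g. (\<forall>i<D. g i \<in> saturated_fiber c) \<and>
    (\<forall>n q. (\<forall>i<D. q i \<in> rees_part 0 n) \<longrightarrow> (\<Sum>i<D. q i * g i) = 0 \<longrightarrow> (\<forall>i<D. q i = 0))"
proof -
  fix v :: 'v
  let ?x = "Var v :: ('v, 'k) mpol"
  obtain d p where p0: "\<forall>i<D. homogeneous d (p i)"
    and ind0: "\<forall>n q. (\<forall>i<D. q i \<in> rees_part 0 n) \<longrightarrow> (\<Sum>i<D. q i * p i) = 0 \<longrightarrow> (\<forall>i<D. q i = 0)"
    and span0: "\<forall>e u. homogeneous e u \<longrightarrow> (\<exists>n b c. b \<in> rees_part 0 n \<and> b \<noteq> 0 \<and> (\<forall>i<D. c i \<in> rees_part 0 n) \<and>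
        b * u * ?x ^ d = ?x ^ e * (\<Sum>i<D. c i * p i))"
    using basis_of_forms[OF fin D, of v] by (elim exE conjE)
  note p = p0[THEN spec, THEN mp] and span = span0[THEN spec, THEN spec, THEN mp]
  note ind = ind0[THEN spec, THEN spec, THEN mp, THEN mp]
  let ?Q = "\<lambda>n. (*) (?x ^ d) ` rees_part d n"
  have "\<exists>n b. b \<in> rees_part 0 n \<and> b \<noteq> 0 \<and> (\<forall>\<alpha>\<in>bidegree (d + d) (\<lambda>_. 0). b * generator_monomial \<alpha> \<in> ?Q n)"
  proof (rule common_multiplier)
    fix \<alpha> assume "\<alpha> \<in> bidegree (d + d) (\<lambda>_. 0)"
    from homogeneous_generator_monomial[OF this] have "homogeneous (d + d) (generator_monomial \<alpha>)" by simp
    from span[OF this] obtain n b c where *: "b \<in> rees_part 0 n" "b \<noteq> 0" "\<forall>i<D. c i \<in> rees_part 0 n"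
      "b * generator_monomial \<alpha> * ?x ^ d = ?x ^ (d + d) * (\<Sum>i<D. c i * p i)" by (elim exE conjE)
    have "?x ^ d * (b * generator_monomial \<alpha>) = ?x ^ d * (?x ^ d * (\<Sum>i<D. c i * p i))"
      using *(4) by (simp only: power_add mult_ac)
    then have "b * generator_monomial \<alpha> = ?x ^ d * (\<Sum>i<D. c i * p i)"
      using Var_nonzero[of v] by simp
    moreover have "(\<Sum>i<D. p i * c i) \<in> rees_part (d + 0) n"
      by (intro rees_part_sum rees_part_mult_homogeneous p) (use *(3) in simp_all)
    then have "(\<Sum>i<D. c i * p i) \<in> rees_part d n" by (simp add: mult.commute)
    ultimately have "b * generator_monomial \<alpha> \<in> ?Q n" by (rule image_eqI)
    with *(1,2) show "\<exists>n b. b \<in> rees_part 0 n \<and> b \<noteq> 0 \<and> b * generator_monomial \<alpha> \<in> ?Q n"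
      by (intro exI conjI)
  next
    fix n n' b h assume b: "b \<in> rees_part 0 n'" and "h \<in> ?Q n"
    then obtain a where a: "a \<in> rees_part d n" "h = ?x ^ d * a" by (elim imageE)
    have "b * a \<in> rees_part d (\<lambda>i. n' i + n i)" using rees_part_mult[OF b a(1)] by simp
    then show "b * h \<in> ?Q (\<lambda>i. n' i + n i)"
      by (rule image_eqI[rotated]) (simp only: a(2) mult.left_commute)
  qed simp
  then obtain c a where a: "a \<in> rees_part 0 c" "a \<noteq> 0"
    "\<forall>\<alpha>\<in>bidegree (d + d) (\<lambda>_. 0). a * generator_monomial \<alpha> \<in> ?Q c" by (elim exE conjE)
  have aQ: "a * u \<in> ?Q c" if "homogeneous (d + d) u" for u
  proof -
    have "rees_part (d + d) (\<lambda>_. 0) \<subseteq> {u. a * u \<in> ?Q c}"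
      unfolding rees_part_def[of "d + d"]
      by (rule kvs.span_minimal[OF image_subsetI subspace_preimage_mult[OF subspace_image_mult[OF subspace_rees_part]]])
        (rule CollectI, erule a(3)[THEN bspec])
    then show ?thesis using that unfolding rees_part_of_homogeneous[symmetric] by blast
  qed
  \<comment> \<open>a second variable is coprime to \<open>x\<close>; over \<open>\<P>\<^sup>0\<close> every form is a multiple of a power of \<open>x\<close>\<close>
  have dvd: "?x ^ d dvd a * p i" if i: "i < D" for i
  proof (cases "\<exists>v'. v' \<noteq> v")
    case True
    then obtain v' where v': "v' \<noteq> v" by blast
    have "a * (p i * Var v' ^ d) \<in> ?Q c"
      by (rule aQ, rule homogeneous_mult[OF p[OF i] homogeneous_Var_power])
    then obtain h where "a * (p i * Var v' ^ d) = ?x ^ d * h" by (rule imageE)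
    then have "Var v' ^ d * (a * p i) = ?x ^ d * h" by (simp only: mult_ac)
    then have "?x ^ d dvd Var v' ^ d * (a * p i)" by (rule dvdI)
    then show ?thesis by (rule Var_power_dvd_of_dvd_mult[OF _ v'])
  next
    case False
    then have "?x ^ d dvd p i" by (intro Var_power_dvd_homogeneous p[OF i]) blast
    then show ?thesis by (rule dvd_mult)
  qed
  then have "\<forall>i\<in>{..<D}. \<exists>h. a * p i = ?x ^ d * h" by (auto elim: dvdE)
  then obtain g where "\<forall>i\<in>{..<D}. a * p i = ?x ^ d * g i" by (rule bchoice[THEN exE])
  then have g: "\<And>i. i < D \<Longrightarrow> a * p i = ?x ^ d * g i" by simp
  have "g i \<in> saturated_fiber c" if i: "i < D" for i
    unfolding saturated_special_fiber_iff
  proof (intro conjI exI[of _ d] allI impI)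
    have "homogeneous (d + (\<Sum>i\<in>UNIV. c i * \<delta> i)) (a * p i)"
      using homogeneous_mult[OF p[OF i] homogeneous_rees_part[OF a(1)]] by (simp add: mult.commute)
    then show "homogeneous (\<Sum>i\<in>UNIV. c i * \<delta> i) (g i)"
      unfolding g[OF i] by (rule homogeneous_of_Var_power_mult)
    fix u :: "('v, 'k) mpol" assume "homogeneous d u"
    then have "a * (p i * u) \<in> ?Q c" by (intro aQ homogeneous_mult[OF p[OF i]])
    then obtain h where h: "h \<in> rees_part d c" "a * (p i * u) = ?x ^ d * h" by (elim imageE)
    have "a * (p i * u) = a * p i * u" by (simp only: mult.assoc)
    also have "\<dots> = ?x ^ d * (u * g i)" unfolding g[OF i] by (simp only: mult_ac)
    finally have e: "a * (p i * u) = ?x ^ d * (u * g i)" .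
    have "?x ^ d * (u * g i) = ?x ^ d * h" by (simp only: e[symmetric] h(2))
    then have "u * g i = h" using Var_nonzero[of v] by simp
    then show "u * g i \<in> rees_part d c" using h(1) by simp
  qed
  moreover have "q i = 0" if q: "\<forall>i<D. q i \<in> rees_part 0 n" "(\<Sum>i<D. q i * g i) = 0" and i: "i < D" for n q i
  proof -
    have "(\<Sum>i<D. (q i * a) * p i) = (\<Sum>i<D. ?x ^ d * (q i * g i))"
      by (rule sum.cong[OF refl]) (use g in \<open>simp add: mult.assoc mult.left_commute\<close>)
    also have "\<dots> = 0" using q(2) by (simp flip: sum_distrib_left)
    finally have "(\<Sum>i<D. (q i * a) * p i) = 0" .
    moreover have "\<forall>i<D. q i * a \<in> rees_part 0 (\<lambda>i. n i + c i)"
      using q(1) rees_part_fiber_mult[OF _ a(1)] by simp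
    ultimately have "\<forall>i<D. q i * a = 0" by (intro ind)
    then show ?thesis using i a(2) by simp
  qed
  ultimately show ?thesis by (intro exI[of _ c] exI[of _ g] conjI allI impI) simp_all
qed

lemma fiber_finite_dimensional:
  "rees_part 0 n \<subseteq> kvs.span (generator_monomial ` bidegree 0 n)"
  by (simp add: rees_part_def)

text \<open>
  The \<open>D\<close> independent elements span a free module of rank \<open>D\<close>.
\<close>

theorem saturated_hilbert_function_lower_bound:
  assumes "generically_finite m f" "D = map_degree m f"
  shows "\<exists>c. \<forall>n. D * kdim (special_fiber m \<delta> f n) \<le> kdim (saturated_fiber (\<lambda>i. n i + c i))"
proof -
  obtain c g where g0: "\<forall>i<D. g i \<in> saturated_fiber c"
    and ind0: "\<forall>n q. (\<forall>i<D. q i \<in> rees_part 0 n) \<longrightarrow> (\<Sum>i<D. q i * g i) = 0 \<longrightarrow> (\<forall>i<D. q i = 0)"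
    using independent_saturated_elements[OF assms] by (elim exE conjE)
  note g = g0[THEN spec, THEN mp] and ind = ind0[THEN spec, THEN spec, THEN mp, THEN mp]
  have "D * kdim (special_fiber m \<delta> f n) \<le> kdim (saturated_fiber (\<lambda>i. n i + c i))" for n
  proof -
    obtain B where B: "finite B" "kvs.independent B" "kvs.span B = rees_part 0 n" "kvs.dim (rees_part 0 n) = card B"
      by (rule kvs.finite_basis_of_subspace[OF finite_imageI[OF finite_bidegree] subspace_rees_part fiber_finite_dimensional])
    let ?I = "{..<D} \<times> B"
    have B': "b \<in> rees_part 0 n" if "b \<in> B" for b using B(3) kvs.span_base[OF that] by simp
    have "card ?I \<le> kvs.dim (saturated_fiber (\<lambda>i. n i + c i))"
    proof (rule kvs.card_le_dim_of_independent_family[where w = "\<lambda>(i, b). b * g i"])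
      show "finite ?I" using B(1) by simp
      show "(\<lambda>(i, b). b * g i) ` ?I \<subseteq> saturated_fiber (\<lambda>i. n i + c i)"
        using saturated_fiber_mult_fiber[OF B' g] by auto
      fix k assume "(\<Sum>y\<in>?I. Const (k y) * (case y of (i, b) \<Rightarrow> b * g i)) = 0"
      then have "(\<Sum>i<D. \<Sum>b\<in>B. Const (k (i, b)) * (b * g i)) = 0"
        by (simp add: sum.cartesian_product case_prod_beta)
      then have "(\<Sum>i<D. (\<Sum>b\<in>B. Const (k (i, b)) * b) * g i) = 0"
        by (simp add: sum_distrib_right mult.assoc)
      moreover have "\<forall>i<D. (\<Sum>b\<in>B. Const (k (i, b)) * b) \<in> rees_part 0 n"
        by (intro allI impI rees_part_sum rees_part_scale B')
      ultimately have "\<forall>i<D. (\<Sum>b\<in>B. Const (k (i, b)) * b) = 0" by (intro ind)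
      then have "k (i, b) = 0" if "i < D" "b \<in> B" for i b
        using kvs.independentD[OF B(2,1) subset_refl, of "\<lambda>b. k (i, b)" b] that by simp
      then show "\<forall>y\<in>?I. k y = 0" by auto
    qed (rule subspace_saturated_fiber, rule finite_imageI[OF finite_bidegree], rule saturated_fiber_finite_dimensional)
    then show ?thesis using B(4) by (simp add: kdim_alt special_fiber_eq card_cartesian_product)
  qed
  then show ?thesis by blast
qed

text \<open>
  Let \<open>b\<close> be a common denominator for the expansions of the forms of degree
  \<open>E\<close>. Then \<open>b x\<^sup>d g\<close> is a combination of the
  \<open>p\<^sub>i\<close> with coefficients in the fiber ring, for every saturated
  \<open>g\<close>.
\<close>

theorem saturated_hilbert_function_upper_bound:
  assumes fin: "generically_finite m f" and D: "D = map_degree m f"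
  shows "\<exists>c. \<forall>n. kdim (saturated_fiber n) \<le> D * kdim (special_fiber m \<delta> f (\<lambda>i. n i + c i))"
proof -
  fix v :: 'v
  let ?x = "Var v :: ('v, 'k) mpol"
  obtain d p where p0: "\<forall>i<D. homogeneous d (p i)"
    and span0: "\<forall>e u. homogeneous e u \<longrightarrow> (\<exists>n b c. b \<in> rees_part 0 n \<and> b \<noteq> 0 \<and> (\<forall>i<D. c i \<in> rees_part 0 n) \<and>
        b * u * ?x ^ d = ?x ^ e * (\<Sum>i<D. c i * p i))"
    using basis_of_forms[OF fin D, of v] by (elim exE conjE)
  note p = p0[THEN spec, THEN mp] and span = span0[THEN spec, THEN spec, THEN mp]
  from uniform_saturation[of v]
  obtain E where E: "\<forall>n g. g \<in> saturated_fiber n \<longrightarrow> ?x ^ E * g \<in> rees_part E n" by (rule exE)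
  define W where "W n = {\<Sum>i<D. c i * p i | c. \<forall>i<D. c i \<in> rees_part 0 n}" for n
  have W_I: "(\<Sum>i<D. c i * p i) \<in> W n" if "\<forall>i<D. c i \<in> rees_part 0 n" for c n
    unfolding W_def using that by blast
  have W_E: "\<exists>c. (\<forall>i<D. c i \<in> rees_part 0 n) \<and> w = (\<Sum>i<D. c i * p i)" if "w \<in> W n" for w n
    using that unfolding W_def by blast
  have W_mult: "b * h \<in> W (\<lambda>i. n' i + n i)" if b: "b \<in> rees_part 0 n'" and h: "h \<in> W n" for b h n n'
  proof -
    obtain c where c: "\<forall>i<D. c i \<in> rees_part 0 n" "h = (\<Sum>i<D. c i * p i)" using W_E[OF h] by (elim exE conjE)
    have "b * h = (\<Sum>i<D. (b * c i) * p i)" by (simp add: c(2) sum_distrib_left mult.assoc)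
    then show ?thesis using W_I[of "\<lambda>i. b * c i"] rees_part_fiber_mult[OF b] c(1) by simp
  qed
  have W_sub: "kvs.subspace (W n)" for n
  proof (rule kvs.subspaceI)
    show "0 \<in> W n" using W_I[of "\<lambda>_. 0" n] by simp
    show "Const k * w \<in> W n" if "w \<in> W n" for k w
    proof -
      obtain c where c: "\<forall>i<D. c i \<in> rees_part 0 n" "w = (\<Sum>i<D. c i * p i)" using W_E[OF \<open>w \<in> W n\<close>] by (elim exE conjE)
      have "Const k * w = (\<Sum>i<D. (Const k * c i) * p i)" by (simp add: c(2) sum_distrib_left mult.assoc)
      then show ?thesis using W_I[of "\<lambda>i. Const k * c i"] rees_part_scale c(1) by simp
    qed
    fix w w' assume w: "w \<in> W n" and w': "w' \<in> W n"
    obtain c where c: "\<forall>i<D. c i \<in> rees_part 0 n" "w = (\<Sum>i<D. c i * p i)" using W_E[OF w] by (elim exE conjE)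
    obtain c' where c': "\<forall>i<D. c' i \<in> rees_part 0 n" "w' = (\<Sum>i<D. c' i * p i)" using W_E[OF w'] by (elim exE conjE)
    have "w + w' = (\<Sum>i<D. (c i + c' i) * p i)" by (simp add: c(2) c'(2) sum.distrib distrib_right)
    then show "w + w' \<in> W n" using W_I[of "\<lambda>i. c i + c' i"] rees_part_add c(1) c'(1) by simp
  qed
  let ?Q = "\<lambda>n. (*) (?x ^ E) ` W n"
  have Q_mult: "b * h \<in> ?Q (\<lambda>i. n' i + n i)" if "b \<in> rees_part 0 n'" "h \<in> ?Q n" for b h n n'
  proof -
    from that(2) obtain w where w: "w \<in> W n" "h = ?x ^ E * w" by (elim imageE)
    show ?thesis using W_mult[OF that(1) w(1)]
      by (rule image_eqI[rotated]) (simp only: w(2) mult.left_commute)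
  qed
  have "\<exists>n b. b \<in> rees_part 0 n \<and> b \<noteq> 0 \<and> (\<forall>\<alpha>\<in>bidegree E (\<lambda>_. 0). b * (generator_monomial \<alpha> * ?x ^ d) \<in> ?Q n)"
  proof (rule common_multiplier)
    fix \<alpha> assume "\<alpha> \<in> bidegree E (\<lambda>_. 0)"
    from homogeneous_generator_monomial[OF this] have "homogeneous E (generator_monomial \<alpha>)" by simp
    from span[OF this] obtain n b c where *: "b \<in> rees_part 0 n" "b \<noteq> 0" "\<forall>i<D. c i \<in> rees_part 0 n"
      "b * generator_monomial \<alpha> * ?x ^ d = ?x ^ E * (\<Sum>i<D. c i * p i)" by (elim exE conjE)
    have "b * (generator_monomial \<alpha> * ?x ^ d) \<in> ?Q n"
      by (rule image_eqI[OF _ W_I[OF *(3)]]) (simp only: *(4) mult.assoc[symmetric])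
    with *(1,2) show "\<exists>n b. b \<in> rees_part 0 n \<and> b \<noteq> 0 \<and> b * (generator_monomial \<alpha> * ?x ^ d) \<in> ?Q n"
      by (intro exI conjI)
  qed (rule finite_bidegree, rule Q_mult)
  then obtain c b where b: "b \<in> rees_part 0 c" "b \<noteq> 0"
    "\<forall>\<alpha>\<in>bidegree E (\<lambda>_. 0). b * (generator_monomial \<alpha> * ?x ^ d) \<in> ?Q c" by (elim exE conjE)
  have mem: "b * ?x ^ d * g \<in> W (\<lambda>i. n i + c i)" if g: "g \<in> saturated_fiber n" for g n
  proof -
    have "rees_part E n \<subseteq> {h. b * ?x ^ d * h \<in> ?Q (\<lambda>i. n i + c i)}"
      unfolding rees_part_def[of E]
    proof (rule kvs.span_minimal[OF image_subsetI subspace_preimage_mult[OF subspace_image_mult[OF W_sub]]])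
      fix \<gamma> assume "\<gamma> \<in> bidegree E n"
      then have "\<gamma> \<in> bidegree (E + 0) n" by simp
      then obtain \<alpha> \<beta> where *: "\<alpha> \<in> bidegree E (\<lambda>_. 0)" "\<beta> \<in> bidegree 0 n" "\<gamma> = (\<lambda>z. \<alpha> z + \<beta> z)"
        by (rule bidegree_split)
      have mem: "generator_monomial \<beta> * (b * (generator_monomial \<alpha> * ?x ^ d)) \<in> ?Q (\<lambda>i. n i + c i)"
        by (rule Q_mult[OF rees_part_base[OF *(2)] b(3)[THEN bspec, OF *(1)]])
      have eq: "b * ?x ^ d * generator_monomial \<gamma> = generator_monomial \<beta> * (b * (generator_monomial \<alpha> * ?x ^ d))"
        unfolding *(3) generator_monomial_add by (simp only: mult_ac)
      show "generator_monomial \<gamma> \<in> {h. b * ?x ^ d * h \<in> ?Q (\<lambda>i. n i + c i)}"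
        by (rule CollectI) (simp only: eq mem)
    qed
    then have "b * ?x ^ d * (?x ^ E * g) \<in> ?Q (\<lambda>i. n i + c i)" using E g by blast
    then obtain w where w: "w \<in> W (\<lambda>i. n i + c i)" "b * ?x ^ d * (?x ^ E * g) = ?x ^ E * w" by (elim imageE)
    have "?x ^ E * (b * ?x ^ d * g) = ?x ^ E * w" using w(2) by (simp only: mult_ac)
    then have "b * ?x ^ d * g = w" using Var_nonzero[of v] by simp
    then show ?thesis using w(1) by simp
  qed
  have "kdim (saturated_fiber n) \<le> D * kdim (special_fiber m \<delta> f (\<lambda>i. n i + c i))" for n
  proof -
    let ?n = "\<lambda>i. n i + c i"
    obtain B where B: "finite B" "kvs.independent B" "kvs.span B = rees_part 0 ?n" "kvs.dim (rees_part 0 ?n) = card B"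
      by (rule kvs.finite_basis_of_subspace[OF finite_imageI[OF finite_bidegree] subspace_rees_part fiber_finite_dimensional])
    let ?S = "(\<lambda>(i, b). p i * b) ` ({..<D} \<times> B)"
    have W_span: "W ?n \<subseteq> kvs.span ?S"
    proof
      fix w assume "w \<in> W ?n"
      then obtain k where k: "\<forall>i<D. k i \<in> rees_part 0 ?n" "w = (\<Sum>i<D. k i * p i)" using W_E by blast
      have "p i * k i \<in> kvs.span ?S" if i: "i < D" for i
      proof -
        have "kvs.span B \<subseteq> {h. p i * h \<in> kvs.span ?S}"
        proof (rule kvs.span_minimal[OF _ subspace_preimage_mult[OF kvs.subspace_span]], rule subsetI)
          fix h assume "h \<in> B"
          then have "p i * h \<in> ?S" using i by (intro image_eqI[of _ _ "(i, h)"]) simp_all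
          then show "h \<in> {h. p i * h \<in> kvs.span ?S}" by (simp add: kvs.span_base)
        qed
        then show ?thesis using k(1) i B(3) by blast
      qed
      then have "(\<Sum>i<D. p i * k i) \<in> kvs.span ?S" by (intro kvs.span_sum) simp
      then show "w \<in> kvs.span ?S" by (simp add: k(2) mult.commute)
    qed
    have "b * ?x ^ d \<noteq> 0" using b(2) Var_nonzero[of v] by simp
    then have "kdim (saturated_fiber n) = kdim ((*) (b * ?x ^ d) ` saturated_fiber n)"
      by (rule kdim_image_mult[OF _ finite_imageI[OF finite_bidegree] subspace_saturated_fiber saturated_fiber_finite_dimensional, symmetric])
    also have "\<dots> \<le> card ?S"
      unfolding kdim_alt
    proof (rule kvs.dim_le_card)
      show "(*) (b * ?x ^ d) ` saturated_fiber n \<subseteq> kvs.span ?S"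
        using mem W_span by blast
      show "finite ?S" using B(1) by simp
    qed
    also have "\<dots> \<le> card ({..<D} \<times> B)" by (rule card_image_le) (use B(1) in simp)
    also have "\<dots> = D * kdim (special_fiber m \<delta> f ?n)"
      by (simp add: card_cartesian_product kdim_alt special_fiber_eq B(4))
    finally show ?thesis .
  qed
  then show ?thesis by blast
qed

theorem mixed_multiplicity_saturated:
  assumes card: "card (UNIV :: 'v set) = r + 1" and fin: "generically_finite m f" and d: "(\<Sum>i\<in>UNIV. d i) = r"
  shows "mixed_multiplicity d (saturated_special_fiber m \<delta> f) =
    of_nat (map_degree m f) * mixed_multiplicity d (special_fiber m \<delta> f)"
proof -
  obtain eF \<nu>0 where eF0: "finite_support eF"
    "\<forall>\<nu>. (\<forall>i. \<nu>0 i \<le> \<nu> i) \<longrightarrow> of_nat (kdim (special_fiber m \<delta> f \<nu>)) = binomial_sum eF \<nu>"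
    using eventually_polynomial_fiber unfolding eventually_polynomial_def by (elim exE conjE)
  note eF = eF0(1) eF0(2)[THEN spec, THEN mp]
  obtain eS \<nu>1 where eS0: "finite_support eS"
    "\<forall>\<nu>. (\<forall>i. \<nu>1 i \<le> \<nu> i) \<longrightarrow> of_nat (kdim (saturated_fiber \<nu>)) = binomial_sum eS \<nu>"
    using eventually_polynomial_saturated_fiber unfolding eventually_polynomial_def by (elim exE conjE)
  note eS = eS0(1) eS0(2)[THEN spec, THEN mp]
  obtain a where a: "\<forall>n. map_degree m f * kdim (special_fiber m \<delta> f n) \<le> kdim (saturated_fiber (\<lambda>i. n i + a i))"
    using saturated_hilbert_function_lower_bound[OF fin refl] by (rule exE)
  obtain b where b: "\<forall>n. kdim (saturated_fiber n) \<le> map_degree m f * kdim (special_fiber m \<delta> f (\<lambda>i. n i + b i))"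
    using saturated_hilbert_function_upper_bound[OF fin refl] by (rule exE)
  have "eS d = of_nat (map_degree m f) * eF d"
    by (rule leading_coefficients_proportional[where hF = "\<lambda>n. kdim (special_fiber m \<delta> f n)"
          and hS = "\<lambda>n. kdim (saturated_fiber n)" and \<delta> = \<delta> and a = a and b = b,
          OF eF eS kdim_fiber_le[OF card] a[THEN spec] b[THEN spec] d])
  moreover have "mixed_multiplicity d (special_fiber m \<delta> f) = eF d"
    by (rule mixed_multiplicity_eqI[OF eF(1)]) (erule eF(2))
  moreover have "mixed_multiplicity d (saturated_special_fiber m \<delta> f) = eS d"
    by (rule mixed_multiplicity_eqI[OF eS(1)]) (erule eS(2))
  ultimately show ?thesis by simp
qed

section \<open>Birationality\<close>

text \<open>An empty basis could not represent the element \<open>1\<close>.\<close>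

lemma map_degree_pos:
  assumes "generically_finite m f" shows "0 < map_degree m f"
proof (rule ccontr)
  fix v :: 'v
  assume "\<not> 0 < map_degree m f"
  then have D: "map_degree m f = 0" by simp
  obtain d p where
    span: "\<forall>e u. homogeneous e u \<longrightarrow> (\<exists>n b c. b \<in> rees_part 0 n \<and> b \<noteq> 0 \<and> (\<forall>i<0. c i \<in> rees_part 0 n) \<and>
        b * u * Var v ^ d = Var v ^ e * (\<Sum>i<0. c i * (p :: nat \<Rightarrow> ('v, 'k) mpol) i))"
    using basis_of_forms[OF assms D[symmetric], of v] by (elim exE conjE)
  obtain b where "b \<noteq> 0" "b * 1 * Var v ^ d = (0 :: ('v, 'k) mpol)"
    using span[THEN spec, THEN spec, THEN mp, OF homogeneous_1] by (elim exE conjE) simp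
  then show False by (simp add: Var_nonzero)
qed

text \<open>
  Compare the expansions of \<open>g\<close> and of a nonzero element \<open>a\<close> of the same
  degree in the one-element basis.
\<close>

lemma fraction_of_saturated_element:
  assumes fin: "generically_finite m f" and D: "map_degree m f = 1" and g: "g \<in> saturated_fiber n"
  shows "\<exists>n' a b c. a \<in> rees_part 0 n \<and> b \<in> rees_part 0 n' \<and> c \<in> rees_part 0 n' \<and> c \<noteq> 0 \<and> g * c = a * b"
proof -
  fix v :: 'v
  let ?x = "Var v :: ('v, 'k) mpol" and ?e = "\<Sum>i\<in>UNIV. n i * \<delta> i"
  obtain d p where
    span: "\<forall>e u. homogeneous e u \<longrightarrow> (\<exists>n b c. b \<in> rees_part 0 n \<and> b \<noteq> 0 \<and> (\<forall>i<1. c i \<in> rees_part 0 n) \<and>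
        b * u * ?x ^ d = ?x ^ e * (\<Sum>i<1. c i * (p :: nat \<Rightarrow> ('v, 'k) mpol) i))"
    using basis_of_forms[OF fin D[symmetric], of v] by (elim exE conjE)
  \<comment> \<open>the only basis element is \<open>p 0\<close>\<close>
  have span1: "\<exists>n b c. b \<in> rees_part 0 n \<and> b \<noteq> 0 \<and> c \<in> rees_part 0 n \<and> b * u * ?x ^ d = ?x ^ e * (c * p 0)"
    if u: "homogeneous e u" for e u
  proof -
    obtain n b c where "b \<in> rees_part 0 n" "b \<noteq> 0" "\<forall>i<1. c i \<in> rees_part 0 n"
      "b * u * ?x ^ d = ?x ^ e * (\<Sum>i<1. c i * p i)"
      using span[THEN spec, THEN spec, THEN mp, OF u] by (elim exE conjE)
    then show ?thesis by (intro exI[of _ n] exI[of _ b] exI[of _ "c 0"]) simp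
  qed
  obtain a where a: "a \<in> rees_part 0 n" "a \<noteq> 0" using exists_nonzero_in_fiber by blast
  have hg: "homogeneous ?e g" using g unfolding saturated_special_fiber_iff by (rule conjunct1)
  have ha: "homogeneous ?e a" using homogeneous_rees_part[OF a(1)] by simp
  obtain n1 b1 c1 where 1: "b1 \<in> rees_part 0 n1" "b1 \<noteq> 0" "c1 \<in> rees_part 0 n1" "b1 * g * ?x ^ d = ?x ^ ?e * (c1 * p 0)"
    using span1[OF hg] by (elim exE conjE)
  obtain n2 b2 c2 where 2: "b2 \<in> rees_part 0 n2" "b2 \<noteq> 0" "c2 \<in> rees_part 0 n2" "b2 * a * ?x ^ d = ?x ^ ?e * (c2 * p 0)"
    using span1[OF ha] by (elim exE conjE)
  have "b2 * a * ?x ^ d \<noteq> 0" using 2(2) a(2) by (simp add: Var_nonzero)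
  then have c2: "c2 \<noteq> 0" unfolding 2(4) by auto
  have "?x ^ d * (g * (b1 * c2)) = c2 * (b1 * g * ?x ^ d)" by (simp only: mult_ac)
  also have "\<dots> = c1 * (?x ^ ?e * (c2 * p 0))" unfolding 1(4) by (simp only: mult_ac)
  also have "\<dots> = ?x ^ d * (a * (c1 * b2))" unfolding 2(4)[symmetric] by (simp only: mult_ac)
  finally have "?x ^ d * (g * (b1 * c2)) = ?x ^ d * (a * (c1 * b2))" .
  then have "g * (b1 * c2) = a * (c1 * b2)" using Var_nonzero[of v] by simp
  moreover have "b1 * c2 \<noteq> 0" using 1(2) c2 by simp
  ultimately show ?thesis
    using a(1) rees_part_fiber_mult[OF 1(1) 2(3)] rees_part_fiber_mult[OF 1(3) 2(1)]
    by (intro exI[of _ "\<lambda>i. n1 i + n2 i"] exI[of _ a] exI[of _ "c1 * b2"] exI[of _ "b1 * c2"] conjI)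
qed

text \<open>For a saturated element \<open>g\<close> and a variable \<open>x\<close>, one \<open>s\<close> makes all products
  \<open>x ^ s * g ^ i\<close> lie in the finitely generated module of components of degree \<open>s\<close> in
  the variables. By the ascending chain condition one of them depends on the earlier ones,
  and cancelling \<open>x ^ s\<close> gives an integral equation for \<open>g\<close>.\<close>

theorem saturated_element_integral:
  assumes g: "g \<in> saturated_fiber n"
  shows "\<exists>N a. 0 < N \<and> (\<forall>i<N. a i \<in> rees_part 0 (\<lambda>j. (N - i) * n j)) \<and> g ^ N = (\<Sum>i<N. a i * g ^ i)"
proof -
  fix v :: 'v
  let ?x = "Var v :: ('v, 'k) mpol"
  obtain s where s: "\<forall>u. homogeneous s u \<longrightarrow> u * g \<in> rees_part s n"
    using g unfolding saturated_special_fiber_iff by (elim conjE exE)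
  have step: "h * g \<in> rees_part s (\<lambda>i. n' i + n i)" if h: "h \<in> rees_part s n'" for h n'
  proof -
    have "rees_part s n' \<subseteq> {h. g * h \<in> rees_part s (\<lambda>i. n' i + n i)}"
      unfolding rees_part_def[of s n']
    proof (rule kvs.span_minimal[OF image_subsetI subspace_preimage_mult[OF subspace_rees_part]])
      fix \<gamma> assume "\<gamma> \<in> bidegree s n'"
      then have "\<gamma> \<in> bidegree (s + 0) n'" by simp
      then obtain \<alpha> \<beta> where *: "\<alpha> \<in> bidegree s (\<lambda>_. 0)" "\<beta> \<in> bidegree 0 n'" "\<gamma> = (\<lambda>z. \<alpha> z + \<beta> z)"
        by (rule bidegree_split)
      have "homogeneous s (generator_monomial \<alpha>)" using homogeneous_generator_monomial[OF *(1)] by simp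
      then have "generator_monomial \<alpha> * g \<in> rees_part s n" by (rule s[THEN spec, THEN mp])
      from rees_part_mult[OF rees_part_base[OF *(2)] this]
      have mem: "generator_monomial \<beta> * (generator_monomial \<alpha> * g) \<in> rees_part s (\<lambda>i. n' i + n i)" by simp
      have eq: "g * generator_monomial \<gamma> = generator_monomial \<beta> * (generator_monomial \<alpha> * g)"
        unfolding *(3) generator_monomial_add by (simp only: mult_ac)
      show "generator_monomial \<gamma> \<in> {h. g * h \<in> rees_part s (\<lambda>i. n' i + n i)}"
        by (rule CollectI) (simp only: eq mem)
    qed
    then have "g * h \<in> rees_part s (\<lambda>i. n' i + n i)" using h by blast
    then show ?thesis by (simp only: mult.commute)
  qed
  have powers: "?x ^ s * g ^ i \<in> rees_part s (\<lambda>j. i * n j)" for i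
  proof (induction i)
    case 0
    have "?x ^ s \<in> rees_part s (\<lambda>_. 0)" unfolding rees_part_of_homogeneous by (rule homogeneous_Var_power)
    then show ?case by simp
  next
    case (Suc i)
    from step[OF Suc] have "?x ^ s * g ^ i * g \<in> rees_part s (\<lambda>j. i * n j + n j)" .
    moreover have "(\<lambda>j. i * n j + n j) = (\<lambda>j. Suc i * n j)" by (simp add: add.commute)
    moreover have "?x ^ s * g ^ i * g = ?x ^ s * g ^ Suc i" by (simp only: power_Suc mult_ac)
    ultimately show ?case by simp
  qed
  let ?F = "\<lambda>i. (s, \<lambda>j. i * n j, ?x ^ s * g ^ i)"
  have "\<exists>G0. finite G0 \<and> G0 \<subseteq> range ?F \<and> (\<forall>e n g. (e, n, g) \<in> range ?F \<longrightarrow> g \<in> generated G0 e n)"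
  proof (rule finitely_generated)
    fix e' n' g' assume "(e', n', g') \<in> range ?F"
    then obtain i where "e' = s" "n' = (\<lambda>j. i * n j)" "g' = ?x ^ s * g ^ i" by auto
    then show "g' \<in> rees_part e' n'" using powers by simp
  qed
  then obtain G0 where G0: "finite G0" "G0 \<subseteq> range ?F" "\<forall>e n g. (e, n, g) \<in> range ?F \<longrightarrow> g \<in> generated G0 e n"
    by (elim exE conjE)
  obtain I where I: "finite I" "G0 = ?F ` I"
    using finite_subset_image[OF G0(1,2)] by (elim exE conjE)
  obtain N where N: "\<forall>i\<in>I. i < N" using I(1) finite_nat_set_iff_bounded by blast
  define S where "S = {\<Sum>i<N. a i * g ^ i | a. \<forall>i<N. a i \<in> rees_part 0 (\<lambda>j. (N - i) * n j)}"
  have S_I: "(\<Sum>i<N. a i * g ^ i) \<in> S" if "\<forall>i<N. a i \<in> rees_part 0 (\<lambda>j. (N - i) * n j)" for a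
    unfolding S_def using that by blast
  have S_E: "\<exists>a. (\<forall>i<N. a i \<in> rees_part 0 (\<lambda>j. (N - i) * n j)) \<and> w = (\<Sum>i<N. a i * g ^ i)" if "w \<in> S" for w
    using that unfolding S_def by blast
  have sub: "kvs.subspace S"
  proof (rule kvs.subspaceI)
    show "0 \<in> S" using S_I[of "\<lambda>_. 0"] by simp
    show "Const k * w \<in> S" if "w \<in> S" for k w
    proof -
      obtain a where a: "\<forall>i<N. a i \<in> rees_part 0 (\<lambda>j. (N - i) * n j)" "w = (\<Sum>i<N. a i * g ^ i)"
        using S_E[OF \<open>w \<in> S\<close>] by (elim exE conjE)
      have "Const k * w = (\<Sum>i<N. (Const k * a i) * g ^ i)" by (simp add: a(2) sum_distrib_left mult.assoc)
      then show ?thesis using S_I[of "\<lambda>i. Const k * a i"] rees_part_scale a(1) by simp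
    qed
    fix w w' assume w: "w \<in> S" and w': "w' \<in> S"
    obtain a where a: "\<forall>i<N. a i \<in> rees_part 0 (\<lambda>j. (N - i) * n j)" "w = (\<Sum>i<N. a i * g ^ i)"
      using S_E[OF w] by (elim exE conjE)
    obtain a' where a': "\<forall>i<N. a' i \<in> rees_part 0 (\<lambda>j. (N - i) * n j)" "w' = (\<Sum>i<N. a' i * g ^ i)"
      using S_E[OF w'] by (elim exE conjE)
    have "w + w' = (\<Sum>i<N. (a i + a' i) * g ^ i)" by (simp add: a(2) a'(2) sum.distrib distrib_right)
    then show "w + w' \<in> S" using S_I[of "\<lambda>i. a i + a' i"] rees_part_add a(1) a'(1) by simp
  qed
  have "(s, \<lambda>j. N * n j, ?x ^ s * g ^ N) \<in> range ?F" by (rule range_eqI[of _ _ N]) simp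
  then have "?x ^ s * g ^ N \<in> generated G0 s (\<lambda>j. N * n j)" using G0(3) by blast
  then have "?x ^ s * g ^ N \<in> (*) (?x ^ s) ` S"
  proof (rule generated_least[OF _ subspace_image_mult[OF sub]])
    fix \<beta> h e' n' e0 n0
    assume *: "(e0, n0, h) \<in> G0" "\<beta> \<in> bidegree e' n'" "s = e' + e0" "(\<lambda>j. N * n j) = (\<lambda>j. n' j + n0 j)"
    obtain i where i: "i \<in> I" "e0 = s" "n0 = (\<lambda>j. i * n j)" "h = ?x ^ s * g ^ i"
      using *(1) unfolding I(2) by auto
    have iN: "i < N" using N i(1) by blast
    \<comment> \<open>all the generators have first degree \<open>s\<close>, so the cofactors are products of the given forms alone\<close>
    have "e' = 0" using *(3) i(2) by simp
    have "n' j = (N - i) * n j" for j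
      using fun_cong[OF *(4), of j] i(3) by (simp add: diff_mult_distrib)
    then have "n' = (\<lambda>j. (N - i) * n j)" by (rule ext)
    then have \<beta>: "generator_monomial \<beta> \<in> rees_part 0 (\<lambda>j. (N - i) * n j)"
      using rees_part_base[OF *(2)] \<open>e' = 0\<close> by simp
    let ?a = "\<lambda>k. if k = i then generator_monomial \<beta> else 0"
    have "(\<Sum>k<N. ?a k * g ^ k) = (\<Sum>k<N. if k = i then generator_monomial \<beta> * g ^ i else 0)"
      by (rule sum.cong) auto
    also have "\<dots> = generator_monomial \<beta> * g ^ i" using iN by simp
    finally have "generator_monomial \<beta> * g ^ i \<in> S" using S_I[of ?a] \<beta> by simp
    then show "generator_monomial \<beta> * h \<in> (*) (?x ^ s) ` S"
      by (rule image_eqI[rotated]) (simp only: i(4) mult.left_commute)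
  qed
  then obtain w where w: "w \<in> S" "?x ^ s * g ^ N = ?x ^ s * w" by (elim imageE)
  then have "g ^ N = w" using Var_nonzero[of v] by simp
  then obtain a where a: "\<forall>i<N. a i \<in> rees_part 0 (\<lambda>j. (N - i) * n j)" "g ^ N = (\<Sum>i<N. a i * g ^ i)"
    using S_E[OF w(1)] by (elim exE conjE) simp
  have "0 < N"
  proof (rule ccontr)
    assume "\<not> 0 < N"
    then show False using a(2) by simp
  qed
  then show ?thesis using a by (intro exI conjI)
qed

text \<open>
  The exponent of \<open>T\<^sup>n\<close> in \<open>R[T\<^sub>1, \<dots>, T\<^sub>p]\<close>.
\<close>

definition degree_exponent :: "('p \<Rightarrow> nat) \<Rightarrow> 'p \<Rightarrow>\<^sub>0 nat" where
  "degree_exponent n = Abs_poly_mapping n"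

lemma lookup_degree_exponent [simp]: "Poly_Mapping.lookup (degree_exponent n) = n"
  by (simp add: degree_exponent_def Abs_poly_mapping_inverse)

lemma degree_exponent_add: "degree_exponent n + degree_exponent n' = degree_exponent (\<lambda>i. n i + n' i)"
  by (rule poly_mapping_eqI) (simp add: lookup_add)

lemma degree_exponent_0: "degree_exponent (\<lambda>_. 0) = 0"
  by (rule poly_mapping_eqI) simp

abbreviation graded_element :: "('p \<Rightarrow> nat) \<Rightarrow> ('v, 'k) mpol \<Rightarrow> ('p, ('v, 'k) mpol) mpol" where
  "graded_element n a \<equiv> Poly_Mapping.single (degree_exponent n) a"

lemma graded_element_mult: "graded_element n a * graded_element n' b = graded_element (\<lambda>i. n i + n' i) (a * b)"
  by (simp add: mult_single degree_exponent_add)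

lemma graded_element_power: "graded_element n a ^ i = graded_element (\<lambda>j. i * n j) (a ^ i)"
proof (induction i)
  case 0
  then show ?case by (simp add: degree_exponent_0)
next
  case (Suc i)
  show ?case unfolding power_Suc Suc graded_element_mult by (simp add: add.commute)
qed

lemma graded_element_sum: "(\<Sum>i\<in>A. graded_element n (a i)) = graded_element n (\<Sum>i\<in>A. a i)"
  by (induction A rule: infinite_finite_induct) (simp_all add: single_add)

abbreviation fiber_ring :: "('p, ('v, 'k) mpol) mpol set" where
  "fiber_ring \<equiv> multigraded_ring (special_fiber m \<delta> f)"

lemma graded_element_in_ring:
  assumes "0 \<in> M (\<lambda>i. 0)" "\<And>n. 0 \<in> M n"
  shows "graded_element n a \<in> multigraded_ring M \<longleftrightarrow> a \<in> M n"
proof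
  assume "graded_element n a \<in> multigraded_ring M"
  then have "Poly_Mapping.lookup (graded_element n a) (degree_exponent n) \<in> M (Poly_Mapping.lookup (degree_exponent n))"
    unfolding multigraded_ring_def by blast
  then show "a \<in> M n" by simp
next
  assume a: "a \<in> M n"
  have "Poly_Mapping.lookup (graded_element n a) \<mu> \<in> M (Poly_Mapping.lookup \<mu>)" for \<mu>
  proof (cases "degree_exponent n = \<mu>")
    case True
    then have "Poly_Mapping.lookup \<mu> = n" by auto
    then show ?thesis using True a by simp
  next
    case False
    then show ?thesis using assms(2) by (simp add: lookup_single when_def)
  qed
  then show "graded_element n a \<in> multigraded_ring M" unfolding multigraded_ring_def by blast
qed

lemma graded_element_in_fiber_ring: "graded_element n a \<in> fiber_ring \<longleftrightarrow> a \<in> rees_part 0 n"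
  using graded_element_in_ring[of "special_fiber m \<delta> f" n a] by (simp add: special_fiber_eq)

lemma graded_element_in_saturated_ring:
  "graded_element n a \<in> multigraded_ring (saturated_special_fiber m \<delta> f) \<longleftrightarrow> a \<in> saturated_fiber n"
  by (rule graded_element_in_ring) (simp_all add: fiber_subset_saturated)

text \<open>
  The homogeneous equation for \<open>g\<close>, with each coefficient multiplied by its power of
  \<open>T\<close>.
\<close>

theorem integral_over_fiber_ring:
  assumes g: "g \<in> saturated_fiber n"
  shows "integral_over (to_fract ` fiber_ring) (to_fract (graded_element n g))"
proof -
  obtain N a where N: "0 < N" and a: "\<forall>i<N. a i \<in> rees_part 0 (\<lambda>j. (N - i) * n j)" "g ^ N = (\<Sum>i<N. a i * g ^ i)"
    using saturated_element_integral[OF g] by (elim exE conjE)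
  define t where "t i = to_fract (graded_element (\<lambda>j. (N - i) * n j) (a i))" for i
  let ?z = "to_fract (graded_element n g)"
  define q where "q = Polynomial.monom 1 N - (\<Sum>i<N. Polynomial.monom (t i) i)"
  have coeff: "Polynomial.coeff q i = (if i = N then 1 else 0) - (if i < N then t i else 0)" for i
  proof -
    have "(\<Sum>k<N. Polynomial.coeff (Polynomial.monom (t k) k) i) = (\<Sum>k<N. if k = i then t i else 0)"
      by (rule sum.cong) auto
    also have "\<dots> = (if i < N then t i else 0)" by (simp add: sum.delta)
    finally show ?thesis by (simp add: q_def coeff_sum)
  qed
  have deg: "Polynomial.degree q = N"
  proof (rule antisym)
    show "Polynomial.degree q \<le> N" by (rule degree_le) (simp add: coeff)
    show "N \<le> Polynomial.degree q" by (rule le_degree) (simp add: coeff)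
  qed
  have to_fract_power: "to_fract y ^ k = to_fract (y ^ k)" for y :: "('p, ('v, 'k) mpol) mpol" and k
    by (induction k) simp_all
  have "t i * ?z ^ i = to_fract (graded_element (\<lambda>j. N * n j) (a i * g ^ i))" if "i < N" for i
  proof -
    have "(\<lambda>j. (N - i) * n j + i * n j) = (\<lambda>j. N * n j)"
      using that by (simp flip: distrib_right)
    then show ?thesis
      by (simp only: t_def to_fract_power to_fract_mult[symmetric] graded_element_power graded_element_mult)
  qed
  then have "(\<Sum>i<N. t i * ?z ^ i) = (\<Sum>i<N. to_fract (graded_element (\<lambda>j. N * n j) (a i * g ^ i)))"
    by (intro sum.cong) simp_all
  also have "\<dots> = to_fract (graded_element (\<lambda>j. N * n j) (\<Sum>i<N. a i * g ^ i))"
    by (simp only: to_fract_sum[symmetric] graded_element_sum)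
  also have "\<dots> = ?z ^ N"
    by (simp only: a(2)[symmetric] to_fract_power graded_element_power)
  finally have "poly q ?z = 0"
    by (simp add: q_def poly_sum poly_monom)
  moreover have "lead_coeff q = 1" by (simp add: deg coeff)
  moreover have "Polynomial.coeff q i \<in> to_fract ` fiber_ring" for i
  proof -
    have one: "1 \<in> to_fract ` fiber_ring"
    proof (rule image_eqI)
      show "1 = to_fract (graded_element (\<lambda>_. 0) 1)" by (simp add: degree_exponent_0)
      show "graded_element (\<lambda>_. 0) 1 \<in> fiber_ring" unfolding graded_element_in_fiber_ring by (rule one_in_fiber)
    qed
    have zero: "0 \<in> to_fract ` fiber_ring"
    proof (rule image_eqI)
      show "0 = to_fract (graded_element (\<lambda>_. 0) 0)" by simp
      show "graded_element (\<lambda>_. 0) 0 \<in> fiber_ring" unfolding graded_element_in_fiber_ring by simp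
    qed
    have "- t i \<in> to_fract ` fiber_ring" if i: "i < N"
    proof (rule image_eqI)
      show "- t i = to_fract (graded_element (\<lambda>j. (N - i) * n j) (- a i))" by (simp add: t_def single_uminus)
      show "graded_element (\<lambda>j. (N - i) * n j) (- a i) \<in> fiber_ring"
        unfolding graded_element_in_fiber_ring using a(1) i by (intro rees_part_uminus) simp
    qed
    then show ?thesis using one zero by (simp add: coeff)
  qed
  ultimately show ?thesis unfolding integral_over_def by (intro exI[of _ q] conjI allI)
qed

theorem saturated_fiber_eq_of_birational:
  assumes closed: "integrally_closed fiber_ring"
    and fin: "generically_finite m f" and D: "map_degree m f = 1"
  shows "saturated_fiber n = rees_part 0 n"
proof (rule antisym; rule subsetI)
  fix g assume g: "g \<in> saturated_fiber n"
  obtain n' a b c where *: "a \<in> rees_part 0 n" "b \<in> rees_part 0 n'" "c \<in> rees_part 0 n'" "c \<noteq> 0" "g * c = a * b"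
    using fraction_of_saturated_element[OF fin D g] by (elim exE conjE)
  let ?u = "graded_element (\<lambda>i. n i + n' i) (a * b)" and ?w = "graded_element n' c"
  have u: "?u \<in> fiber_ring" unfolding graded_element_in_fiber_ring by (rule rees_part_fiber_mult[OF *(1,2)])
  have w: "?w \<in> fiber_ring" unfolding graded_element_in_fiber_ring by (rule *(3))
  have w0: "?w \<noteq> 0"
  proof
    assume "?w = 0"
    then have "Poly_Mapping.lookup ?w (degree_exponent n') = 0" by (simp only: lookup_zero)
    with *(4) show False by simp
  qed
  have "graded_element n g * ?w = ?u" by (simp only: graded_element_mult *(5))
  then have "to_fract (graded_element n g) * to_fract ?w = to_fract ?u"
    by (simp only: to_fract_mult[symmetric])
  moreover have "to_fract ?w \<noteq> 0" using w0 by (simp only: to_fract_eq_0_iff not_False_eq_True)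
  ultimately have eq: "to_fract (graded_element n g) = Fract ?u ?w"
    unfolding Fract_conv_to_fract by (intro eq_divide_imp)
  have "integral_over (to_fract ` fiber_ring) (Fract ?u ?w)"
    using integral_over_fiber_ring[OF g] by (simp only: eq)
  then have "Fract ?u ?w \<in> to_fract ` fiber_ring"
    using closed u w w0 unfolding integrally_closed_def by blast
  then obtain y where "y \<in> fiber_ring" "to_fract (graded_element n g) = to_fract y"
    unfolding eq[symmetric] by (elim imageE)
  then have "graded_element n g \<in> fiber_ring" by (simp only: to_fract_eq_iff)
  then show "g \<in> rees_part 0 n" by (simp only: graded_element_in_fiber_ring)
qed (rule fiber_subset_saturated)

text \<open>A family of at least two elements of a domain is dependent over it.\<close>

theorem map_degree_eq_1:
  assumes fin: "generically_finite m f"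
    and eq: "multigraded_ring (saturated_special_fiber m \<delta> f) = fiber_ring"
  shows "map_degree m f = 1"
proof (rule ccontr)
  assume "map_degree m f \<noteq> 1"
  then have D: "1 < map_degree m f" using map_degree_pos[OF fin] by linarith
  obtain c g where g0: "\<forall>i<map_degree m f. g i \<in> saturated_fiber c"
    and ind: "\<forall>n q. (\<forall>i<map_degree m f. q i \<in> rees_part 0 n) \<longrightarrow> (\<Sum>i<map_degree m f. q i * g i) = 0 \<longrightarrow> (\<forall>i<map_degree m f. q i = 0)"
    using independent_saturated_elements[OF fin refl] by (elim exE conjE)
  have fiber: "g i \<in> rees_part 0 c" if "i < map_degree m f" for i
  proof -
    have "graded_element c (g i) \<in> fiber_ring"
      unfolding eq[symmetric] graded_element_in_saturated_ring using g0 that by simp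
    then show ?thesis by (simp only: graded_element_in_fiber_ring)
  qed
  have sum2: "(\<Sum>i<map_degree m f. (if i = 0 then a else if i = 1 then b else 0) * g i) = a * g 0 + b * g 1"
    for a b :: "('v, 'k) mpol"
  proof -
    have "(\<Sum>i<map_degree m f. (if i = 0 then a else if i = 1 then b else 0) * g i) =
        (\<Sum>i\<in>{0, 1}. (if i = 0 then a else if i = 1 then b else 0) * g i)"
      by (rule sum.mono_neutral_right) (use D in auto)
    then show ?thesis by simp
  qed
  let ?q = "\<lambda>a b i. if i = 0 then a else if i = (1::nat) then b else (0 :: ('v, 'k) mpol)"
  have h1: "\<forall>i<map_degree m f. ?q (g 1) (- g 0) i = 0"
  proof (rule ind[THEN spec, THEN spec, THEN mp, THEN mp])
    show "\<forall>i<map_degree m f. ?q (g 1) (- g 0) i \<in> rees_part 0 c"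
      using fiber D rees_part_uminus by simp
    show "(\<Sum>i<map_degree m f. ?q (g 1) (- g 0) i * g i) = 0"
      unfolding sum2 by (simp add: mult.commute)
  qed
  have g1: "g 1 = 0" using h1[rule_format, of 0] D by simp
  have h2: "\<forall>i<map_degree m f. ?q 0 1 i = 0"
  proof (rule ind[THEN spec, THEN spec, THEN mp, THEN mp])
    show "\<forall>i<map_degree m f. ?q 0 1 i \<in> rees_part 0 (\<lambda>_. 0)"
      using one_in_fiber by simp
    show "(\<Sum>i<map_degree m f. ?q 0 1 i * g i) = 0"
      unfolding sum2 g1 by simp
  qed
  show False using h2[rule_format, of 1] D by simp
qed

end

theorem theorem3p6:
  fixes f :: "'p::{finite,linorder} \<Rightarrow> nat \<Rightarrow> ('v::{finite,linorder}, 'k::field) mpol"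
    and m \<delta> :: "'p \<Rightarrow> nat"
    and r :: nat
  assumes "card (UNIV :: 'v set) = r + 1"
    and "\<And>i. \<delta> i \<ge> 1"
    and "\<And>i j. j \<le> m i \<Longrightarrow> homogeneous (\<delta> i) (f i j)"
    and "\<And>i. \<exists>j\<le>m i. f i j \<noteq> 0"
    and "generically_finite m f"
  shows "(\<forall>d :: 'p \<Rightarrow> nat. (\<Sum>i\<in>UNIV. d i) = r \<longrightarrow>
            mixed_multiplicity d (saturated_special_fiber m \<delta> f) =
              of_nat (map_degree m f) * multidegree_image d m \<delta> f) \<and>
         (integrally_closed (multigraded_ring (special_fiber m \<delta> f)) \<longrightarrow>
            (birational_map m f \<longleftrightarrow>
              multigraded_ring (saturated_special_fiber m \<delta> f) =
              multigraded_ring (special_fiber m \<delta> f)))"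
proof -
  interpret rational_map m \<delta> f
    by (rule rational_map.intro) (fact assms(3), fact assms(4))
  have birational: "birational_map m f \<longleftrightarrow> map_degree m f = 1"
    using assms(5) by (simp add: birational_map_def)
  have "multigraded_ring (saturated_special_fiber m \<delta> f) = multigraded_ring (special_fiber m \<delta> f)"
    if "integrally_closed (multigraded_ring (special_fiber m \<delta> f))" "map_degree m f = 1"
  proof -
    have "saturated_special_fiber m \<delta> f = special_fiber m \<delta> f"
      by (rule ext) (simp only: saturated_fiber_eq_of_birational[OF that(1) assms(5) that(2)] special_fiber_eq)
    then show ?thesis by simp
  qed
  then show ?thesis
    unfolding birational multidegree_image_def
    using mixed_multiplicity_saturated[OF assms(1,5)] map_degree_eq_1[OF assms(5)] by blast
qed

end
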